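(* Let $K$ be an interface element. The space $\mathbf{V}^f_h(K)$ is unisolvent with respect to the degrees of freedom $\{\mathbf{v}_h|_F\cdot\mathbf{n}_F,\ F\in\mathcal{F}_K\}$.
   Context: $\Omega\subseteq\mathbb{R}^3$ is an open bounded domain, $\Omega^-\subseteq\Omega$ a subdomain, $\Omega^+=\Omega\setminus\overline{\Omega^-}$, and $\Gamma=\partial\Omega^-$ is a sufficiently smooth interface. $\alpha$ is piecewise constant with positive values $\alpha^\pm$ on $\Omega^\pm$. $\mathcal{T}_h$ is a shape-regular tetrahedral mesh of $\Omega$ generated independently of the interface; an (open) element $K\in\mathcal{T}_h$ is an interface element if it meets $\Gamma$. Boundary triangulation assumption: each face of an interface element $K$ is triangulated, with the maximum angle condition, using only the vertices of $K$ and the points where $\Gamma$ cuts the edges of $K$ as vertices; if a face is cut by $\Gamma$, the curve (face $\cap\,\Gamma$) is approximated by an edge of this triangulation with error $\mathcal{O}(h_K^2)$. $\mathcal{F}_K$ denotes the set of triangles of the resulting triangulation of $\partial K$; $\mathbf{n}$ (on $F$: $\mathbf{n}_F$) is the outward unit normal. With $\mathcal{P}_0$ denoting constants, set $\mathcal{B}^f_h(\partial K)=\{v_h:\ v_h|_T\in\mathcal{P}_0(T)\ \forall T\in\mathcal{F}_K\}$ and $$\mathbf{V}^f_h(K)=\{\mathbf{v}_h\in\mathbf{H}(\mathrm{div};K):\ \mathrm{div}(\mathbf{v}_h)\in\mathcal{P}_0(K),\ \mathbf{v}_h\cdot\mathbf{n}|_{\partial K}\in\mathcal{B}^f_h(\partial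 K),\ \alpha\mathbf{v}_h\in\mathbf{H}(\mathrm{curl};K),\ \mathrm{curl}(\alpha\mathbf{v}_h)=\mathbf{0}\}.$$ Unisolvence means that the given functionals form a basis of the dual of the space. *)

theory Defs
  imports "HOL-Analysis.Analysis"
begin

definition partial :: "3 \<Rightarrow> (real^3 \<Rightarrow> real) \<Rightarrow> real^3 \<Rightarrow> real" where
  "partial i f x = frechet_derivative f (at x) (axis i 1)"

definition gradient :: "(real^3 \<Rightarrow> real) \<Rightarrow> real^3 \<Rightarrow> real^3" where
  "gradient f x = (\<chi> i. partial i f x)"

definition curl :: "(real^3 \<Rightarrow> real^3) \<Rightarrow> real^3 \<Rightarrow> real^3" where
  "curl \<psi> x = vector
     [partial 2 (\<lambda>y. \<psi> y $ 3) x - partial 3 (\<lambda>y. \<psi> y $ 2) x,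
      partial 3 (\<lambda>y. \<psi> y $ 1) x - partial 1 (\<lambda>y. \<psi> y $ 3) x,
      partial 1 (\<lambda>y. \<psi> y $ 2) x - partial 2 (\<lambda>y. \<psi> y $ 1) x]"

text \<open>The class \<open>C\<^sup>k(U)\<close>; meaningful for open \<open>U\<close>.\<close>

primrec Ck_on :: "nat \<Rightarrow> (real^3) set \<Rightarrow> (real^3 \<Rightarrow> real) \<Rightarrow> bool" where
  "Ck_on 0 U f \<longleftrightarrow> continuous_on U f"
| "Ck_on (Suc k) U f \<longleftrightarrow> (\<forall>x\<in>U. f differentiable (at x)) \<and> (\<forall>i. Ck_on k U (partial i f))"

definition smooth_on :: "(real^3) set \<Rightarrow> (real^3 \<Rightarrow> real) \<Rightarrow> bool" where
  "smooth_on U f \<longleftrightarrow> (\<forall>k. Ck_on k U f)"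

definition test_function :: "(real^3) set \<Rightarrow> (real^3 \<Rightarrow> real) \<Rightarrow> bool" where
  "test_function U \<phi> \<longleftrightarrow> smooth_on UNIV \<phi> \<and>
     compact (closure {x. \<phi> x \<noteq> 0}) \<and> closure {x. \<phi> x \<noteq> 0} \<subseteq> U"

definition test_field :: "(real^3) set \<Rightarrow> (real^3 \<Rightarrow> real^3) \<Rightarrow> bool" where
  "test_field U \<psi> \<longleftrightarrow> (\<forall>i. test_function U (\<lambda>x. \<psi> x $ i))"

text \<open>\<open>\<Gamma>\<close> is locally a regular level set of a \<open>C\<^sup>2\<close> function.\<close>

definition C2_surface :: "(real^3) set \<Rightarrow> bool" where
  "C2_surface \<Gamma> \<longleftrightarrow> (\<forall>p\<in>\<Gamma>. \<exists>U f. open U \<and> p \<in> U \<and> Ck_on 2 U f \<and>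
     (\<forall>x\<in>U. gradient f x \<noteq> 0) \<and> \<Gamma> \<inter> U = {x\<in>U. f x = 0})"

definition open_tetrahedron :: "(real^3) set \<Rightarrow> bool" where
  "open_tetrahedron K \<longleftrightarrow> (\<exists>S. 3 simplex S \<and> K = interior S)"

definition tetrahedral_mesh :: "(real^3) set \<Rightarrow> (real^3) set set \<Rightarrow> bool" where
  "tetrahedral_mesh \<Omega> \<T> \<longleftrightarrow> (\<forall>K\<in>\<T>. open_tetrahedron K \<and> K \<subseteq> \<Omega>) \<and>
     triangulation (closure ` \<T>) \<and> (\<Union>K\<in>\<T>. closure K) = closure \<Omega>"

text \<open>The ratio of the diameter to the radius of an inscribed ball is bounded by \<open>\<sigma>\<close>.\<close>

definition shape_regular :: "real \<Rightarrow> (real^3) set set \<Rightarrow> bool" where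
  "shape_regular \<sigma> \<T> \<longleftrightarrow> (\<forall>K\<in>\<T>. \<exists>x r. 0 < r \<and> ball x r \<subseteq> K \<and> diameter K \<le> \<sigma> * r)"

definition angle_at :: "real^3 \<Rightarrow> real^3 \<Rightarrow> real^3 \<Rightarrow> real" where
  "angle_at a b c = arccos (((b - a) \<bullet> (c - a)) / (norm (b - a) * norm (c - a)))"

definition max_angle_condition :: "real \<Rightarrow> (real^3) set set \<Rightarrow> bool" where
  "max_angle_condition \<theta> \<F> \<longleftrightarrow>
     (\<forall>a b c. convex hull {a, b, c} \<in> \<F> \<longrightarrow> angle_at a b c \<le> \<theta>)"

text \<open>
  \<open>\<F>\<close> consists of triangulations of the faces of \<open>K\<close> whose vertices are vertices of \<open>K\<close> or points
  where \<open>\<Gamma>\<close> cuts the edges of \<open>K\<close>.  The constants \<open>\<theta> < \<pi>\<close> (maximum angle) and \<open>C\<close> (in the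
  Hausdorff distance bound \<open>C h\<^sub>K\<^sup>2\<close> between the curve of intersection and an edge) are parameters.
\<close>

definition boundary_triangulation ::
    "(real^3) set \<Rightarrow> real \<Rightarrow> real \<Rightarrow> (real^3) set \<Rightarrow> (real^3) set set \<Rightarrow> bool" where
  "boundary_triangulation \<Gamma> \<theta> C K \<F> \<longleftrightarrow>
     (\<forall>F\<in>\<F>. 2 simplex F \<and> (\<exists>G. G facet_of closure K \<and> F \<subseteq> G)) \<and>
     (\<forall>F\<in>\<F>. \<forall>p. p extreme_point_of F \<longrightarrow>
        p extreme_point_of closure K \<or> (\<exists>e. e edge_of closure K \<and> p \<in> e \<inter> \<Gamma>)) \<and>
     max_angle_condition \<theta> \<F> \<and>
     (\<forall>G. G facet_of closure K \<longrightarrow>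
        triangulation {F\<in>\<F>. F \<subseteq> G} \<and> \<Union>{F\<in>\<F>. F \<subseteq> G} = G \<and>
        (rel_interior G \<inter> \<Gamma> \<noteq> {} \<longrightarrow>
          (\<exists>F\<in>\<F>. \<exists>e. F \<subseteq> G \<and> e edge_of F \<and>
             (\<forall>x\<in>G \<inter> \<Gamma>. infdist x e \<le> C * (diameter K)\<^sup>2) \<and>
             (\<forall>y\<in>e. infdist y (G \<inter> \<Gamma>) \<le> C * (diameter K)\<^sup>2))))"

text \<open>
  The integral of \<open>f\<close> over the triangle \<open>G\<close> with respect to surface area, by the affine
  parametrisation \<open>(s,t) \<mapsto> a + s (b - a) + t (c - a)\<close>.  It does not depend on the labelling
  \<open>a, b, c\<close> of the vertices of \<open>G\<close> that is chosen.
\<close>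

definition triangle_integral :: "(real^3) set \<Rightarrow> (real^3 \<Rightarrow> real) \<Rightarrow> real" where
  "triangle_integral G f =
     (let (a, b, c) = (SOME (a, b, c). G = convex hull {a, b, c})
      in norm (cross3 (b - a) (c - a)) *
         (LINT p|lebesgue_on {(s::real, t::real). 0 \<le> s \<and> 0 \<le> t \<and> s + t \<le> 1}.
            f (a + fst p *\<^sub>R (b - a) + snd p *\<^sub>R (c - a))))"

definition boundary_integral :: "(real^3) set \<Rightarrow> (real^3 \<Rightarrow> real) \<Rightarrow> real" where
  "boundary_integral K f = (\<Sum>G | G facet_of closure K. triangle_integral G f)"

text \<open>
  Elements of the function spaces are represented by functions on the whole of space of which only
  the values on \<open>K\<close>, up to null sets, are relevant.
\<close>

definition L2_on :: "(real^3) set \<Rightarrow> (real^3 \<Rightarrow> 'a::euclidean_space) \<Rightarrow> bool" where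
  "L2_on K v \<longleftrightarrow> v \<in> borel_measurable (lebesgue_on K) \<and>
     integrable (lebesgue_on K) (\<lambda>x. (norm (v x))\<^sup>2)"

definition has_weak_div :: "(real^3) set \<Rightarrow> (real^3 \<Rightarrow> real^3) \<Rightarrow> (real^3 \<Rightarrow> real) \<Rightarrow> bool" where
  "has_weak_div K v d \<longleftrightarrow> L2_on K v \<and> L2_on K d \<and>
     (\<forall>\<phi>. test_function K \<phi> \<longrightarrow>
        (LINT x|lebesgue_on K. v x \<bullet> gradient \<phi> x) = - (LINT x|lebesgue_on K. d x * \<phi> x))"

definition Hdiv :: "(real^3) set \<Rightarrow> (real^3 \<Rightarrow> real^3) set" where
  "Hdiv K = {v. \<exists>d. has_weak_div K v d}"

definition has_weak_curl :: "(real^3) set \<Rightarrow> (real^3 \<Rightarrow> real^3) \<Rightarrow> (real^3 \<Rightarrow> real^3) \<Rightarrow> bool" where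
  "has_weak_curl K w r \<longleftrightarrow> L2_on K w \<and> L2_on K r \<and>
     (\<forall>\<psi>. test_field K \<psi> \<longrightarrow>
        (LINT x|lebesgue_on K. w x \<bullet> curl \<psi> x) = (LINT x|lebesgue_on K. r x \<bullet> \<psi> x))"

definition Hcurl :: "(real^3) set \<Rightarrow> (real^3 \<Rightarrow> real^3) set" where
  "Hcurl K = {w. \<exists>r. has_weak_curl K w r}"

text \<open>
  \<open>v \<cdot> n = g\<close> on the boundary of \<open>K\<close>, with the outward unit normal \<open>n\<close>.  The normal trace of a field
  in \<open>H(div; K)\<close> is the functional given by Green's formula
  \<open>\<langle>v \<cdot> n, \<phi>\<rangle> = \<integral>\<^sub>K v \<cdot> \<nabla>\<phi> + \<integral>\<^sub>K (div v) \<phi>\<close>; restrictions to \<open>K\<close> of smooth functions on the whole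
  space suffice as \<open>\<phi>\<close>, since they are dense in \<open>H\<^sup>1(K)\<close>.
\<close>

definition has_normal_trace :: "(real^3) set \<Rightarrow> (real^3 \<Rightarrow> real^3) \<Rightarrow> (real^3 \<Rightarrow> real) \<Rightarrow> bool" where
  "has_normal_trace K v g \<longleftrightarrow> (\<exists>d. has_weak_div K v d \<and>
     (\<forall>\<phi>. smooth_on UNIV \<phi> \<longrightarrow>
        (LINT x|lebesgue_on K. v x \<bullet> gradient \<phi> x) + (LINT x|lebesgue_on K. d x * \<phi> x)
          = boundary_integral K (\<lambda>x. g x * \<phi> x)))"

text \<open>Values on the edges of the triangles do not matter, hence the relative interiors.\<close>

definition Bf :: "(real^3) set set \<Rightarrow> (real^3 \<Rightarrow> real) set" where
  "Bf \<F> = {g. \<forall>F\<in>\<F>. \<exists>c. \<forall>x\<in>rel_interior F. g x = c}"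

definition Vf :: "(real^3 \<Rightarrow> real) \<Rightarrow> (real^3) set \<Rightarrow> (real^3) set set \<Rightarrow> (real^3 \<Rightarrow> real^3) set" where
  "Vf \<alpha> K \<F> = {v \<in> Hdiv K.
     (\<exists>c. has_weak_div K v (\<lambda>_. c)) \<and>
     (\<exists>g\<in>Bf \<F>. has_normal_trace K v g) \<and>
     (\<lambda>x. \<alpha> x *\<^sub>R v x) \<in> Hcurl K \<and>
     has_weak_curl K (\<lambda>x. \<alpha> x *\<^sub>R v x) (\<lambda>_. 0)}"

definition dof :: "(real^3) set \<Rightarrow> (real^3) set set \<Rightarrow> (real^3) set \<Rightarrow> (real^3 \<Rightarrow> real^3) \<Rightarrow> real" where
  "dof K \<F> F v = (THE c. \<exists>g\<in>Bf \<F>. has_normal_trace K v g \<and> (\<forall>x\<in>rel_interior F. g x = c))"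

text \<open>
  Linear functionals on a space \<open>V\<close> of fields on \<open>K\<close>, where fields that agree almost everywhere on
  \<open>K\<close> are the same element of the space.  Only the values of a functional on \<open>V\<close> are relevant.
\<close>

definition dual_space ::
    "(real^3) set \<Rightarrow> (real^3 \<Rightarrow> real^3) set \<Rightarrow> ((real^3 \<Rightarrow> real^3) \<Rightarrow> real) set" where
  "dual_space K V = {l.
     (\<forall>u\<in>V. \<forall>v\<in>V. l (\<lambda>x. u x + v x) = l u + l v) \<and>
     (\<forall>c. \<forall>v\<in>V. l (\<lambda>x. c *\<^sub>R v x) = c * l v) \<and>
     (\<forall>u\<in>V. \<forall>v\<in>V. (AE x in lebesgue_on K. u x = v x) \<longrightarrow> l u = l v)}"

text \<open>
  The finite family \<open>\<Lambda> i\<close>, \<open>i \<in> I\<close>, is a basis of the dual of \<open>V\<close>: its members lie in the dual, are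
  linearly independent, and span it.
\<close>

definition unisolvent ::
    "(real^3) set \<Rightarrow> (real^3 \<Rightarrow> real^3) set \<Rightarrow> 'i set \<Rightarrow> ('i \<Rightarrow> (real^3 \<Rightarrow> real^3) \<Rightarrow> real) \<Rightarrow> bool" where
  "unisolvent K V I \<Lambda> \<longleftrightarrow> finite I \<and>
     (\<forall>i\<in>I. \<Lambda> i \<in> dual_space K V) \<and>
     (\<forall>c. (\<forall>v\<in>V. (\<Sum>i\<in>I. c i * \<Lambda> i v) = 0) \<longrightarrow> (\<forall>i\<in>I. c i = 0)) \<and>
     (\<forall>l\<in>dual_space K V. \<exists>c. \<forall>v\<in>V. l v = (\<Sum>i\<in>I. c i * \<Lambda> i v))"

end

theory Submission
  imports Defs
begin

text \<open>
  Existence. Extending data \<open>g\<close> that are constant on each triangle radially from every face of \<open>K\<close>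
  towards the opposite vertex gives an explicit bounded field with normal trace \<open>g\<close>; together with the
  Poincare inequality it shows that the Neumann problem \<open>div (\<alpha>\<^sup>-\<^sup>1 \<nabla>u) = const\<close> with flux \<open>g\<close> is a Riesz
  representation problem on the closure of the gradients of smooth functions in \<open>L\<^sup>2(K)\<close>. The interface is
  a null set, so \<open>\<alpha>\<close> may be replaced by a measurable function with two values.

  Uniqueness. If all degrees of freedom of \<open>v\<close> vanish, then \<open>v\<close> is orthogonal to the gradients of all
  smooth functions. As \<open>K\<close> is convex, contracting and mollifying the curl-free field \<open>\<alpha> v\<close> gives smooth
  fields that are curl-free on all of \<open>K\<close>, hence gradients by the Poincare lemma, and that converge weakly to
  \<open>\<alpha> v\<close>. Therefore \<open>\<integral> \<alpha> \<bar>v\<bar>\<^sup>2 = 0\<close>.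

  The normal trace determines its value on a triangle by testing with bump functions supported near a
  relative interior point.
\<close>

section \<open>Smooth functions\<close>

text \<open>Two facts carry unisolvence: every coefficient vector on the triangles is the flux of a
  field in the space, and a field with zero fluxes vanishes almost everywhere. The fields with unit
  fluxes then form a dual basis, so finite dimension is a by-product. The data obey no compatibility
  condition, because the divergence may be any constant and adjusts itself to the total flux. The
  obstacle to existence is to bound the boundary functional by the norm of the gradient. The cone
  fields turn it into volume integrals, where Cauchy-Schwarz applies; their Jacobian constant can
  stay abstract because it is divided out. Subtracting the mean divergence makes the remaining
  volume term blind to constants, as the Poincare inequality requires. Sobolev spaces of potentials
  are bypassed on both sides. For existence only the limit of the gradients in
  \<open>L2_on K\<close> is formed, and it inherits the vanishing weak curl. For uniqueness the
  approximants of \<open>\<alpha> v\<close> need only converge weakly, since each of them is already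
  orthogonal to \<open>v\<close>.\<close>

lemma partial_eqI: "(f has_derivative D) (at x) \<Longrightarrow> partial i f x = D (axis i 1)"
  unfolding partial_def using frechet_derivative_at by metis

lemma gradient_nth [simp]: "gradient f x $ i = partial i f x"
  by (simp add: gradient_def)

lemma has_derivative_gradient:
  assumes "f differentiable (at x)"
  shows "(f has_derivative (\<lambda>h. gradient f x \<bullet> h)) (at x)"
proof -
  have D: "(f has_derivative frechet_derivative f (at x)) (at x)"
    using assms frechet_derivative_works by blast
  have lin: "linear (frechet_derivative f (at x))" using assms linear_frechet_derivative by blast
  have "frechet_derivative f (at x) h = gradient f x \<bullet> h" for h
  proof -
    have "frechet_derivative f (at x) h = frechet_derivative f (at x) (\<Sum>i\<in>UNIV. h $ i *\<^sub>R axis i 1)"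
      using basis_expansion[of h] by (simp add: scalar_mult_eq_scaleR)
    also have "\<dots> = (\<Sum>i\<in>UNIV. h $ i * partial i f x)"
      by (simp add: linear_sum[OF lin] linear_scale[OF lin] partial_def)
    also have "\<dots> = gradient f x \<bullet> h" by (simp add: inner_vec_def mult.commute)
    finally show ?thesis .
  qed
  then have "frechet_derivative f (at x) = (\<lambda>h. gradient f x \<bullet> h)" by blast
  with D show ?thesis by simp
qed

lemma partial_add:
  "f differentiable (at x) \<Longrightarrow> g differentiable (at x) \<Longrightarrow>
   partial i (\<lambda>x. f x + g x) x = partial i f x + partial i g x"
  by (subst partial_eqI[OF has_derivative_add[OF has_derivative_gradient has_derivative_gradient]])
     (auto simp: inner_axis)

lemma partial_mult:
  "f differentiable (at x) \<Longrightarrow> g differentiable (at x) \<Longrightarrow>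
   partial i (\<lambda>x. f x * g x) x = f x * partial i g x + partial i f x * g x"
  by (subst partial_eqI[OF has_derivative_mult[OF has_derivative_gradient has_derivative_gradient]])
     (auto simp: inner_axis)

lemma partial_const [simp]: "partial i (\<lambda>x. c) x = 0"
  by (subst partial_eqI[OF has_derivative_const]) auto

lemma partial_coord: "partial i (\<lambda>x. x $ j) x = (if i = j then 1 else 0)"
proof -
  have "((\<lambda>x. x $ j) has_derivative (\<lambda>x. x $ j)) (at x)" for x :: "real^3"
    by (rule bounded_linear.has_derivative[OF bounded_linear_vec_nth has_derivative_ident])
  from partial_eqI[OF this] show ?thesis by (auto simp: axis_def)
qed

text \<open>\<open>PC k f\<close>: \<open>f\<close> is \<open>C\<^sup>k\<close> in its first argument, with partial derivatives that are jointly continuous in both.\<close>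

primrec PC :: "nat \<Rightarrow> (real^3 \<Rightarrow> 'p::topological_space \<Rightarrow> real) \<Rightarrow> bool" where
  "PC 0 f \<longleftrightarrow> continuous_on UNIV (\<lambda>z. f (fst z) (snd z))"
| "PC (Suc k) f \<longleftrightarrow> continuous_on UNIV (\<lambda>z. f (fst z) (snd z)) \<and>
     (\<forall>x y. (\<lambda>x. f x y) differentiable (at x)) \<and>
     (\<forall>i. PC k (\<lambda>x y. partial i (\<lambda>x. f x y) x))"

lemma PC_continuous: "PC k f \<Longrightarrow> continuous_on UNIV (\<lambda>z. f (fst z) (snd z))"
  by (cases k) auto

text \<open>The product rule leaves one factor undifferentiated, so the induction in
  \<open>PC_mult\<close> has to reuse a factor of class k + 1 as one of class k.\<close>

lemma PC_Suc: "PC (Suc k) f \<Longrightarrow> PC k f"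
  by (induction k arbitrary: f) auto

lemma PC_add: "PC k f \<Longrightarrow> PC k g \<Longrightarrow> PC k (\<lambda>x y. f x y + g x y)"
proof (induction k arbitrary: f g)
  case 0 then show ?case by (auto intro: continuous_intros)
next
  case (Suc k) then show ?case by (auto intro!: continuous_intros simp: partial_add)
qed

lemma PC_mult: "PC k f \<Longrightarrow> PC k g \<Longrightarrow> PC k (\<lambda>x y. f x y * g x y)"
proof (induction k arbitrary: f g)
  case 0 then show ?case by (auto intro: continuous_intros)
next
  case (Suc k)
  then have "PC k (\<lambda>x y. f x y * partial i (\<lambda>x. g x y) x + partial i (\<lambda>x. f x y) x * g x y)" for i
    using PC_Suc[OF Suc.prems(1)] PC_Suc[OF Suc.prems(2)] by (intro PC_add Suc.IH) auto
  with Suc.prems show ?case by (auto intro!: continuous_intros simp: partial_mult)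
qed

lemma PC_const:
  fixes c :: "'b::topological_space \<Rightarrow> real"
  assumes "continuous_on UNIV c"
  shows "PC k (\<lambda>x y. c y)"
proof -
  have cont: "continuous_on UNIV (\<lambda>z. c (snd z))" if "continuous_on UNIV c" for c :: "'b \<Rightarrow> real"
    using continuous_on_compose2[OF that continuous_on_snd[OF continuous_on_id]] by simp
  have 0: "PC k (\<lambda>x (y::'b). 0)" for k by (induction k) auto
  show ?thesis using cont[OF assms] 0 by (cases k) auto
qed

lemma PC_coord: "PC k (\<lambda>x y. x $ j)"
proof (cases k)
  case 0 then show ?thesis by (auto intro!: continuous_intros)
next
  case (Suc l)
  have "PC l (\<lambda>x (y::'a). c)" for c by (rule PC_const) simp
  with Suc show ?thesis
    by (auto intro!: continuous_intros bounded_linear_imp_differentiable bounded_linear_vec_nth simp: partial_coord)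
qed

lemma PC_sum: "finite I \<Longrightarrow> (\<And>i. i \<in> I \<Longrightarrow> PC k (f i)) \<Longrightarrow> PC k (\<lambda>x y. \<Sum>i\<in>I. f i x y)"
  by (induction I rule: finite_induct) (simp_all add: PC_const PC_add)

lemma PC_prod: "finite I \<Longrightarrow> (\<And>i. i \<in> I \<Longrightarrow> PC k (f i)) \<Longrightarrow> PC k (\<lambda>x y. \<Prod>i\<in>I. f i x y)"
  by (induction I rule: finite_induct) (simp_all add: PC_const PC_mult)

section \<open>Smoothness with and without a parameter\<close>

lemma differentiable_at_imp_continuous_on:
  "(\<And>x. x \<in> U \<Longrightarrow> f differentiable (at x)) \<Longrightarrow> continuous_on U f"
  by (meson continuous_at_imp_continuous_on differentiable_imp_continuous_within)

lemma Ck_on_continuous: "Ck_on k U f \<Longrightarrow> continuous_on U f"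
  by (cases k) (auto intro: differentiable_at_imp_continuous_on)

lemma Ck_on_if_PC: "PC k (\<lambda>x (y::real). f x) \<Longrightarrow> Ck_on k UNIV f"
proof (induction k arbitrary: f)
  case 0
  have "continuous_on UNIV (\<lambda>x. f (fst (x, 0::real)))"
    by (rule continuous_on_compose2[OF 0[unfolded PC.simps], where f = "\<lambda>x. (x, 0)"])
       (auto intro!: continuous_on_Pair)
  then show ?case by simp
qed auto

lemma partial_affine:
  assumes "f differentiable (at (s *\<^sub>R x + c))"
  shows "partial i (\<lambda>x. f (s *\<^sub>R x + c)) x = s * partial i f (s *\<^sub>R x + c)"
    and "(\<lambda>x. f (s *\<^sub>R x + c)) differentiable (at x)"
proof -
  have D: "((\<lambda>x. f (s *\<^sub>R x + c)) has_derivative (\<lambda>h. gradient f (s *\<^sub>R x + c) \<bullet> (s *\<^sub>R h))) (at x)"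
    by (rule has_derivative_compose[where f = "\<lambda>x. s *\<^sub>R x + c" and f' = "\<lambda>h. s *\<^sub>R h" and s = UNIV,
          OF _ has_derivative_gradient[OF assms]]) (auto intro!: derivative_eq_intros)
  from partial_eqI[OF this] show "partial i (\<lambda>x. f (s *\<^sub>R x + c)) x = s * partial i f (s *\<^sub>R x + c)"
    by (simp add: inner_axis)
  from D show "(\<lambda>x. f (s *\<^sub>R x + c)) differentiable (at x)" by (auto simp: differentiable_def)
qed

text \<open>This form covers every parameter dependence that occurs later: translations, the segment
  from a base point to x, and the dilated mollifier. Each derivative in x brings out only the factor
  \<open>s y\<close>, which is constant in x, so the induction closes.\<close>

lemma PC_affine:
  assumes "Ck_on k UNIV f" "continuous_on UNIV s" "continuous_on UNIV c"
  shows "PC k (\<lambda>x y. f (s y *\<^sub>R x + c y))"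
proof -
  have cont: "continuous_on UNIV (\<lambda>z. f (s (snd z) *\<^sub>R fst z + c (snd z)))" if "continuous_on UNIV f"
    for f :: "real^3 \<Rightarrow> real"
  proof (rule continuous_on_compose2[OF that])
    show "continuous_on UNIV (\<lambda>z. s (snd z) *\<^sub>R fst z + c (snd z))"
      using continuous_on_compose2[OF assms(2) continuous_on_snd[OF continuous_on_id]]
        continuous_on_compose2[OF assms(3) continuous_on_snd[OF continuous_on_id]]
      by (intro continuous_intros) auto
  qed simp
  show ?thesis
    using assms(1)
  proof (induction k arbitrary: f)
    case 0 with cont show ?case by simp
  next
    case (Suc k)
    have "PC k (\<lambda>x y. s y * partial i f (s y *\<^sub>R x + c y))" for i
      using Suc assms(2) by (intro PC_mult PC_const) auto
    with Suc.prems show ?case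
      using cont Ck_on_continuous[OF Suc.prems] by (auto simp: partial_affine)
  qed
qed

lemma PC_if_Ck_on: "Ck_on k UNIV f \<Longrightarrow> PC k (\<lambda>x y. f x)"
  using PC_affine[of k f "\<lambda>_. 1" "\<lambda>_. 0"] by simp

text \<open>With a dummy real parameter \<open>PC\<close> becomes ordinary smoothness, so the
  closure of \<open>Ck_on\<close> under sums and products is read off without a second
  induction.\<close>

lemma Ck_on_UNIV_iff: "Ck_on k UNIV f \<longleftrightarrow> PC k (\<lambda>x (y::real). f x)"
  using Ck_on_if_PC PC_if_Ck_on by blast

lemma smooth_const: "smooth_on UNIV (\<lambda>x. c)"
  by (auto simp: smooth_on_def Ck_on_UNIV_iff intro!: PC_const)

lemma smooth_add: "smooth_on UNIV f \<Longrightarrow> smooth_on UNIV g \<Longrightarrow> smooth_on UNIV (\<lambda>x. f x + g x)"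
  and smooth_mult: "smooth_on UNIV f \<Longrightarrow> smooth_on UNIV g \<Longrightarrow> smooth_on UNIV (\<lambda>x. f x * g x)"
  by (auto simp: smooth_on_def Ck_on_UNIV_iff intro: PC_add PC_mult)

lemma smooth_prod:
  "finite I \<Longrightarrow> (\<And>i. i \<in> I \<Longrightarrow> smooth_on UNIV (f i)) \<Longrightarrow> smooth_on UNIV (\<lambda>x. \<Prod>i\<in>I. f i x)"
  by (auto simp: smooth_on_def Ck_on_UNIV_iff intro: PC_prod)

lemma smooth_continuous: "smooth_on U f \<Longrightarrow> continuous_on U f"
  unfolding smooth_on_def using Ck_on_continuous by blast

lemma smooth_differentiable: "smooth_on UNIV f \<Longrightarrow> f differentiable (at x)"
  unfolding smooth_on_def by (metis Ck_on.simps(2) UNIV_I)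

lemma smooth_partial: "smooth_on UNIV f \<Longrightarrow> smooth_on UNIV (partial i f)"
  unfolding smooth_on_def by (metis Ck_on.simps(2))

lemma smooth_gradient_continuous: "smooth_on UNIV f \<Longrightarrow> continuous_on UNIV (gradient f)"
  unfolding gradient_def
  by (intro continuous_on_vec_lambda) (use smooth_partial smooth_continuous in auto)

text \<open>The remainder of the linearisation is controlled by the mean value inequality, uniformly in
  the parameter, because the gradient is uniformly continuous on compact sets.\<close>

lemma has_derivative_parametric_integral:
  fixes f :: "real^3 \<Rightarrow> 'p::euclidean_space \<Rightarrow> real"
  assumes f: "PC (Suc 0) f" and m: "integrable M m" and P: "compact P" "AE y in M. y \<in> P"
    and M: "(\<lambda>y. y) \<in> measurable M borel"
  shows "integrable M (\<lambda>y. m y * f x y)"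
    and "((\<lambda>x. LINT y|M. m y * f x y) has_derivative
          (\<lambda>h. \<Sum>i\<in>UNIV. (LINT y|M. m y * partial i (\<lambda>x. f x y) x) * h $ i)) (at x)"
proof -
  have int: "integrable M (\<lambda>y. m y * g x y)"
    if g: "continuous_on UNIV (\<lambda>z. g (fst z) (snd z))" for g :: "real^3 \<Rightarrow> 'p \<Rightarrow> real" and x
  proof -
    have gx: "continuous_on UNIV (g x)"
      using continuous_on_compose2[OF g, where f = "\<lambda>y. (x, y)" and s = UNIV] by (simp add: continuous_on_Pair)
    then have "compact (g x ` P)" using P(1) by (meson compact_continuous_image continuous_on_subset subset_UNIV)
    then obtain B where B: "\<And>y. y \<in> P \<Longrightarrow> norm (g x y) \<le> B"
      using compact_imp_bounded by (metis bounded_iff image_eqI)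
    have "g x \<in> borel_measurable M"
      using measurable_compose[OF M borel_measurable_continuous_onI[OF gx]] by simp
    then have "(\<lambda>y. m y * g x y) \<in> borel_measurable M" using m by simp
    moreover have "AE y in M. norm (m y * g x y) \<le> norm (B * m y)"
      using P(2)
    proof eventually_elim
      case (elim y)
      have "\<bar>g x y\<bar> \<le> \<bar>B\<bar>" using B[OF elim] by simp
      from mult_right_mono[OF this, of "\<bar>m y\<bar>"] show ?case by (simp add: abs_mult mult.commute)
    qed
    ultimately show ?thesis
      by (intro Bochner_Integration.integrable_bound[OF integrable_mult_right[OF m, of B]]) auto
  qed
  show int_f: "integrable M (\<lambda>y. m y * f x y)" for x
    using int f by auto
  define G where "G x y = (\<chi> i. partial i (\<lambda>x. f x y) x)" for x y
  have G_cont: "continuous_on UNIV (\<lambda>z. G (fst z) (snd z))"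
    unfolding G_def using f by (intro continuous_on_vec_lambda) auto
  have f_der: "((\<lambda>x. f x y) has_derivative (\<lambda>h. G x y \<bullet> h)) (at x)" for x y
    using has_derivative_gradient[of "\<lambda>x. f x y" x] f by (simp add: G_def gradient_def)
  have int_G: "integrable M (\<lambda>y. m y * (G x y $ i))" for x i
    using int[of "\<lambda>x y. partial i (\<lambda>x. f x y) x"] f by (simp add: G_def)
  define D where "D h = (\<Sum>i\<in>UNIV. (LINT y|M. m y * partial i (\<lambda>x. f x y) x) * h $ i)" for h
  have D_eq: "D h = (LINT y|M. m y * (G x y \<bullet> h))" for h
    using int_G[of x] by (simp add: D_def G_def inner_vec_def sum_distrib_left flip: mult.assoc)
  have int_Gh: "integrable M (\<lambda>y. m y * (G x y \<bullet> h))" for h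
    using int_G[of x] by (simp add: inner_vec_def sum_distrib_left flip: mult.assoc)
  have lin: "bounded_linear D"
    unfolding D_def by (intro bounded_linear_sum bounded_linear_const_mult bounded_linear_vec_nth)
  have "((\<lambda>x. LINT y|M. m y * f x y) has_derivative D) (at x)"
    unfolding has_derivative_at_alt
  proof (intro conjI lin allI impI)
    fix e :: real assume e: "e > 0"
    define I where "I = (LINT y|M. \<bar>m y\<bar>)"
    have I: "I \<ge> 0" by (simp add: I_def)
    \<comment> \<open>The 1 keeps the denominator positive when m vanishes almost
      everywhere.\<close>
    define e' where "e' = e / (I + 1)"
    have e': "e' > 0" using e I by (simp add: e'_def)
    have "uniformly_continuous_on (cball x 1 \<times> P) (\<lambda>z. G (fst z) (snd z))"
      using G_cont P(1) by (intro compact_uniformly_continuous compact_Times) (auto intro: continuous_on_subset)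
    then obtain d where d: "d > 0" "\<And>z z'. z \<in> cball x 1 \<times> P \<Longrightarrow> z' \<in> cball x 1 \<times> P \<Longrightarrow> dist z' z < d
        \<Longrightarrow> dist (G (fst z') (snd z')) (G (fst z) (snd z)) < e'"
      unfolding uniformly_continuous_on_def using e' by metis
    \<comment> \<open>A radius of at most 1 stays inside \<open>cball x 1\<close>, where uniform
      continuity was obtained; d/2 makes the second bound strict.\<close>
    define r where "r = min 1 (d/2)"
    have r: "r > 0" "r \<le> 1" "r < d" using d(1) by (auto simp: r_def)
    have key: "\<bar>f x' y - f x y - G x y \<bullet> (x' - x)\<bar> \<le> e' * norm (x' - x)"
      if x': "norm (x' - x) < r" and y: "y \<in> P" for x' y
    proof -
      have "norm ((\<lambda>z. f z y - G x y \<bullet> z) x' - (\<lambda>z. f z y - G x y \<bullet> z) x) \<le> e' * norm (x' - x)"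
      proof (rule differentiable_bound[where S="ball x r" and f'="\<lambda>z h. G z y \<bullet> h - G x y \<bullet> h"])
        show "convex (ball x r)" by simp
        fix z assume z: "z \<in> ball x r"
        show "((\<lambda>z. f z y - G x y \<bullet> z) has_derivative (\<lambda>h. G z y \<bullet> h - G x y \<bullet> h)) (at z within ball x r)"
          by (intro derivative_intros has_derivative_at_withinI[OF f_der])
        have "dist (G z y) (G x y) < e'"
          using d(2)[of "(x,y)" "(z,y)"] z y r by (auto simp: dist_Pair_Pair dist_commute)
        then have "norm (G z y - G x y) \<le> e'" by (simp add: dist_norm)
        then show "onorm (\<lambda>h. G z y \<bullet> h - G x y \<bullet> h) \<le> e'"
          unfolding inner_diff_left[symmetric] using e'
            by (intro onorm_bound)
              (auto intro: order_trans[OF Cauchy_Schwarz_ineq2 mult_right_mono])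
      next
        show "x' \<in> ball x r" "x \<in> ball x r" using x' r by (auto simp: dist_norm norm_minus_commute)
      qed
      then show ?thesis by (simp add: inner_diff_right algebra_simps)
    qed
    show "\<exists>d>0. \<forall>x'. norm (x' - x) < d \<longrightarrow>
        norm ((LINT y|M. m y * f x' y) - (LINT y|M. m y * f x y) - D (x' - x)) \<le> e * norm (x' - x)"
    proof (intro exI conjI allI impI)
      show "r > 0" by fact
      fix x' assume x': "norm (x' - x) < r"
      have "norm ((LINT y|M. m y * f x' y) - (LINT y|M. m y * f x y) - D (x' - x))
        = norm (LINT y|M. m y * (f x' y - f x y - G x y \<bullet> (x' - x)))"
        using int_f int_Gh by (simp add: D_eq right_diff_distrib)
      also have "\<dots> \<le> (LINT y|M. norm (m y * (f x' y - f x y - G x y \<bullet> (x' - x))))"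
        by (rule integral_norm_bound)
      also have "\<dots> \<le> (LINT y|M. \<bar>m y\<bar> * (e' * norm (x' - x)))"
      proof (rule integral_mono_AE)
        show "integrable M (\<lambda>y. norm (m y * (f x' y - f x y - G x y \<bullet> (x' - x))))"
          using int_f int_Gh by (simp add: right_diff_distrib)
        show "integrable M (\<lambda>y. \<bar>m y\<bar> * (e' * norm (x' - x)))" using m by simp
        show "AE y in M. norm (m y * (f x' y - f x y - G x y \<bullet> (x' - x))) \<le> \<bar>m y\<bar> * (e' * norm (x' - x))"
          using P(2) by eventually_elim (auto simp: abs_mult intro!: mult_left_mono key[OF x'])
      qed
      also have "\<dots> = I * e' * norm (x' - x)" by (simp add: I_def)
      also have "\<dots> \<le> e * norm (x' - x)"
        using e I by (intro mult_right_mono) (auto simp: e'_def field_simps)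
      finally show "norm ((LINT y|M. m y * f x' y) - (LINT y|M. m y * f x y) - D (x' - x)) \<le> e * norm (x' - x)" .
    qed
  qed
  then show "((\<lambda>x. LINT y|M. m y * f x y) has_derivative
          (\<lambda>h. \<Sum>i\<in>UNIV. (LINT y|M. m y * partial i (\<lambda>x. f x y) x) * h $ i)) (at x)"
    by (simp add: D_def[abs_def])
qed

lemma partial_parametric_integral:
  fixes f :: "real^3 \<Rightarrow> 'p::euclidean_space \<Rightarrow> real"
  assumes "PC (Suc 0) f" "integrable M m" "compact P" "AE y in M. y \<in> P" "(\<lambda>y. y) \<in> measurable M borel"
  shows "partial i (\<lambda>x. LINT y|M. m y * f x y) x = (LINT y|M. m y * partial i (\<lambda>x. f x y) x)"
  by (subst partial_eqI[OF has_derivative_parametric_integral(2)[OF assms]])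
     (simp add: axis_def if_distrib cong: if_cong)

lemma smooth_parametric_integral:
  fixes f :: "real^3 \<Rightarrow> 'p::euclidean_space \<Rightarrow> real"
  assumes "\<And>k. PC k f" "integrable M m" "compact P" "AE y in M. y \<in> P" "(\<lambda>y. y) \<in> measurable M borel"
  shows "smooth_on UNIV (\<lambda>x. LINT y|M. m y * f x y)"
proof -
  have diff: "(\<lambda>x. LINT y|M. m y * f x y) differentiable (at x)" if "PC (Suc 0) f"
    for x and f :: "real^3 \<Rightarrow> 'p \<Rightarrow> real"
    using has_derivative_parametric_integral(2)[OF that assms(2-)] unfolding differentiable_def by blast
  have "Ck_on k UNIV (\<lambda>x. LINT y|M. m y * f x y)" if "\<And>k. PC k f" for k and f :: "real^3 \<Rightarrow> 'p \<Rightarrow> real"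
    using that
  proof (induction k arbitrary: f)
    case 0
    show ?case using diff[OF 0]
      by (auto simp: continuous_on_eq_continuous_within intro!: differentiable_imp_continuous_within)
  next
    case (Suc k)
    have "PC k (\<lambda>x y. partial i (\<lambda>x. f x y) x)" for k i
      using Suc.prems[of "Suc k"] by simp
    from Suc.IH[OF this]
    have "Ck_on k UNIV (\<lambda>x. LINT y|M. m y * partial i (\<lambda>x. f x y) x)" for i .
    moreover have "partial i (\<lambda>x. LINT y|M. m y * f x y) = (\<lambda>x. LINT y|M. m y * partial i (\<lambda>x. f x y) x)" for i
      using partial_parametric_integral[OF Suc.prems assms(2-)] by blast
    ultimately show ?case using diff[OF Suc.prems] by simp
  qed
  with assms(1) show ?thesis by (simp add: smooth_on_def)
qed

section \<open>Test functions\<close>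

lemma has_real_derivative_line:
  assumes "smooth_on UNIV f"
  shows "((\<lambda>t. f (p + t *\<^sub>R d)) has_real_derivative gradient f (p + t *\<^sub>R d) \<bullet> d) (at t within S)"
proof -
  have "((\<lambda>t. f (p + t *\<^sub>R d)) has_derivative (\<lambda>h. gradient f (p + t *\<^sub>R d) \<bullet> (h *\<^sub>R d))) (at t within S)"
    using has_derivative_compose[OF has_derivative_add[OF has_derivative_const
          has_derivative_scaleR_left[OF has_derivative_ident]]
        has_derivative_gradient[OF smooth_differentiable[OF assms]]] by simp
  then show ?thesis by (simp add: has_field_derivative_def mult_commute_abs)
qed

text \<open>The mean value theorem is applied twice: to the increment in direction i, and then to
  \<open>partial i f\<close> in direction j. The mixed second difference on the left is symmetric in
  i and j, the expression on the right is not, and this is what yields the symmetry of second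
  derivatives.\<close>

lemma second_difference_mean_value:
  assumes f: "smooth_on UNIV f" and t: "t > 0"
  shows "\<exists>u v. 0 < u \<and> u < t \<and> 0 < v \<and> v < t \<and>
    f (x + t *\<^sub>R axis i 1 + t *\<^sub>R axis j 1) - f (x + t *\<^sub>R axis i 1) - f (x + t *\<^sub>R axis j 1) + f x
      = t * t * partial j (partial i f) (x + u *\<^sub>R axis i 1 + v *\<^sub>R axis j 1)"
proof -
  define g where "g u = f ((x + t *\<^sub>R axis j 1) + u *\<^sub>R axis i 1) - f (x + u *\<^sub>R axis i 1)" for u
  have "(g has_real_derivative partial i f ((x + t *\<^sub>R axis j 1) + u *\<^sub>R axis i 1)
      - partial i f (x + u *\<^sub>R axis i 1)) (at u)" for u
    unfolding g_def
    using has_real_derivative_line[OF f, of "x + t *\<^sub>R axis j 1" "axis i 1" u UNIV]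
      has_real_derivative_line[OF f, of x "axis i 1" u UNIV]
    by (intro DERIV_diff) (simp_all add: inner_axis)
  from MVT2[OF t, of g, OF this] obtain u where u: "0 < u" "u < t"
    "g t - g 0 = t * (partial i f ((x + u *\<^sub>R axis i 1) + t *\<^sub>R axis j 1) - partial i f (x + u *\<^sub>R axis i 1))"
    by (auto simp: algebra_simps)
  have "((\<lambda>v. partial i f ((x + u *\<^sub>R axis i 1) + v *\<^sub>R axis j 1)) has_real_derivative
      partial j (partial i f) ((x + u *\<^sub>R axis i 1) + v *\<^sub>R axis j 1)) (at v)" for v
    using has_real_derivative_line[OF smooth_partial[OF f], of i "x + u *\<^sub>R axis i 1" "axis j 1" v UNIV]
    by (simp add: inner_axis)
  from MVT2[OF t, OF this] obtain v where v: "0 < v" "v < t"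
    "partial i f ((x + u *\<^sub>R axis i 1) + t *\<^sub>R axis j 1) - partial i f (x + u *\<^sub>R axis i 1)
      = t * partial j (partial i f) ((x + u *\<^sub>R axis i 1) + v *\<^sub>R axis j 1)"
    by auto
  from u v show ?thesis
    by (intro exI[of _ u] exI[of _ v]) (auto simp: g_def algebra_simps)
qed

lemma partial_commute:
  assumes f: "smooth_on UNIV f"
  shows "partial i (partial j f) x = partial j (partial i f) x"
proof (rule ccontr)
  assume ne: "partial i (partial j f) x \<noteq> partial j (partial i f) x"
  define e where "e = \<bar>partial i (partial j f) x - partial j (partial i f) x\<bar> / 2"
  have e: "e > 0" using ne by (simp add: e_def)
  have near: "\<exists>d>0. \<forall>y. dist y x < d \<longrightarrow> \<bar>partial k (partial l f) y - partial k (partial l f) x\<bar> < e" for k l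
    using smooth_continuous[OF smooth_partial[OF smooth_partial[OF f]], of k l] e
    by (auto simp: continuous_on_iff dist_real_def)
  obtain d1 where d1: "d1 > 0" "\<And>y. dist y x < d1 \<Longrightarrow> \<bar>partial i (partial j f) y - partial i (partial j f) x\<bar> < e"
    using near by meson
  obtain d2 where d2: "d2 > 0" "\<And>y. dist y x < d2 \<Longrightarrow> \<bar>partial j (partial i f) y - partial j (partial i f) x\<bar> < e"
    using near by meson
  \<comment> \<open>Each intermediate point is within 2 t of x, so a third of the smaller radius
    suffices.\<close>
  define t where "t = min d1 d2 / 3"
  have t: "t > 0" "2 * t < d1" "2 * t < d2" using d1 d2 by (auto simp: t_def min_def)
  have small: "dist (x + u *\<^sub>R axis k 1 + v *\<^sub>R axis l 1) x < 2 * t"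
    if "0 < u" "u < t" "0 < v" "v < t" for u v and k l :: 3
  proof -
    have "norm (u *\<^sub>R axis k 1 + v *\<^sub>R axis l (1::real)) \<le> u + v"
      using that by (intro norm_triangle_le) (simp add: norm_axis_1)
    then show ?thesis using that by (simp add: dist_norm algebra_simps)
  qed
  obtain u v where 1: "0 < u" "u < t" "0 < v" "v < t"
    "f (x + t *\<^sub>R axis i 1 + t *\<^sub>R axis j 1) - f (x + t *\<^sub>R axis i 1) - f (x + t *\<^sub>R axis j 1) + f x
      = t * t * partial j (partial i f) (x + u *\<^sub>R axis i 1 + v *\<^sub>R axis j 1)"
    using second_difference_mean_value[OF f t(1)] by meson
  obtain u' v' where 2: "0 < u'" "u' < t" "0 < v'" "v' < t"
    "f (x + t *\<^sub>R axis j 1 + t *\<^sub>R axis i 1) - f (x + t *\<^sub>R axis j 1) - f (x + t *\<^sub>R axis i 1) + f x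
      = t * t * partial i (partial j f) (x + u' *\<^sub>R axis j 1 + v' *\<^sub>R axis i 1)"
    using second_difference_mean_value[OF f t(1)] by meson
  \<comment> \<open>Both sides are the same second difference divided by t^2.\<close>
  have "partial j (partial i f) (x + u *\<^sub>R axis i 1 + v *\<^sub>R axis j 1)
      = partial i (partial j f) (x + u' *\<^sub>R axis j 1 + v' *\<^sub>R axis i 1)"
    using 1(5) 2(5) t(1) by (simp add: algebra_simps)
  moreover have "\<bar>partial j (partial i f) (x + u *\<^sub>R axis i 1 + v *\<^sub>R axis j 1) - partial j (partial i f) x\<bar> < e"
    using small[OF 1(1-4), of i j] t by (intro d2(2)) simp
  moreover have "\<bar>partial i (partial j f) (x + u' *\<^sub>R axis j 1 + v' *\<^sub>R axis i 1) - partial i (partial j f) x\<bar> < e"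
    using small[OF 2(1-4), of j i] t by (intro d1(2)) simp
  ultimately have "\<bar>partial i (partial j f) x - partial j (partial i f) x\<bar> < 2 * e" by linarith
  then show False by (simp add: e_def)
qed

section \<open>Locality of derivatives, bumps and test functions\<close>

lemma partial_cong_open:
  assumes "open U" "x \<in> U" "\<And>y. y \<in> U \<Longrightarrow> f y = g y"
  shows "partial i f x = partial i g x"
proof -
  \<comment> \<open>The Frechet derivative is a choice among all admissible maps, so the two
    predicates themselves have to agree, also where neither function is differentiable.\<close>
  have "(f has_derivative D) (at x) \<longleftrightarrow> (g has_derivative D) (at x)" for D
    using has_derivative_transform_within_open[OF _ assms(1,2), of f D UNIV g]
      has_derivative_transform_within_open[OF _ assms(1,2), of g D UNIV f] assms(3) by auto
  then show ?thesis by (simp add: partial_def frechet_derivative_def)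
qed

text \<open>The functions \<open>p(1/t) exp(-1/t)\<close>, extended by zero, are closed under differentiation.\<close>

definition flat :: "real poly \<Rightarrow> real \<Rightarrow> real" where
  "flat p t = (if t > 0 then poly p (1 / t) * exp (- (1 / t)) else 0)"

lemma tendsto_poly_exp_0: "((\<lambda>y::real. poly q y * exp (- y)) \<longlongrightarrow> 0) at_top"
proof -
  have "((\<lambda>y::real. \<Sum>i\<le>degree q. coeff q i * (y ^ i / exp y)) \<longlongrightarrow> (\<Sum>i\<le>degree q. coeff q i * 0)) at_top"
    by (intro tendsto_intros tendsto_power_div_exp_0)
  then show ?thesis by (simp add: poly_altdef sum_distrib_right exp_minus divide_inverse mult.assoc)
qed

text \<open>With y = 1/t, the derivative of p(y) exp(-y) with respect to t is y^2 (p(y) - p'(y))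
  exp(-y), which is the polynomial in the statement. At 0 only the right-hand difference quotient
  has content.\<close>

lemma flat_has_derivative:
  "(flat p has_real_derivative flat (monom 1 2 * (p - pderiv p)) t) (at t)"
proof (cases t "0::real" rule: linorder_cases)
  case less
  have "((\<lambda>_. 0) has_real_derivative 0) (at t)" by simp
  then have "(flat p has_real_derivative 0) (at t)"
    by (rule has_field_derivative_transform_within_open[where S = "{..<0}"]) (use less in \<open>auto simp: flat_def\<close>)
  with less show ?thesis by (simp add: flat_def)
next
  case greater
  have "((\<lambda>t. poly p (1 / t) * exp (- (1 / t))) has_real_derivative flat (monom 1 2 * (p - pderiv p)) t) (at t)"
    using greater
    by (auto intro!: derivative_eq_intros DERIV_chain2[OF poly_DERIV]
        simp: flat_def poly_monom field_simps power2_eq_square)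
  then show ?thesis
    by (rule has_field_derivative_transform_within_open[where S = "{0<..}"]) (use greater in \<open>auto simp: flat_def\<close>)
next
  case equal
  have "((\<lambda>h. flat p h / h) \<longlongrightarrow> 0) (at_left 0)"
    by (rule tendsto_eventually) (auto simp: eventually_at_filter flat_def)
  moreover have "((\<lambda>h. flat p h / h) \<longlongrightarrow> 0) (at_right 0)"
  proof -
    \<comment> \<open>\<open>pCons 0 p\<close> is the polynomial y p(y): the additional factor y is
      the 1/h of the difference quotient.\<close>
    have "((\<lambda>h. poly (pCons 0 p) (inverse h) * exp (- inverse h)) \<longlongrightarrow> 0) (at_right (0::real))"
      by (rule filterlim_compose[OF tendsto_poly_exp_0 filterlim_inverse_at_top_right])
    then show ?thesis
      by (rule Lim_transform_eventually) (auto simp: eventually_at_filter flat_def field_simps)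
  qed
  ultimately have "((\<lambda>h. flat p h / h) \<longlongrightarrow> 0) (at 0)" by (simp add: filterlim_split_at)
  with equal show ?thesis by (simp add: has_field_derivative_def has_derivative_at DERIV_def flat_def flip: has_field_derivative_def)
qed

lemma flat_smooth: "smooth_on UNIV (\<lambda>x. flat p (a * x $ i + b))"
proof -
  have D: "((\<lambda>x. flat p (a * x $ i + b)) has_derivative
      (\<lambda>h. flat (monom 1 2 * (p - pderiv p)) (a * x $ i + b) * (a * h $ i))) (at x)" for p and x :: "real^3"
    by (rule has_derivative_compose[where f = "\<lambda>x. a * x $ i + b" and f' = "\<lambda>h. a * h $ i" and s = UNIV,
          OF _ flat_has_derivative[unfolded has_field_derivative_def]])
       (auto intro!: derivative_eq_intros bounded_linear.has_derivative[OF bounded_linear_vec_nth])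
  have "Ck_on k UNIV (\<lambda>x. flat p (a * x $ i + b))" for k
  proof (induction k arbitrary: p)
    case 0
    show ?case using D[THEN differentiableI] by (simp add: differentiable_at_imp_continuous_on)
  next
    case (Suc k)
    let ?q = "monom 1 2 * (p - pderiv p)"
    have "partial j (\<lambda>x. flat p (a * x $ i + b)) = (\<lambda>x. flat ?q (a * x $ i + b) * (if i = j then a else 0))" for j
      by (rule ext, subst partial_eqI[OF D]) (auto simp: axis_def)
    moreover have "Ck_on k UNIV (\<lambda>x. flat ?q (a * x $ i + b) * (if i = j then a else 0))" for j
      using Suc.IH[of ?q] PC_const[of "\<lambda>_::real. if i = j then a else 0" k]
      unfolding Ck_on_UNIV_iff by (intro PC_mult) auto
    ultimately show ?case using D[THEN differentiableI] by simp
  qed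
  then show ?thesis by (simp add: smooth_on_def)
qed

text \<open>The factor n + 1 steepens the profile: as n grows the bumps stay between 0 and 1 and
  converge pointwise to the indicator of the open box, so that dominated convergence passes from
  test functions to boxes. For a fixed n it is a nonnegative bump, positive exactly on the
  box.\<close>

definition box_bump :: "nat \<Rightarrow> real^3 \<Rightarrow> real^3 \<Rightarrow> real^3 \<Rightarrow> real" where
  "box_bump n a b x = (\<Prod>i\<in>UNIV. flat 1 (real (Suc n) * (x $ i - a $ i)) * flat 1 (real (Suc n) * (b $ i - x $ i)))"

lemma flat_1_bounds: "0 \<le> flat 1 t" "flat 1 t \<le> 1" and flat_1_pos: "0 < t \<Longrightarrow> 0 < flat 1 t"
  and flat_nonpos: "t \<le> 0 \<Longrightarrow> flat p t = 0"
  by (auto simp: flat_def)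

lemma box_bump_smooth: "smooth_on UNIV (box_bump n a b)"
proof -
  have "smooth_on UNIV (\<lambda>x. \<Prod>i\<in>UNIV. flat 1 (real (Suc n) * x $ i + (- real (Suc n) * a $ i))
      * flat 1 ((- real (Suc n)) * x $ i + real (Suc n) * b $ i))"
    by (intro smooth_prod smooth_mult flat_smooth) simp
  then show ?thesis by (simp add: box_bump_def[abs_def] algebra_simps)
qed

lemma box_bump_bounds: "0 \<le> box_bump n a b x" "box_bump n a b x \<le> 1"
  unfolding box_bump_def using flat_1_bounds by (auto intro!: prod_nonneg prod_le_1 mult_le_one)

lemma box_bump_eq_0: "x \<notin> box a b \<Longrightarrow> box_bump n a b x = 0"
  by (force simp: box_bump_def mem_box_cart not_less intro!: flat_nonpos mult_nonneg_nonpos)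

lemma box_bump_pos: "x \<in> box a b \<Longrightarrow> box_bump n a b x > 0"
  unfolding box_bump_def mem_box_cart by (intro prod_pos) (auto intro!: mult_pos_pos flat_1_pos)

lemma box_bump_tendsto: "(\<lambda>n. box_bump n a b x) \<longlonglongrightarrow> indicator (box a b) x"
proof (cases "x \<in> box a b")
  case True
  have flat_lim: "(\<lambda>n. flat 1 (real (Suc n) * t)) \<longlonglongrightarrow> 1" if "t > 0" for t
  proof -
    have "(\<lambda>n. exp (- (inverse (real (Suc n)) * (1 / t)))) \<longlonglongrightarrow> exp (- (0 * (1 / t)))"
      by (intro tendsto_intros LIMSEQ_inverse_real_of_nat)
    moreover have "flat 1 (real (Suc n) * t) = exp (- (inverse (real (Suc n)) * (1 / t)))" for n
    proof -
      have "real (Suc n) * t > 0" using that by simp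
      then show ?thesis by (simp add: flat_def inverse_eq_divide)
    qed
    ultimately show ?thesis by simp
  qed
  have "(\<lambda>n. box_bump n a b x) \<longlonglongrightarrow> (\<Prod>i\<in>(UNIV::3 set). 1 * 1)"
    unfolding box_bump_def using True by (intro tendsto_intros flat_lim) (auto simp: mem_box_cart)
  with True show ?thesis by simp
qed (simp add: box_bump_eq_0)

lemma box_bump_test_function:
  assumes "cbox a b \<subseteq> U"
  shows "test_function U (box_bump n a b)"
proof -
  have "{x. box_bump n a b x \<noteq> 0} \<subseteq> cbox a b"
    using box_bump_eq_0 box_subset_cbox by blast
  then have sub: "closure {x. box_bump n a b x \<noteq> 0} \<subseteq> cbox a b"
    by (intro closure_minimal closed_cbox)
  then have "compact (closure {x. box_bump n a b x \<noteq> 0})"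
    by (meson bounded_subset compact_closure closure_subset bounded_cbox subset_trans)
  with sub assms box_bump_smooth show ?thesis by (auto simp: test_function_def)
qed

lemma test_function_smooth: "test_function U \<phi> \<Longrightarrow> smooth_on UNIV \<phi>"
  by (simp add: test_function_def)

lemma test_function_eq_0: "test_function U \<phi> \<Longrightarrow> x \<notin> U \<Longrightarrow> \<phi> x = 0"
  unfolding test_function_def using closure_subset[of "{x. \<phi> x \<noteq> 0}"] by blast

lemma test_function_partial:
  assumes "test_function U \<phi>"
  shows "test_function U (partial i \<phi>)"
proof -
  have "partial i \<phi> x = 0" if "x \<notin> closure {x. \<phi> x \<noteq> 0}" for x
  proof -
    have "partial i \<phi> x = partial i (\<lambda>_. 0) x"
      by (rule partial_cong_open[where U = "- closure {x. \<phi> x \<noteq> 0}"])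
         (use that closure_subset[of "{x. \<phi> x \<noteq> 0}"] in auto)
    then show ?thesis by simp
  qed
  then have "{x. partial i \<phi> x \<noteq> 0} \<subseteq> closure {x. \<phi> x \<noteq> 0}" by blast
  then have "closure {x. partial i \<phi> x \<noteq> 0} \<subseteq> closure {x. \<phi> x \<noteq> 0}" by (simp add: closure_minimal)
  with assms show ?thesis
    unfolding test_function_def
    by (metis (no_types, lifting) closed_closure compact_Int_closed inf.absorb_iff2 smooth_partial subset_trans)
qed

lemma test_function_mult_smooth:
  assumes "test_function U \<phi>" "smooth_on UNIV \<psi>"
  shows "test_function U (\<lambda>x. \<psi> x * \<phi> x)"
proof -
  have "closure {x. \<psi> x * \<phi> x \<noteq> 0} \<subseteq> closure {x. \<phi> x \<noteq> 0}" by (rule closure_mono) auto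
  with assms show ?thesis
    unfolding test_function_def
    by (metis (no_types, lifting) closed_closure compact_Int_closed inf.absorb_iff2 smooth_mult subset_trans)
qed

lemma test_function_add:
  assumes "test_function U \<phi>" "test_function U \<psi>"
  shows "test_function U (\<lambda>x. \<phi> x + \<psi> x)"
proof -
  have "closure {x. \<phi> x + \<psi> x \<noteq> 0} \<subseteq> closure ({x. \<phi> x \<noteq> 0} \<union> {x. \<psi> x \<noteq> 0})" by (rule closure_mono) auto
  then have sub: "closure {x. \<phi> x + \<psi> x \<noteq> 0} \<subseteq> closure {x. \<phi> x \<noteq> 0} \<union> closure {x. \<psi> x \<noteq> 0}"
    by (simp add: closure_Un)
  have "compact (closure {x. \<phi> x \<noteq> 0} \<union> closure {x. \<psi> x \<noteq> 0})"
    using assms by (simp add: test_function_def compact_Un)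
  from compact_Int_closed[OF this closed_closure, of "{x. \<phi> x + \<psi> x \<noteq> 0}"] sub
  have "compact (closure {x. \<phi> x + \<psi> x \<noteq> 0})" by (simp add: inf.absorb2)
  moreover have "smooth_on UNIV (\<lambda>x. \<phi> x + \<psi> x)"
    using assms by (intro smooth_add test_function_smooth)
  ultimately show ?thesis using sub assms unfolding test_function_def by blast
qed

text \<open>By translation invariance the integral of \<open>\<phi> (x + y)\<close> over y does not
  depend on x. Differentiating it under the integral sign at x = 0 gives the claim.\<close>

lemma integral_partial_test_function:
  assumes \<phi>: "test_function U \<phi>"
  shows "(LINT x|lborel. partial i \<phi> x) = 0"
proof -
  define S where "S = closure {x. \<phi> x \<noteq> 0}"
  have S: "compact S" "\<And>x. x \<notin> S \<Longrightarrow> \<phi> x = 0" "\<And>x. x \<notin> S \<Longrightarrow> partial i \<phi> x = 0"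
  proof -
    show "compact S" using \<phi> by (simp add: S_def test_function_def)
    show "\<And>x. x \<notin> S \<Longrightarrow> \<phi> x = 0" using closure_subset[of "{x. \<phi> x \<noteq> 0}"] by (auto simp: S_def)
    have "test_function S \<phi>" using \<phi> by (simp add: test_function_def S_def)
    then show "\<And>x. x \<notin> S \<Longrightarrow> partial i \<phi> x = 0" using test_function_partial test_function_eq_0 by blast
  qed
  obtain R where R: "S \<subseteq> cball 0 R" using bounded_subset_ballD[OF compact_imp_bounded[OF S(1)], of 0] ball_subset_cball by blast
  \<comment> \<open>Differentiation under the integral sign asks for a compact parameter set. The
    margin 1 keeps the supports of all translates by vectors shorter than 1 inside B, so F is
    constant near 0.\<close>
  define B where "B = cball (0::real^3) (R + 1)"
  have B: "compact B" "B \<in> sets lborel" "S \<subseteq> B" using R by (auto simp: B_def)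
  define F where "F x = (LINT y|restrict_space lborel B. 1 * \<phi> (1 *\<^sub>R x + y))" for x
  have F_eq: "F x = (LINT y|lborel. indicator B y * \<phi> (x + y))" for x
    using B by (simp add: F_def integral_restrict_space)
  have PC: "PC k (\<lambda>x y. \<phi> (1 *\<^sub>R x + y))" for k
    using test_function_smooth[OF \<phi>] by (intro PC_affine) (auto simp: smooth_on_def)
  have fin: "emeasure lborel B < \<infinity>" using emeasure_bounded_finite[of B] by (simp add: B_def)
  have "partial i F 0 = (LINT y|restrict_space lborel B. 1 * partial i (\<lambda>x. \<phi> (1 *\<^sub>R x + y)) 0)"
    unfolding F_def
  proof (rule partial_parametric_integral[OF PC _ B(1)])
    show "integrable (restrict_space lborel B) (\<lambda>y. 1::real)"
      using B fin by (simp add: integrable_restrict_space)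
    show "AE y in restrict_space lborel B. y \<in> B" using B by (auto simp: AE_restrict_space_iff)
    show "(\<lambda>y. y) \<in> borel_measurable (restrict_space lborel B)" by (simp add: measurable_restrict_space1)
  qed
  also have "\<dots> = (LINT y|restrict_space lborel B. partial i \<phi> y)"
    by (subst partial_affine) (auto intro: smooth_differentiable[OF test_function_smooth[OF \<phi>]])
  also have "\<dots> = (LINT y|lborel. partial i \<phi> y)"
  proof -
    have "indicator B y *\<^sub>R partial i \<phi> y = partial i \<phi> y" for y
      using B(3) S(3)[of y] by (cases "y \<in> B") auto
    then have "(LINT y|lborel. indicator B y *\<^sub>R partial i \<phi> y) = (LINT y|lborel. partial i \<phi> y)"
      by presburger
    then show ?thesis using B(2) by (subst integral_restrict_space) auto
  qed
  finally have 1: "partial i F 0 = (LINT y|lborel. partial i \<phi> y)" .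
  have F_const: "F x = (LINT y|lborel. \<phi> y)" if x: "x \<in> ball 0 1" for x
  proof -
    have "indicator B y * \<phi> (x + y) = \<phi> (x + y)" for y
    proof (cases "y \<in> B")
      case False
      then have "norm (x + y) > R" using x norm_diff_ineq[of y x] by (simp add: B_def add.commute)
      then have "x + y \<notin> S" using R by auto
      then show ?thesis using S(2) by simp
    qed simp
    then have "F x = (LINT y|lborel. \<phi> (x + y))" unfolding F_eq by presburger
    also have "\<dots> = (LINT y|distr lborel borel ((+) x). \<phi> y)"
      using smooth_continuous[OF test_function_smooth[OF \<phi>]]
      by (subst integral_distr) (auto intro: borel_measurable_continuous_onI)
    finally show ?thesis by (simp add: lborel_distr_plus)
  qed
  have "partial i F 0 = partial i (\<lambda>_. (LINT y|lborel. \<phi> y)) 0"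
    by (rule partial_cong_open[of "ball 0 1"]) (use F_const in auto)
  with 1 show ?thesis by simp
qed

section \<open>Lebesgue integrals over Borel sets and the fundamental lemma\<close>

lemma AE_lebesgue_on_iff:
  assumes "K \<in> sets lebesgue"
  shows "(AE x in lebesgue_on K. P x) \<longleftrightarrow> (AE x in lebesgue. x \<in> K \<longrightarrow> P x)"
  using assms by (simp add: AE_restrict_space_iff)

lemma lebesgue_on_lborel:
  fixes f :: "'a::euclidean_space \<Rightarrow> 'b::{banach, second_countable_topology}"
  assumes K: "K \<in> sets borel" and f: "f \<in> borel_measurable borel"
  shows "(LINT x|lebesgue_on K. f x) = (LINT x|lborel. indicator K x *\<^sub>R f x)"
    and "integrable (lebesgue_on K) f \<longleftrightarrow> integrable lborel (\<lambda>x. indicator K x *\<^sub>R f x)"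
proof -
  have K': "K \<in> sets lebesgue" using K by auto
  have m: "(\<lambda>x. indicator K x *\<^sub>R f x) \<in> borel_measurable lborel" using K f by measurable
  show "(LINT x|lebesgue_on K. f x) = (LINT x|lborel. indicator K x *\<^sub>R f x)"
    using K' integral_completion[OF m] by (simp add: integral_restrict_space)
  show "integrable (lebesgue_on K) f \<longleftrightarrow> integrable lborel (\<lambda>x. indicator K x *\<^sub>R f x)"
    using K' integrable_completion[OF m] by (simp add: integrable_restrict_space)
qed

lemma nn_integral_lebesgue_on_lborel:
  assumes K: "K \<in> sets borel" and f: "f \<in> borel_measurable borel"
  shows "(\<integral>\<^sup>+x. f x \<partial>lebesgue_on K) = (\<integral>\<^sup>+x. f x * indicator K x \<partial>lborel)"
proof -
  have K': "K \<in> sets lebesgue" using K by auto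
  have m: "(\<lambda>x. f x * indicator K x) \<in> borel_measurable lborel" using K f by measurable
  show ?thesis using K' by (simp add: nn_integral_restrict_space nn_integral_completion m)
qed

lemma id_measurable_lebesgue_on: "(\<lambda>y. y) \<in> borel_measurable (lebesgue_on K)"
  using measurable_restrict_space1[of "\<lambda>y. y" lebesgue borel K] by (simp add: measurable_completion)

lemma borel_measurable_lebesgue_onI:
  assumes "f \<in> borel_measurable borel"
  shows "f \<in> borel_measurable (lebesgue_on K)"
  using measurable_compose[OF id_measurable_lebesgue_on[of K] assms] by simp

text \<open>A Borel representative supported in K moves integrals from \<open>lebesgue_on K\<close>
  to \<open>lborel\<close>, where the boxes generate the sigma-algebra.\<close>

lemma ex_borel_version_real:
  fixes f :: "'a::euclidean_space \<Rightarrow> real"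
  assumes K: "K \<in> sets borel" and f: "f \<in> borel_measurable (lebesgue_on K)"
  obtains f' where "f' \<in> borel_measurable borel" "AE x in lebesgue_on K. f x = f' x" "\<And>x. x \<notin> K \<Longrightarrow> f' x = 0"
proof -
  have K': "K \<in> sets lebesgue" using K by auto
  have "(\<lambda>x. f x * indicator K x) \<in> borel_measurable lebesgue"
    using f K' borel_measurable_restrict_space_iff[of K lebesgue f] by (simp add: mult.commute)
  then obtain g where g: "g \<in> borel_measurable lborel" "AE x in lborel. f x * indicator K x = g x"
    using completion_ex_borel_measurable_real by blast
  define f' where "f' x = g x * indicator K x" for x
  have "AE x in lebesgue. x \<in> K \<longrightarrow> f x = f' x"
    using AE_completion[OF g(2)] by eventually_elim (auto simp: f'_def)
  then have "AE x in lebesgue_on K. f x = f' x" using K' by (simp add: AE_lebesgue_on_iff)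
  moreover have "f' \<in> borel_measurable borel" unfolding f'_def using g(1) K by measurable
  ultimately show ?thesis using that[of f'] by (auto simp: f'_def)
qed

text \<open>Letting bumps grow to indicators shows that g has integral zero over every closed box's
  interior in K. The measures whose densities are the positive and the negative part of a localised
  g therefore agree on boxes, an intersection-stable generator, so the two parts agree almost
  everywhere.\<close>

lemma fundamental_lemma:
  fixes f :: "real^3 \<Rightarrow> real"
  assumes K: "open K" and f: "integrable (lebesgue_on K) f"
    and zero: "\<And>\<phi>. test_function K \<phi> \<Longrightarrow> (LINT x|lebesgue_on K. f x * \<phi> x) = 0"
  shows "AE x in lebesgue_on K. f x = 0"
proof -
  have Kb: "K \<in> sets borel" using K by auto
  have Kl: "K \<in> sets lebesgue" using Kb by auto
  obtain g where g: "g \<in> borel_measurable borel" "AE x in lebesgue_on K. f x = g x" "\<And>x. x \<notin> K \<Longrightarrow> g x = 0"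
    using ex_borel_version_real[OF Kb borel_measurable_integrable[OF f]] by blast
  have gK: "indicator K x *\<^sub>R g x = g x" for x using g(3) by (cases "x \<in> K") auto
  have "integrable (lebesgue_on K) g"
    using f g(2) borel_measurable_lebesgue_onI[OF g(1)] by (subst integrable_cong_AE[symmetric, of f]) auto
  then have g_int: "integrable lborel g"
    unfolding lebesgue_on_lborel(2)[OF Kb g(1)] gK .
  have box0: "(LINT x|lborel. indicator (box a b) x * g x) = 0" if ab: "cbox a b \<subseteq> K" for a b
  proof (rule LIMSEQ_unique)
    have bm: "box_bump n a b \<in> borel_measurable borel" for n
      by (intro borel_measurable_continuous_onI smooth_continuous box_bump_smooth)
    show "(\<lambda>n. LINT x|lborel. box_bump n a b x * g x) \<longlonglongrightarrow> (LINT x|lborel. indicator (box a b) x * g x)"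
    proof (rule integral_dominated_convergence[where w = "\<lambda>x. \<bar>g x\<bar>"])
      show "integrable lborel (\<lambda>x. \<bar>g x\<bar>)" using g_int by simp
      show "AE x in lborel. (\<lambda>n. box_bump n a b x * g x) \<longlonglongrightarrow> indicator (box a b) x * g x"
        by (intro AE_I2 tendsto_mult box_bump_tendsto tendsto_const)
      show "AE x in lborel. norm (box_bump n a b x * g x) \<le> \<bar>g x\<bar>" for n
        using box_bump_bounds[of n a b] by (intro AE_I2) (auto simp: abs_mult mult_left_le_one_le)
    qed (use g(1) bm in measurable)
    have "(LINT x|lborel. box_bump n a b x * g x) = 0" for n
    proof -
      have "(LINT x|lborel. box_bump n a b x * g x) = (LINT x|lebesgue_on K. box_bump n a b x * g x)"
      proof -
        have eq: "indicator K x *\<^sub>R (box_bump n a b x * g x) = box_bump n a b x * g x" for x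
          using gK[of x] by auto
        have "(\<lambda>x. box_bump n a b x * g x) \<in> borel_measurable borel" using g(1) bm by measurable
        from lebesgue_on_lborel(1)[OF Kb this] show ?thesis unfolding eq by (rule sym)
      qed
      also have "\<dots> = (LINT x|lebesgue_on K. f x * box_bump n a b x)"
        using g(2) borel_measurable_lebesgue_onI[OF g(1)] borel_measurable_lebesgue_onI[OF bm] borel_measurable_integrable[OF f]
        by (intro integral_cong_AE) auto
      also have "\<dots> = 0" by (rule zero[OF box_bump_test_function[OF ab]])
      finally show ?thesis .
    qed
    then show "(\<lambda>n. LINT x|lborel. box_bump n a b x * g x) \<longlonglongrightarrow> 0" by simp
  qed
  have AE_box: "AE x in lborel. x \<in> box c d \<longrightarrow> g x = 0" if cd: "cbox c d \<subseteq> K" for c d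
  proof -
    \<comment> \<open>Cutting g off to a box whose closure lies in K makes the vanishing of the
      integrals available for all boxes of the space, as the generator argument demands.\<close>
    define p where "p x = indicator (box c d) x * g x" for x
    have p: "p \<in> borel_measurable borel" "integrable lborel p"
      unfolding p_def using g(1) integrable_mult_indicator[OF _ g_int, of "box c d"] by simp_all
    have p_box: "(LINT x|lborel. indicator (box a b) x * p x) = 0" for a b
    proof -
      obtain a' b' where ab: "box a b \<inter> box c d = box a' b'" by (rule that[OF box_Int_box])
      have sub: "box a' b' \<subseteq> K" using ab cd box_subset_cbox by blast
      have "(LINT x|lborel. indicator (box a' b') x * g x) = 0"
      \<comment> \<open>The closed box is the closure of the open one only if the latter is
        nonempty.\<close>
      proof (cases "box a' b' = {}")
        case False
        have "box a' b' \<subseteq> cbox c d" using ab box_subset_cbox[of c d] by blast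
        from closure_mono[OF this] have "cbox a' b' \<subseteq> cbox c d" using closure_box[OF False] by simp
        then show ?thesis using box0 cd by (meson order_trans)
      qed simp
      then show ?thesis unfolding p_def ab[symmetric] by (simp add: indicator_inter_arith mult.assoc)
    qed
    have "density lborel (\<lambda>x. ennreal (p x)) = density lborel (\<lambda>x. ennreal (- p x))"
    proof (rule measure_eqI_generator_eq[where E = "range (\<lambda>(a, b). box a b)" and \<Omega> = UNIV
          and A = "\<lambda>n. box (- (real n *\<^sub>R One)) (real n *\<^sub>R One)"])
      show "Int_stable (range (\<lambda>(a, b). box a b :: (real^3) set))"
        by (auto simp: Int_stable_def box_Int_box)
      have sets: "sets borel = sigma_sets UNIV (range (\<lambda>(a, b). box a b :: (real^3) set))"
        by (simp add: borel_eq_box)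
      then show "sets (density lborel (\<lambda>x. ennreal (p x))) = sigma_sets UNIV (range (\<lambda>(a, b). box a b))"
        "sets (density lborel (\<lambda>x. ennreal (- p x))) = sigma_sets UNIV (range (\<lambda>(a, b). box a b))"
        by simp_all
      show "(\<Union>n. box (- (real n *\<^sub>R One)) (real n *\<^sub>R One)) = (UNIV :: (real^3) set)"
        by (rule UN_box_eq_UNIV)
      show "emeasure (density lborel (\<lambda>x. ennreal (p x))) (box (- (real n *\<^sub>R One)) (real n *\<^sub>R One)) \<noteq> \<infinity>" for n
      proof -
        have "emeasure (density lborel (\<lambda>x. ennreal (p x))) (box (- (real n *\<^sub>R One)) (real n *\<^sub>R One))
          \<le> (\<integral>\<^sup>+x. ennreal (norm (p x)) \<partial>lborel)"
          using p(1) by (subst emeasure_density) (auto intro!: nn_integral_mono simp: indicator_def ennreal_leI)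
        also have "\<dots> < \<infinity>" using p(2) by (simp add: integrable_iff_bounded)
        finally show ?thesis by simp
      qed
      fix X :: "(real^3) set" assume "X \<in> range (\<lambda>(a, b). box a b)"
      then obtain a b where X: "X = box a b" by auto
      have q: "integrable lborel (\<lambda>x. indicator X x * p x)"
        using integrable_mult_indicator[OF _ p(2), of X] X by simp
      have "ennreal (p x) * indicator X x = ennreal (indicator X x * p x)"
        "ennreal (- p x) * indicator X x = ennreal (- (indicator X x * p x))" for x
        by (auto simp: indicator_def)
      then have 1: "emeasure (density lborel (\<lambda>x. ennreal (p x))) X = (\<integral>\<^sup>+x. ennreal (indicator X x * p x) \<partial>lborel)"
        "emeasure (density lborel (\<lambda>x. ennreal (- p x))) X = (\<integral>\<^sup>+x. ennreal (- (indicator X x * p x)) \<partial>lborel)"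
        using p(1) X by (simp_all add: emeasure_density)
      have inj: "A = B" if "enn2real A = enn2real B" "A \<noteq> \<infinity>" "B \<noteq> \<infinity>" for A B :: ennreal
        using that by (cases A; cases B) auto
      have fin: "(\<integral>\<^sup>+x. ennreal (indicator X x * p x) \<partial>lborel) \<noteq> \<infinity>" "(\<integral>\<^sup>+x. ennreal (- (indicator X x * p x)) \<partial>lborel) \<noteq> \<infinity>"
        using q by (auto simp: real_integrable_def)
      have "enn2real (\<integral>\<^sup>+x. ennreal (indicator X x * p x) \<partial>lborel) = enn2real (\<integral>\<^sup>+x. ennreal (- (indicator X x * p x)) \<partial>lborel)"
        using p_box[of a b] q X by (simp add: real_lebesgue_integral_def)
      then show "emeasure (density lborel (\<lambda>x. ennreal (p x))) X = emeasure (density lborel (\<lambda>x. ennreal (- p x))) X"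
        unfolding 1 by (rule inj[OF _ fin])
    qed auto
    then have "AE x in lborel. ennreal (p x) = ennreal (- p x)"
      using p(1) by (intro sigma_finite_measure.density_unique[OF lborel.sigma_finite_measure_axioms]) auto
    then show ?thesis
    proof eventually_elim
      case (elim x)
      \<comment> \<open>\<open>ennreal\<close> truncates negative reals to 0, so the equality forces
        both the positive and the negative part to vanish.\<close>
      have "p x = 0"
      proof (cases "p x \<ge> 0")
        case True then show ?thesis using elim by (simp add: ennreal_neg ennreal_eq_0_iff)
      next
        case False then show ?thesis using elim by (simp add: ennreal_neg ennreal_eq_0_iff)
      qed
      then show ?case by (auto simp: p_def)
    qed
  qed
  \<comment> \<open>Countably many closed boxes exhaust K, and the boundary of each of them is a
    null set.\<close>
  obtain D where D: "countable D" "D \<subseteq> Pow K" "\<And>X. X \<in> D \<Longrightarrow> \<exists>a b. X = cbox a b" "\<Union>D = K"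
    by (rule open_countable_Union_open_cbox[OF K]) (rule that)
  have "AE x in lborel. \<forall>X\<in>D. x \<in> X \<longrightarrow> g x = 0"
  proof (subst AE_ball_countable[OF D(1)], intro ballI)
    fix X assume "X \<in> D"
    then obtain a b where X: "X = cbox a b" "cbox a b \<subseteq> K" using D by blast
    have "AE x in lborel. x \<notin> cbox a b - box a b"
      by (rule AE_not_in) (auto simp: null_sets_def emeasure_Diff emeasure_lborel_box_eq emeasure_lborel_cbox_eq box_subset_cbox)
    with AE_box[OF X(2)] show "AE x in lborel. x \<in> X \<longrightarrow> g x = 0"
      by eventually_elim (auto simp: X)
  qed
  then have "AE x in lborel. x \<in> K \<longrightarrow> g x = 0" by eventually_elim (use D(4) in blast)
  then have "AE x in lebesgue. x \<in> K \<longrightarrow> g x = 0" by (rule AE_completion)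
  then have "AE x in lebesgue_on K. g x = 0" using Kl by (simp add: AE_lebesgue_on_iff)
  with g(2) show ?thesis by eventually_elim simp
qed

section \<open>Square-integrable functions\<close>

text \<open>The normalisation c/2 matches increments of a quadratic energy. The lemma serves twice:
  for the residual of a minimising sequence and for the Cauchy-Schwarz inequality.\<close>

lemma nonneg_quadratic_discriminant:
  fixes a b c :: real
  assumes "\<And>t. 0 \<le> a + t * b + t\<^sup>2 * c / 2" "0 \<le> c"
  shows "b\<^sup>2 \<le> 2 * a * c"
proof (cases "c = 0")
  case True
  have "b = 0"
  proof (rule ccontr)
    assume "b \<noteq> 0"
    \<comment> \<open>At this t the affine function \<open>a + t * b\<close> takes the value
      -1.\<close>
    then show False using assms(1)[of "- (a + 1) / b"] True by simp
  qed
  with True show ?thesis by simp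
next
  case False
  have "0 \<le> a + (- b / c) * b + (- b / c)\<^sup>2 * c / 2" by (rule assms(1))
  also have "\<dots> = a - b\<^sup>2 / (2 * c)" using False by (simp add: field_simps power2_eq_square)
  finally show ?thesis using False assms(2) by (simp add: field_simps)
qed

text \<open>A minimising sequence of \<open>B(f,f)/2 - L f\<close>, where \<open>f + c g\<close> is written \<open>comb c f g\<close>.\<close>

lemma riesz_sequence:
  fixes comb :: "real \<Rightarrow> 'v \<Rightarrow> 'v \<Rightarrow> 'v" and B :: "'v \<Rightarrow> 'v \<Rightarrow> real" and L :: "'v \<Rightarrow> real"
  assumes ne: "S \<noteq> {}"
    and closed: "\<And>c f g. f \<in> S \<Longrightarrow> g \<in> S \<Longrightarrow> comb c f g \<in> S"
    and lin: "\<And>c f g h. f \<in> S \<Longrightarrow> g \<in> S \<Longrightarrow> h \<in> S \<Longrightarrow> B (comb c f g) h = B f h + c * B g h"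
    and sym: "\<And>f g. f \<in> S \<Longrightarrow> g \<in> S \<Longrightarrow> B f g = B g f"
    and pos: "\<And>f. f \<in> S \<Longrightarrow> 0 \<le> B f f"
    and L: "\<And>c f g. f \<in> S \<Longrightarrow> g \<in> S \<Longrightarrow> L (comb c f g) = L f + c * L g"
    and bound: "\<And>f. f \<in> S \<Longrightarrow> (L f)\<^sup>2 \<le> C * B f f"
  shows "\<exists>x::nat \<Rightarrow> 'v. (\<forall>n. x n \<in> S) \<and>
    (\<forall>e>0. \<exists>N. \<forall>m\<ge>N. \<forall>n\<ge>N. B (comb (-1) (x m) (x n)) (comb (-1) (x m) (x n)) < e) \<and>
    (\<forall>y\<in>S. (\<lambda>n. B (x n) y) \<longlonglongrightarrow> L y)"
proof -
  define J where "J f = B f f / 2 - L f" for f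
  have J_comb: "J (comb t f y) = J f + t * (B f y - L y) + t\<^sup>2 * B y y / 2" if "f \<in> S" "y \<in> S" for t f y
  proof -
    have "B (comb t f y) (comb t f y) = B f (comb t f y) + t * B y (comb t f y)"
      using that closed by (intro lin) auto
    also have "B f (comb t f y) = B f f + t * B f y"
      using that closed lin sym by metis
    also have "B y (comb t f y) = B f y + t * B y y"
      using that closed lin sym by metis
    finally show ?thesis using L[OF that] by (simp add: J_def field_simps power2_eq_square)
  qed
  have J_low: "J f \<ge> - \<bar>C\<bar> / 2" if "f \<in> S" for f
  proof -
    have "(L f)\<^sup>2 \<le> \<bar>C\<bar> * B f f"
      using bound[OF that] mult_right_mono[OF abs_ge_self pos[OF that], of C] by linarith
    \<comment> \<open>The inequality of arithmetic and geometric means: it bounds |L f| by half of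
      |C| + B f f, and the energy term \<open>B f f / 2\<close> absorbs the second summand.\<close>
    also have "\<dots> \<le> ((\<bar>C\<bar> + B f f) / 2)\<^sup>2"
      using zero_le_power2[of "\<bar>C\<bar> - B f f"] by (simp add: field_simps power2_eq_square)
    finally have "\<bar>L f\<bar> \<le> \<bar>(\<bar>C\<bar> + B f f) / 2\<bar>" by (simp only: abs_le_square_iff)
    then show ?thesis using pos[OF that] by (simp add: J_def)
  qed
  then have bdd: "bdd_below (J ` S)" by (auto intro!: bdd_belowI)
  define I where "I = Inf (J ` S)"
  have I: "I \<le> J f" if "f \<in> S" for f unfolding I_def using bdd that by (intro cInf_lower) auto
  have "\<exists>f\<in>S. J f < I + 1 / real (Suc n)" for n
  proof -
    have "I < I + 1 / real (Suc n)" by simp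
    then show ?thesis unfolding I_def using ne bdd by (subst (asm) cInf_less_iff) auto
  qed
  then obtain x where x: "\<And>n. x n \<in> S" "\<And>n. J (x n) < I + 1 / real (Suc n)" by metis
  \<comment> \<open>The energy at \<open>x n + t y\<close> is at least its infimum for every t. The
    discriminant of this quadratic in t bounds the residual of the Euler-Lagrange equation by the
    excess energy of \<open>x n\<close>, which is below 1/(n+1).\<close>
  have res: "(B (x n) y - L y)\<^sup>2 \<le> 2 / real (Suc n) * B y y" if y: "y \<in> S" for n y
  proof -
    have "(B (x n) y - L y)\<^sup>2 \<le> 2 * (J (x n) - I) * B y y"
    proof (rule nonneg_quadratic_discriminant)
      show "0 \<le> B y y" by (rule pos[OF y])
      fix t
      have "I \<le> J (comb t (x n) y)" by (intro I closed x y)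
      then show "0 \<le> J (x n) - I + t * (B (x n) y - L y) + t\<^sup>2 * B y y / 2"
        by (simp add: J_comb[OF x(1) y])
    qed
    also have "\<dots> \<le> 2 * (1 / real (Suc n)) * B y y"
      using x(2)[of n] pos[OF y] by (intro mult_right_mono mult_left_mono) auto
    finally show ?thesis by simp
  qed
  have "(\<lambda>n. B (x n) y) \<longlonglongrightarrow> L y" if y: "y \<in> S" for y
  proof -
    have "(\<lambda>n. (2 * B y y) * inverse (real (Suc n))) \<longlonglongrightarrow> (2 * B y y) * 0"
      by (intro tendsto_intros LIMSEQ_inverse_real_of_nat)
    then have "(\<lambda>n. 2 / real (Suc n) * B y y) \<longlonglongrightarrow> 0" by (simp add: field_simps)
    then have "(\<lambda>n. (B (x n) y - L y)\<^sup>2) \<longlonglongrightarrow> 0"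
      using Lim_null_comparison[where f = "\<lambda>n. (B (x n) y - L y)\<^sup>2" and g = "\<lambda>n. 2 / real (Suc n) * B y y"
          and net = sequentially] res[OF y]
      by (simp only: real_norm_def abs_power2 eventually_True)
    then have "(\<lambda>n. sqrt ((B (x n) y - L y)\<^sup>2)) \<longlonglongrightarrow> sqrt 0" by (rule tendsto_real_sqrt)
    then have "(\<lambda>n. B (x n) y - L y) \<longlonglongrightarrow> 0" by (simp add: tendsto_rabs_zero_iff)
    then show ?thesis by (simp add: LIM_zero_iff)
  qed
  moreover have "\<exists>N. \<forall>m\<ge>N. \<forall>n\<ge>N. B (comb (-1) (x m) (x n)) (comb (-1) (x m) (x n)) < e" if e: "e > 0" for e
  proof -
    obtain N where N: "8 / e < real N" using reals_Archimedean2 by blast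
    then have N0: "real N > 0" using e by (meson divide_pos_pos less_trans zero_less_numeral)
    have "B d d < e" if mn: "m \<ge> N" "n \<ge> N" and d: "d = comb (-1) (x m) (x n)" for m n d
    proof -
      have dS: "d \<in> S" using d closed x by auto
      \<comment> \<open>Because d is the difference of two terms of the sequence,
        \<open>B d d\<close> is the difference of their residuals at d. The residual bound with y =
        d then yields (B d d)^2 <= (8/N) B d d, and one factor cancels.\<close>
      have "B d d = B (x m) d + (-1) * B (x n) d" using lin[OF x(1) x(1) dS] d by simp
      then have "(B d d)\<^sup>2 = ((B (x m) d - L d) - (B (x n) d - L d))\<^sup>2" by simp
      also have "\<dots> \<le> 2 * (B (x m) d - L d)\<^sup>2 + 2 * (B (x n) d - L d)\<^sup>2"
        using zero_le_power2[of "(B (x m) d - L d) + (B (x n) d - L d)"] by (simp add: power2_eq_square algebra_simps)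
      also have "\<dots> \<le> 2 * (2 / real (Suc m) * B d d) + 2 * (2 / real (Suc n) * B d d)"
        using res[OF dS] by (intro add_mono mult_left_mono) auto
      also have "\<dots> \<le> 2 * (2 / real N * B d d) + 2 * (2 / real N * B d d)"
        using mn N0 pos[OF dS] by (intro add_mono mult_left_mono mult_right_mono divide_left_mono) auto
      also have "\<dots> = 8 / real N * B d d" by simp
      finally have "B d d * B d d \<le> 8 / real N * B d d" by (simp add: power2_eq_square)
      moreover have "8 / real N < e" using N N0 e by (simp add: field_simps)
      ultimately show ?thesis using pos[OF dS] e
        by (metis dual_order.trans less_eq_real_def mult_le_cancel_right not_le)
    qed
    then show ?thesis by blast
  qed
  ultimately show ?thesis using x(1) by blast
qed

section \<open>The space of square-integrable fields\<close>

lemma L2_on_inner_integrable: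
  assumes "L2_on K u" "L2_on K v"
  shows "integrable (lebesgue_on K) (\<lambda>x. u x \<bullet> v x)"
proof (rule Bochner_Integration.integrable_bound)
  show "integrable (lebesgue_on K) (\<lambda>x. (norm (u x))\<^sup>2 + (norm (v x))\<^sup>2)"
    using assms by (auto simp: L2_on_def)
  show "(\<lambda>x. u x \<bullet> v x) \<in> borel_measurable (lebesgue_on K)" using assms by (auto simp: L2_on_def)
  have "\<bar>u x \<bullet> v x\<bar> \<le> (norm (u x))\<^sup>2 + (norm (v x))\<^sup>2" for x
  proof -
    have "\<bar>u x \<bullet> v x\<bar> \<le> norm (u x) * norm (v x)" by (rule Cauchy_Schwarz_ineq2)
    also have "\<dots> \<le> (norm (u x))\<^sup>2 + (norm (v x))\<^sup>2"
    proof -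
      have "2 * (norm (u x) * norm (v x)) \<le> (norm (u x))\<^sup>2 + (norm (v x))\<^sup>2"
        using zero_le_power2[of "norm (u x) - norm (v x)"] by (simp add: power2_eq_square algebra_simps)
      moreover have "0 \<le> norm (u x) * norm (v x)" by simp
      ultimately show ?thesis by linarith
    qed
    finally show ?thesis .
  qed
  then show "AE x in lebesgue_on K. norm (u x \<bullet> v x) \<le> norm ((norm (u x))\<^sup>2 + (norm (v x))\<^sup>2)"
    by (intro AE_I2) auto
qed

lemma L2_on_comb:
  assumes "L2_on K u" "L2_on K v"
  shows "L2_on K (\<lambda>x. u x + c *\<^sub>R v x)"
proof -
  have "(norm (u x + c *\<^sub>R v x))\<^sup>2 = (u x \<bullet> u x) + 2 * c * (u x \<bullet> v x) + c\<^sup>2 * (v x \<bullet> v x)" for x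
    unfolding power2_norm_eq_inner
    by (simp add: inner_add_left inner_add_right inner_commute power2_eq_square algebra_simps)
  then have "integrable (lebesgue_on K) (\<lambda>x. (norm (u x + c *\<^sub>R v x))\<^sup>2)"
    using assms by (simp add: L2_on_inner_integrable)
  with assms show ?thesis by (auto simp: L2_on_def)
qed

lemma L2_on_zero: "L2_on K (\<lambda>x. 0)"
  by (simp add: L2_on_def)

lemma L2_on_diff: "L2_on K u \<Longrightarrow> L2_on K v \<Longrightarrow> L2_on K (\<lambda>x. u x - v x)"
  using L2_on_comb[of K u v "-1"] by simp

lemma L2_on_cong_AE:
  assumes "L2_on K u" "v \<in> borel_measurable (lebesgue_on K)" "AE x in lebesgue_on K. u x = v x"
  shows "L2_on K v"
proof -
  have "integrable (lebesgue_on K) (\<lambda>x. (norm (v x))\<^sup>2)"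
    using assms by (subst integrable_cong_AE[symmetric, of "\<lambda>x. (norm (u x))\<^sup>2"]) (auto simp: L2_on_def)
  with assms show ?thesis by (simp add: L2_on_def)
qed

lemma L2_on_mult_bounded:
  fixes v :: "real^3 \<Rightarrow> 'a::euclidean_space"
  assumes "L2_on K v" "b \<in> borel_measurable (lebesgue_on K)" "AE x in lebesgue_on K. \<bar>b x\<bar> \<le> C"
  shows "L2_on K (\<lambda>x. b x *\<^sub>R v x)"
proof -
  have "integrable (lebesgue_on K) (\<lambda>x. (norm (b x *\<^sub>R v x))\<^sup>2)"
  proof (rule Bochner_Integration.integrable_bound)
    show "integrable (lebesgue_on K) (\<lambda>x. C\<^sup>2 * (norm (v x))\<^sup>2)" using assms by (simp add: L2_on_def)
    show "(\<lambda>x. (norm (b x *\<^sub>R v x))\<^sup>2) \<in> borel_measurable (lebesgue_on K)"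
      using assms by (auto simp: L2_on_def)
    show "AE x in lebesgue_on K. norm ((norm (b x *\<^sub>R v x))\<^sup>2) \<le> norm (C\<^sup>2 * (norm (v x))\<^sup>2)"
      using assms(3)
    proof eventually_elim
      case (elim x)
      then have "\<bar>b x\<bar>\<^sup>2 \<le> C\<^sup>2" by (intro power_mono) auto
      then show ?case by (simp add: power_mult_distrib mult_right_mono)
    qed
  qed
  with assms show ?thesis by (auto simp: L2_on_def)
qed

lemma finite_measure_lebesgue_on:
  assumes "bounded K" "K \<in> sets borel"
  shows "finite_measure (lebesgue_on K)"
proof -
  have "emeasure (lebesgue_on K) (space (lebesgue_on K)) < \<infinity>"
    using emeasure_bounded_finite[OF assms(1)] assms(2) by (simp add: emeasure_restrict_space)
  then show ?thesis by (intro finite_measureI) auto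
qed

lemma L2_on_bounded:
  assumes "bounded K" "open K" "v \<in> borel_measurable (lebesgue_on K)" "\<And>x. x \<in> K \<Longrightarrow> norm (v x) \<le> C"
  shows "L2_on K v"
proof -
  interpret finite_measure "lebesgue_on K"
    using assms(1,2) by (intro finite_measure_lebesgue_on) auto
  have "integrable (lebesgue_on K) (\<lambda>x. (norm (v x))\<^sup>2)"
  proof (rule integrable_const_bound[where B = "C\<^sup>2"])
    show "AE x in lebesgue_on K. norm ((norm (v x))\<^sup>2) \<le> C\<^sup>2"
      using assms(4) by (intro AE_I2) (auto intro!: power_mono)
  qed (use assms(3) in measurable)
  with assms show ?thesis by (simp add: L2_on_def)
qed

lemma L2_on_continuous:
  assumes "bounded K" "open K" "continuous_on UNIV v"
  shows "L2_on K v"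
proof -
  have "compact (v ` closure K)"
    using assms by (intro compact_continuous_image) (auto intro: continuous_on_subset)
  then obtain C where "\<And>x. x \<in> closure K \<Longrightarrow> norm (v x) \<le> C"
    using compact_imp_bounded by (metis bounded_iff image_eqI)
  then have "\<And>x. x \<in> K \<Longrightarrow> norm (v x) \<le> C" using closure_subset by blast
  then show ?thesis
    using assms by (intro L2_on_bounded borel_measurable_lebesgue_onI borel_measurable_continuous_onI)
qed

lemma L2_Cauchy_Schwarz:
  assumes "L2_on K u" "L2_on K v"
  shows "(LINT x|lebesgue_on K. u x \<bullet> v x)\<^sup>2 \<le>
    (LINT x|lebesgue_on K. (norm (u x))\<^sup>2) * (LINT x|lebesgue_on K. (norm (v x))\<^sup>2)"
proof -
  let ?I = "\<lambda>f. LINT x|lebesgue_on K. f x :: real"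
  have int: "integrable (lebesgue_on K) (\<lambda>x. u x \<bullet> u x)" "integrable (lebesgue_on K) (\<lambda>x. u x \<bullet> v x)"
    "integrable (lebesgue_on K) (\<lambda>x. v x \<bullet> v x)"
    using assms by (simp_all add: L2_on_inner_integrable)
  have "0 \<le> ?I (\<lambda>x. u x \<bullet> u x) / 2 + t * ?I (\<lambda>x. u x \<bullet> v x) + t\<^sup>2 * ?I (\<lambda>x. v x \<bullet> v x) / 2" for t
  proof -
    have "(norm (u x + t *\<^sub>R v x))\<^sup>2 = (u x \<bullet> u x) + 2 * t * (u x \<bullet> v x) + t\<^sup>2 * (v x \<bullet> v x)" for x
      unfolding power2_norm_eq_inner
      by (simp add: inner_add_left inner_add_right inner_commute power2_eq_square algebra_simps)
    then have "?I (\<lambda>x. (norm (u x + t *\<^sub>R v x))\<^sup>2)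
      = ?I (\<lambda>x. u x \<bullet> u x) + 2 * t * ?I (\<lambda>x. u x \<bullet> v x) + t\<^sup>2 * ?I (\<lambda>x. v x \<bullet> v x)"
      using int by simp
    moreover have "0 \<le> ?I (\<lambda>x. (norm (u x + t *\<^sub>R v x))\<^sup>2)" by simp
    ultimately show ?thesis by simp
  qed
  from nonneg_quadratic_discriminant[OF this] show ?thesis
    by (simp add: power2_norm_eq_inner)
qed

text \<open>Riesz-Fischer. A subsequence whose consecutive squared distances are below 4^(-k) has
  summable increments almost everywhere, hence a pointwise limit; Fatou's lemma along the
  subsequence then bounds the distance of every late term of the full sequence from that
  limit.\<close>

lemma L2_complete:
  fixes u :: "nat \<Rightarrow> real^3 \<Rightarrow> 'a::euclidean_space"
  assumes K: "bounded K" "open K" and u: "\<And>n. L2_on K (u n)"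
    and cauchy: "\<And>e. e > 0 \<Longrightarrow> \<exists>N. \<forall>m\<ge>N. \<forall>n\<ge>N. (LINT x|lebesgue_on K. (norm (u m x - u n x))\<^sup>2) < e"
  shows "\<exists>w. L2_on K w \<and> (\<lambda>n. LINT x|lebesgue_on K. (norm (u n x - w x))\<^sup>2) \<longlonglongrightarrow> 0"
proof -
  define M where "M = lebesgue_on K"
  interpret finite_measure M
    unfolding M_def using K by (intro finite_measure_lebesgue_on) auto
  have [measurable]: "u n \<in> borel_measurable M" for n using u by (simp add: L2_on_def M_def)
  have sq: "(\<integral>\<^sup>+x. ennreal ((norm (u m x - u n x))\<^sup>2) \<partial>M) = ennreal (LINT x|M. (norm (u m x - u n x))\<^sup>2)" for m n
    using L2_on_diff[OF u u, of m n] by (intro nn_integral_eq_integral) (auto simp: L2_on_def M_def)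
  have "\<exists>N. \<forall>m\<ge>N. \<forall>n\<ge>N. (LINT x|M. (norm (u m x - u n x))\<^sup>2) < (1/4)^k" for k
    unfolding M_def by (rule cauchy) simp
  then have "\<forall>k. \<exists>N. \<forall>m\<ge>N. \<forall>n\<ge>N. (LINT x|M. (norm (u m x - u n x))\<^sup>2) < (1/4)^k" by simp
  from choice[OF this] obtain N
    where "\<forall>k. \<forall>m\<ge>N k. \<forall>n\<ge>N k. (LINT x|M. (norm (u m x - u n x))\<^sup>2) < (1/4)^k" ..
  then have N: "(LINT x|M. (norm (u m x - u n x))\<^sup>2) < (1/4)^k" if "m \<ge> N k" "n \<ge> N k" for k m n
    using that by simp
  \<comment> \<open>Summing all thresholds up to k makes r monotone and at least \<open>N k\<close>;
    the added k makes it tend to infinity.\<close>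
  define r where "r k = (\<Sum>i\<le>k. N i) + k" for k
  have rN: "r k \<ge> N k" for k
    using member_le_sum[of k "{..k}" N] by (simp add: r_def trans_le_add1)
  have r_mono: "r k \<le> r (Suc k)" for k by (simp add: r_def)
  have r_ge: "r k \<ge> k" for k by (simp add: r_def)
  define d where "d k x = norm (u (r (Suc k)) x - u (r k) x)" for k x
  have d_meas [measurable]: "d k \<in> borel_measurable M" for k unfolding d_def by measurable
  have d_int: "(\<integral>\<^sup>+x. ennreal (d k x) \<partial>M) \<le> ennreal ((1/2)^k * (1 + measure M (space M)))" for k
  proof -
    \<comment> \<open>A weighted Young inequality: the square integrates to at most 4^(-k), so with
      the weight 2^k both terms have integrals of order 2^(-k). Finiteness of the measure enters
      through the constant term.\<close>
    have "d k x \<le> 2^k * (d k x)\<^sup>2 + (1/2)^k" for x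
    proof -
      have "0 \<le> (2^k * d k x - 1)\<^sup>2 / 2^k" by simp
      also have "\<dots> = 2^k * (d k x)\<^sup>2 - 2 * d k x + (1/2)^k"
        by (simp add: power2_eq_square field_simps power_one_over)
      finally have "2 * d k x \<le> 2^k * (d k x)\<^sup>2 + (1/2)^k" by simp
      moreover have "d k x \<ge> 0" by (simp add: d_def)
      ultimately show ?thesis by linarith
    qed
    then have "(\<integral>\<^sup>+x. ennreal (d k x) \<partial>M) \<le> (\<integral>\<^sup>+x. ennreal (2^k) * ennreal ((d k x)\<^sup>2) + ennreal ((1/2)^k) \<partial>M)"
      by (intro nn_integral_mono) (simp add: ennreal_mult[symmetric] ennreal_plus[symmetric] ennreal_leI del: ennreal_plus)
    also have "\<dots> = ennreal (2^k) * (\<integral>\<^sup>+x. ennreal ((d k x)\<^sup>2) \<partial>M) + ennreal ((1/2)^k) * emeasure M (space M)"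
      by (simp add: nn_integral_add nn_integral_cmult)
    also have "\<dots> \<le> ennreal (2^k) * ennreal ((1/4)^k) + ennreal ((1/2)^k) * emeasure M (space M)"
    proof (intro add_right_mono mult_left_mono)
      have "(LINT x|M. (norm (u (r (Suc k)) x - u (r k) x))\<^sup>2) < (1/4)^k"
        by (rule N) (use rN[of k] r_mono[of k] in linarith)+
      then show "(\<integral>\<^sup>+x. ennreal ((d k x)\<^sup>2) \<partial>M) \<le> ennreal ((1/4)^k)"
        unfolding d_def sq by (intro ennreal_leI) simp
    qed auto
    also have "\<dots> = ennreal ((1/2)^k * (1 + measure M (space M)))"
    proof -
      have "(2::real)^k * (1/4)^k = (1/2)^k" by (simp add: power_mult_distrib[symmetric])
      then show ?thesis
        by (simp add: emeasure_eq_measure ennreal_mult[symmetric] ennreal_plus[symmetric] distrib_left del: ennreal_plus)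
    qed
    finally show ?thesis .
  qed
  have "(\<integral>\<^sup>+x. (\<Sum>k. ennreal (d k x)) \<partial>M) = (\<Sum>k. \<integral>\<^sup>+x. ennreal (d k x) \<partial>M)"
    by (intro nn_integral_suminf) measurable
  also have "\<dots> \<le> (\<Sum>k. ennreal ((1/2)^k * (1 + measure M (space M))))"
    by (intro suminf_le d_int) auto
  also have "\<dots> < \<infinity>"
    by (subst suminf_ennreal2) (auto intro!: summable_mult2 summable_geometric)
  finally have "AE x in M. (\<Sum>k. ennreal (d k x)) \<noteq> \<infinity>"
    by (intro nn_integral_PInf_AE) auto
  then have conv: "AE x in M. (\<lambda>k. u (r k) x) \<longlonglongrightarrow> lim (\<lambda>k. u (r k) x)"
  proof eventually_elim
    case (elim x)
    have "summable (\<lambda>k. d k x)" using elim by (intro summable_suminf_not_top) (auto simp: d_def)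
    then have "summable (\<lambda>k. u (r (Suc k)) x - u (r k) x)" unfolding d_def by (rule summable_norm_cancel)
    then have "convergent (\<lambda>n. \<Sum>k<n. u (r (Suc k)) x - u (r k) x)" by (simp add: summable_iff_convergent)
    then have "convergent (\<lambda>n. u (r n) x - u (r 0) x)" by (simp add: sum_lessThan_telescope[of "\<lambda>n. u (r n) x"])
    then have "convergent (\<lambda>n. (u (r n) x - u (r 0) x) + u (r 0) x)" by (intro convergent_add convergent_const)
    then show ?case by (simp add: convergent_LIMSEQ_iff)
  qed
  \<comment> \<open>Where the subsequence diverges \<open>lim\<close> has an unspecified value; this
    happens only on a null set.\<close>
  define w where "w x = lim (\<lambda>k. u (r k) x)" for x
  have w_meas [measurable]: "w \<in> borel_measurable M" unfolding w_def by measurable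
  have est: "(\<integral>\<^sup>+x. ennreal ((norm (u n x - w x))\<^sup>2) \<partial>M) \<le> ennreal ((1/4)^j)" if n: "n \<ge> N j" for n j
  proof -
    have "(\<integral>\<^sup>+x. ennreal ((norm (u n x - w x))\<^sup>2) \<partial>M)
      = (\<integral>\<^sup>+x. liminf (\<lambda>k. ennreal ((norm (u n x - u (r k) x))\<^sup>2)) \<partial>M)"
    proof (rule nn_integral_cong_AE, use conv in eventually_elim)
      case (elim x)
      have "(\<lambda>k. ennreal ((norm (u n x - u (r k) x))\<^sup>2)) \<longlonglongrightarrow> ennreal ((norm (u n x - w x))\<^sup>2)"
        unfolding w_def by (intro tendsto_intros tendsto_ennrealI elim)
      then show ?case by (intro lim_imp_Liminf[symmetric]) auto
    qed
    also have "\<dots> \<le> liminf (\<lambda>k. \<integral>\<^sup>+x. ennreal ((norm (u n x - u (r k) x))\<^sup>2) \<partial>M)"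
      by (intro nn_integral_liminf) measurable
    also have "\<dots> \<le> ennreal ((1/4)^j)"
    proof (rule Liminf_le)
      show "\<forall>\<^sub>F k in sequentially. (\<integral>\<^sup>+x. ennreal ((norm (u n x - u (r k) x))\<^sup>2) \<partial>M) \<le> ennreal ((1/4)^j)"
        using eventually_ge_at_top[of "N j"]
      proof eventually_elim
        case (elim k)
        then have "r k \<ge> N j" using r_ge[of k] by linarith
        from N[OF n this] show ?case unfolding sq by (intro ennreal_leI) simp
      qed
    qed simp
    finally show ?thesis .
  qed
  have int: "integrable M (\<lambda>x. (norm (u n x - w x))\<^sup>2)" if "n \<ge> N j" for n j
    using est[OF that] by (intro integrableI_bounded) (auto simp: le_less_trans)
  have "L2_on K (\<lambda>x. u (N 0) x - w x)"
    using int[of 0 "N 0"] by (simp add: L2_on_def M_def[symmetric])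
  from L2_on_diff[OF u[of "N 0"] this] have w: "L2_on K w" by simp
  have le: "(LINT x|M. (norm (u n x - w x))\<^sup>2) \<le> (1/4)^j" if "n \<ge> N j" for n j
    using est[OF that] int[OF that] by (subst (asm) nn_integral_eq_integral) auto
  have "(\<lambda>n. LINT x|M. (norm (u n x - w x))\<^sup>2) \<longlonglongrightarrow> 0"
  proof (rule LIMSEQ_I)
    fix e :: real assume e: "e > 0"
    obtain j where j: "(1/4::real)^j < e" using real_arch_pow_inv[OF e, of "1/4"] by auto
    show "\<exists>no. \<forall>n\<ge>no. norm ((LINT x|M. (norm (u n x - w x))\<^sup>2) - 0) < e"
      using le[of j] j by (intro exI[of _ "N j"]) (auto intro: le_less_trans)
  qed
  with w show ?thesis unfolding M_def by blast
qed

lemma L2_inner_tendsto: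
  assumes u: "\<And>n. L2_on K (u n)" and w: "L2_on K w" and v: "L2_on K v"
    and lim: "(\<lambda>n. LINT x|lebesgue_on K. (norm (u n x - w x))\<^sup>2) \<longlonglongrightarrow> 0"
  shows "(\<lambda>n. LINT x|lebesgue_on K. u n x \<bullet> v x) \<longlonglongrightarrow> (LINT x|lebesgue_on K. w x \<bullet> v x)"
proof -
  let ?V = "LINT x|lebesgue_on K. (norm (v x))\<^sup>2"
  have "(\<lambda>n. sqrt ((LINT x|lebesgue_on K. (norm (u n x - w x))\<^sup>2) * ?V)) \<longlonglongrightarrow> sqrt (0 * ?V)"
    by (intro tendsto_intros lim)
  moreover have "\<bar>(LINT x|lebesgue_on K. u n x \<bullet> v x) - (LINT x|lebesgue_on K. w x \<bullet> v x)\<bar>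
    \<le> sqrt ((LINT x|lebesgue_on K. (norm (u n x - w x))\<^sup>2) * ?V)" for n
  proof -
    have "(LINT x|lebesgue_on K. u n x \<bullet> v x) - (LINT x|lebesgue_on K. w x \<bullet> v x)
      = (LINT x|lebesgue_on K. (u n x - w x) \<bullet> v x)"
      using L2_on_inner_integrable[OF u v] L2_on_inner_integrable[OF w v] by (simp add: inner_diff_left)
    with L2_Cauchy_Schwarz[OF L2_on_diff[OF u w] v, of n] show ?thesis
      by (intro real_le_rsqrt) simp
  qed
  ultimately have "(\<lambda>n. (LINT x|lebesgue_on K. u n x \<bullet> v x) - (LINT x|lebesgue_on K. w x \<bullet> v x)) \<longlonglongrightarrow> 0"
    using Lim_null_comparison[where f = "\<lambda>n. (LINT x|lebesgue_on K. u n x \<bullet> v x) - (LINT x|lebesgue_on K. w x \<bullet> v x)"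
        and g = "\<lambda>n. sqrt ((LINT x|lebesgue_on K. (norm (u n x - w x))\<^sup>2) * ?V)" and net = sequentially]
    by (simp only: real_norm_def mult_zero_left real_sqrt_zero eventually_True)
  then show ?thesis by (simp add: LIM_zero_iff)
qed

text \<open>Riesz representation on the closure of the test functions; the representing limit equals \<open>f\<close>
  by the fundamental lemma.\<close>

lemma test_functions_dense_L2:
  fixes f :: "real^3 \<Rightarrow> real"
  assumes K: "bounded K" "open K" and f: "L2_on K f"
  obtains \<phi> where "\<And>n. test_function K (\<phi> n)"
    "(\<lambda>n. LINT x|lebesgue_on K. (\<phi> n x - f x)\<^sup>2) \<longlonglongrightarrow> 0"
proof -
  let ?S = "{\<phi>. test_function K \<phi>}"
  define comb where "comb c \<phi> \<psi> = (\<lambda>x. \<phi> x + c * \<psi> x :: real)" for c \<phi> and \<psi> :: "real^3 \<Rightarrow> real"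
  define B where "B \<phi> \<psi> = (LINT x|lebesgue_on K. \<phi> x * \<psi> x)" for \<phi> \<psi> :: "real^3 \<Rightarrow> real"
  have T: "L2_on K \<phi>" if "test_function K \<phi>" for \<phi>
    using that K by (intro L2_on_continuous smooth_continuous test_function_smooth)
  have int: "integrable (lebesgue_on K) (\<lambda>x. p x * q x)" if "L2_on K p" "L2_on K q" for p q :: "real^3 \<Rightarrow> real"
    using L2_on_inner_integrable[OF that] by simp
  have "\<exists>x::nat \<Rightarrow> _. (\<forall>n. x n \<in> ?S) \<and>
    (\<forall>e>0. \<exists>N. \<forall>m\<ge>N. \<forall>n\<ge>N. B (comb (-1) (x m) (x n)) (comb (-1) (x m) (x n)) < e) \<and>
    (\<forall>y\<in>?S. (\<lambda>n. B (x n) y) \<longlonglongrightarrow> (LINT x|lebesgue_on K. f x * y x))"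
  proof (rule riesz_sequence[where C = "LINT x|lebesgue_on K. (norm (f x))\<^sup>2"])
    show "comb c p q \<in> ?S" if "p \<in> ?S" "q \<in> ?S" for c p q
      using that unfolding comb_def
      by (auto intro!: test_function_add test_function_mult_smooth smooth_const)
    show "B (comb c p q) h = B p h + c * B q h" if "p \<in> ?S" "q \<in> ?S" "h \<in> ?S" for c p q h
      using int[OF T T, of p h] int[OF T T, of q h] that
      by (simp add: B_def comb_def distrib_right mult.assoc)
    show "(LINT x|lebesgue_on K. f x * comb c p q x)
      = (LINT x|lebesgue_on K. f x * p x) + c * (LINT x|lebesgue_on K. f x * q x)" if "p \<in> ?S" "q \<in> ?S" for c p q
      using int[OF f T, of p] int[OF f T, of q] that
      by (simp add: comb_def distrib_left mult.left_commute)
    show "(LINT x|lebesgue_on K. f x * p x)\<^sup>2 \<le> (LINT x|lebesgue_on K. (norm (f x))\<^sup>2) * B p p" if "p \<in> ?S" for p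
      using L2_Cauchy_Schwarz[OF f T, of p] that by (simp add: B_def power2_eq_square)
    show "B p q = B q p" for p q by (simp add: B_def mult.commute)
    show "0 \<le> B p p" for p by (simp add: B_def)
    have "test_function K (\<lambda>x. 0)" by (simp add: test_function_def smooth_const)
    then show "?S \<noteq> {}" by blast
  qed
  then obtain \<phi> where \<phi>: "\<And>n. test_function K (\<phi> n)"
    "\<And>e. e > 0 \<Longrightarrow> \<exists>N. \<forall>m\<ge>N. \<forall>n\<ge>N. B (comb (-1) (\<phi> m) (\<phi> n)) (comb (-1) (\<phi> m) (\<phi> n)) < e"
    "\<And>y. test_function K y \<Longrightarrow> (\<lambda>n. B (\<phi> n) y) \<longlonglongrightarrow> (LINT x|lebesgue_on K. f x * y x)"
    by blast
  obtain p where p: "L2_on K p" "(\<lambda>n. LINT x|lebesgue_on K. (norm (\<phi> n x - p x))\<^sup>2) \<longlonglongrightarrow> 0"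
    using L2_complete[OF K, of \<phi>] T[OF \<phi>(1)] \<phi>(2) by (auto simp: B_def comb_def power2_eq_square)
  have "AE x in lebesgue_on K. f x - p x = 0"
  proof (rule fundamental_lemma[OF K(2)])
    show "integrable (lebesgue_on K) (\<lambda>x. f x - p x)"
      using L2_on_diff[OF f p(1)] int[OF _ L2_on_continuous[OF K continuous_on_const], of _ 1] by simp
    fix y assume y: "test_function K y"
    have "(\<lambda>n. LINT x|lebesgue_on K. \<phi> n x \<bullet> y x) \<longlonglongrightarrow> (LINT x|lebesgue_on K. p x \<bullet> y x)"
      by (rule L2_inner_tendsto[OF T[OF \<phi>(1)] p(1) T[OF y] p(2)])
    with \<phi>(3)[OF y] have "(LINT x|lebesgue_on K. f x * y x) = (LINT x|lebesgue_on K. p x * y x)"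
      by (simp add: B_def LIMSEQ_unique)
    then show "(LINT x|lebesgue_on K. (f x - p x) * y x) = 0"
      using int[OF f T[OF y]] int[OF p(1) T[OF y]] by (simp add: left_diff_distrib)
  qed
  then have "(LINT x|lebesgue_on K. (\<phi> n x - f x)\<^sup>2) = (LINT x|lebesgue_on K. (norm (\<phi> n x - p x))\<^sup>2)" for n
  proof (intro integral_cong_AE)
    have [measurable]: "f \<in> borel_measurable (lebesgue_on K)" "p \<in> borel_measurable (lebesgue_on K)"
      "\<phi> n \<in> borel_measurable (lebesgue_on K)"
      using f p(1) T[OF \<phi>(1)] by (auto simp: L2_on_def)
    show "(\<lambda>x. (\<phi> n x - f x)\<^sup>2) \<in> borel_measurable (lebesgue_on K)"
      "(\<lambda>x. (norm (\<phi> n x - p x))\<^sup>2) \<in> borel_measurable (lebesgue_on K)" by measurable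
  qed auto
  then have "(\<lambda>n. LINT x|lebesgue_on K. (\<phi> n x - f x)\<^sup>2) \<longlonglongrightarrow> 0" using p(2) by (simp only:)
  with \<phi>(1) show ?thesis by (rule that)
qed

section \<open>The Poincare inequality\<close>

lemma pair_sigma_finite_lborel: "pair_sigma_finite lborel lborel"
  by (intro pair_sigma_finite.intro lborel.sigma_finite_measure_axioms)

lemma nn_integral_lborel_affine:
  fixes f :: "real^3 \<Rightarrow> ennreal"
  assumes f[measurable]: "f \<in> borel_measurable borel" and c: "c \<noteq> 0"
  shows "(\<integral>\<^sup>+x. f x \<partial>lborel) = ennreal (\<bar>c\<bar> ^ 3) * (\<integral>\<^sup>+x. f (t + c *\<^sub>R x) \<partial>lborel)"
  by (subst lborel_affine[OF c, of t]) (simp add: nn_integral_density nn_integral_distr nn_integral_cmult)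

text \<open>The 8 is the inverse of (1/2)^3, the smallest Jacobian of a scaling by c >= 1/2 in three
  dimensions.\<close>

lemma nn_integral_lborel_affine_le:
  fixes f :: "real^3 \<Rightarrow> ennreal"
  assumes f: "f \<in> borel_measurable borel" and c: "1/2 \<le> c"
  shows "(\<integral>\<^sup>+x. f (t + c *\<^sub>R x) \<partial>lborel) \<le> 8 * (\<integral>\<^sup>+x. f x \<partial>lborel)"
proof -
  have "(1/2)^3 \<le> c^3" using c by (intro power_mono) auto
  then have "1 \<le> 8 * \<bar>c\<bar>^3" using c by (simp add: power_divide)
  then have "1 * (\<integral>\<^sup>+x. f (t + c *\<^sub>R x) \<partial>lborel) \<le> ennreal (8 * \<bar>c\<bar>^3) * (\<integral>\<^sup>+x. f (t + c *\<^sub>R x) \<partial>lborel)"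
    by (intro mult_right_mono) auto
  also have "\<dots> = 8 * (ennreal (\<bar>c\<bar>^3) * (\<integral>\<^sup>+x. f (t + c *\<^sub>R x) \<partial>lborel))"
    by (subst ennreal_mult) (auto simp: mult.assoc)
  also have "\<dots> = 8 * (\<integral>\<^sup>+x. f x \<partial>lborel)"
    using nn_integral_lborel_affine[OF f, of c t] c by simp
  finally show ?thesis by simp
qed

lemma smooth_difference_segment:
  assumes \<phi>: "smooth_on UNIV \<phi>" and D: "norm (x - y) \<le> D"
  shows "ennreal ((\<phi> x - \<phi> y)\<^sup>2) \<le>
    ennreal (D\<^sup>2) * (\<integral>\<^sup>+t. ennreal ((norm (gradient \<phi> (y + t *\<^sub>R (x - y))))\<^sup>2) * indicator {0..1} t \<partial>lborel)"
proof -
  define F' where "F' t = gradient \<phi> (y + t *\<^sub>R (x - y)) \<bullet> (x - y)" for t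
  define c where "c = \<phi> x - \<phi> y"
  have G_cont: "continuous_on UNIV (\<lambda>t. gradient \<phi> (y + t *\<^sub>R (x - y)))"
    by (rule continuous_on_compose2[OF smooth_gradient_continuous[OF \<phi>]]) (auto intro!: continuous_intros)
  have F'_cont: "continuous_on UNIV F'" unfolding F'_def by (intro continuous_intros G_cont)
  have int: "integrable lborel (\<lambda>t. indicator {0..1::real} t *\<^sub>R g t)" if "continuous_on UNIV g" for g :: "real \<Rightarrow> real"
    by (rule borel_integrable_compact) (auto intro: continuous_on_subset[OF that])
  have FTC: "(LINT t|lborel. F' t * indicator {0..1} t) = c"
  proof -
    have der: "((\<lambda>t. \<phi> (y + t *\<^sub>R (x - y))) has_real_derivative F' t) (at t)" for t
      unfolding F'_def by (rule has_real_derivative_line[OF \<phi>])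
    have "isCont F' t" for t using F'_cont by (simp add: continuous_on_eq_continuous_at)
    from integral_FTC_Icc_real[of 0 1, OF _ der this] show ?thesis by (simp add: c_def)
  qed
  have int': "integrable lborel (\<lambda>t. F' t * indicator {0..1} t)" "integrable lborel (\<lambda>t. (F' t)\<^sup>2 * indicator {0..1} t)"
    using int[OF F'_cont] int[of "\<lambda>t. (F' t)\<^sup>2"] F'_cont by (auto intro!: continuous_intros simp: mult.commute)
  \<comment> \<open>Since c is the mean of F' on the unit interval, expanding the variance of F'
    gives the Cauchy-Schwarz bound c^2 <= integral of F'^2.\<close>
  have "0 \<le> (LINT t|lborel. (F' t - c)\<^sup>2 * indicator {0..1} t)" by simp
  also have "\<dots> = (LINT t|lborel. (F' t)\<^sup>2 * indicator {0..1} t - 2 * c * (F' t * indicator {0..1} t) + c\<^sup>2 * indicator {0..1} t)"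
    by (rule Bochner_Integration.integral_cong) (auto simp: power2_eq_square algebra_simps)
  also have "\<dots> = (LINT t|lborel. (F' t)\<^sup>2 * indicator {0..1} t) - 2 * c * c + c\<^sup>2"
    using int' FTC by simp
  finally have "c\<^sup>2 \<le> (LINT t|lborel. (F' t)\<^sup>2 * indicator {0..1} t)" by (simp add: power2_eq_square)
  then have "ennreal (c\<^sup>2) \<le> ennreal (LINT t|lborel. (F' t)\<^sup>2 * indicator {0..1} t)" by (rule ennreal_leI)
  also have "\<dots> = (\<integral>\<^sup>+t. ennreal ((F' t)\<^sup>2 * indicator {0..1} t) \<partial>lborel)"
    using int' by (intro nn_integral_eq_integral[symmetric]) auto
  also have "\<dots> \<le> (\<integral>\<^sup>+t. ennreal (D\<^sup>2) * (ennreal ((norm (gradient \<phi> (y + t *\<^sub>R (x - y))))\<^sup>2) * indicator {0..1} t) \<partial>lborel)"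
  proof (rule nn_integral_mono)
    fix t
    have "\<bar>F' t\<bar> \<le> norm (gradient \<phi> (y + t *\<^sub>R (x - y))) * D"
      unfolding F'_def using D by (intro order_trans[OF Cauchy_Schwarz_ineq2] mult_left_mono) auto
    then have "\<bar>F' t\<bar>\<^sup>2 \<le> (norm (gradient \<phi> (y + t *\<^sub>R (x - y))) * D)\<^sup>2" by (intro power_mono) auto
    then have "(F' t)\<^sup>2 \<le> D\<^sup>2 * (norm (gradient \<phi> (y + t *\<^sub>R (x - y))))\<^sup>2"
      by (simp add: power_mult_distrib mult.commute)
    then show "ennreal ((F' t)\<^sup>2 * indicator {0..1} t)
      \<le> ennreal (D\<^sup>2) * (ennreal ((norm (gradient \<phi> (y + t *\<^sub>R (x - y))))\<^sup>2) * indicator {0..1} t)"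
      by (auto simp: indicator_def ennreal_mult[symmetric] intro!: ennreal_leI)
  qed
  also have "\<dots> = ennreal (D\<^sup>2) * (\<integral>\<^sup>+t. ennreal ((norm (gradient \<phi> (y + t *\<^sub>R (x - y))))\<^sup>2) * indicator {0..1} t \<partial>lborel)"
    using borel_measurable_continuous_onI[OF G_cont] by (intro nn_integral_cmult) simp
  finally show ?thesis unfolding c_def .
qed

text \<open>For \<open>t \<ge> 1/2\<close> the substitution \<open>z = (1-t) y + t x\<close> is made in \<open>x\<close>, otherwise in \<open>y\<close>, so that
  its Jacobian is at least \<open>1/8\<close>.\<close>

lemma poincare_double_integral:
  assumes K: "open K" "convex K" and D: "\<And>x y. x \<in> K \<Longrightarrow> y \<in> K \<Longrightarrow> norm (x - y) \<le> D"
    and \<phi>: "smooth_on UNIV \<phi>"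
  shows "(\<integral>\<^sup>+y. (\<integral>\<^sup>+x. ennreal ((\<phi> x - \<phi> y)\<^sup>2) * indicator K x \<partial>lborel) * indicator K y \<partial>lborel) \<le>
    ennreal (D\<^sup>2) * (8 * emeasure lborel K * (\<integral>\<^sup>+z. ennreal ((norm (gradient \<phi> z))\<^sup>2) * indicator K z \<partial>lborel))"
proof -
  have [measurable]: "K \<in> sets borel" using K by auto
  have [measurable]: "gradient \<phi> \<in> borel_measurable borel"
    using smooth_gradient_continuous[OF \<phi>] by (rule borel_measurable_continuous_onI)
  have [measurable]: "\<phi> \<in> borel_measurable borel"
    using smooth_continuous[OF \<phi>] by (rule borel_measurable_continuous_onI)
  define G where "G z = ennreal ((norm (gradient \<phi> z))\<^sup>2) * indicator K z" for z
  have [measurable]: "G \<in> borel_measurable borel" unfolding G_def by measurable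
  define I where "I = (\<integral>\<^sup>+z. G z \<partial>lborel)"
  \<comment> \<open>All domains of integration are encoded as indicators, with the squared gradient
    extended by zero, so that the three integrals run over whole spaces and can be interchanged
    freely.\<close>
  define H where "H x y t = G (y + t *\<^sub>R (x - y)) * indicator {0..1::real} t * indicator K x * indicator K y" for x y t
  have [measurable]: "(\<lambda>p. H (f p) (g p) (h p)) \<in> borel_measurable M"
    if [measurable]: "f \<in> borel_measurable M" "g \<in> borel_measurable M" "h \<in> borel_measurable M"
    for f g h and M :: "'z measure"
    unfolding H_def by measurable
  have pt: "ennreal ((\<phi> x - \<phi> y)\<^sup>2) * indicator K x * indicator K y \<le> ennreal (D\<^sup>2) * (\<integral>\<^sup>+t. H x y t \<partial>lborel)" for x y
  proof (cases "x \<in> K \<and> y \<in> K")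
    case True
    have "y + t *\<^sub>R (x - y) \<in> K" if "t \<in> {0..1}" for t
      using convexD_alt[OF K(2), of y x t] True that by (simp add: algebra_simps)
    then have "(\<integral>\<^sup>+t. H x y t \<partial>lborel) = (\<integral>\<^sup>+t. ennreal ((norm (gradient \<phi> (y + t *\<^sub>R (x - y))))\<^sup>2) * indicator {0..1} t \<partial>lborel)"
      using True by (intro nn_integral_cong) (auto simp: H_def G_def indicator_def)
    with smooth_difference_segment[OF \<phi> D[of x y]] True show ?thesis by simp
  qed auto
  have "(\<integral>\<^sup>+y. (\<integral>\<^sup>+x. ennreal ((\<phi> x - \<phi> y)\<^sup>2) * indicator K x \<partial>lborel) * indicator K y \<partial>lborel)
    = (\<integral>\<^sup>+y. (\<integral>\<^sup>+x. ennreal ((\<phi> x - \<phi> y)\<^sup>2) * indicator K x * indicator K y \<partial>lborel) \<partial>lborel)"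
    by (intro nn_integral_cong nn_integral_multc[symmetric]) measurable
  also have "\<dots> \<le> (\<integral>\<^sup>+y. (\<integral>\<^sup>+x. ennreal (D\<^sup>2) * (\<integral>\<^sup>+t. H x y t \<partial>lborel) \<partial>lborel) \<partial>lborel)"
    by (intro nn_integral_mono pt)
  also have "\<dots> = ennreal (D\<^sup>2) * (\<integral>\<^sup>+y. (\<integral>\<^sup>+x. (\<integral>\<^sup>+t. H x y t \<partial>lborel) \<partial>lborel) \<partial>lborel)"
    by (simp add: nn_integral_cmult)
  also have "(\<integral>\<^sup>+y. (\<integral>\<^sup>+x. (\<integral>\<^sup>+t. H x y t \<partial>lborel) \<partial>lborel) \<partial>lborel)
    = (\<integral>\<^sup>+y. (\<integral>\<^sup>+t. (\<integral>\<^sup>+x. H x y t \<partial>lborel) \<partial>lborel) \<partial>lborel)"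
    by (intro nn_integral_cong pair_sigma_finite.Fubini'[OF pair_sigma_finite_lborel]) measurable
  also have "\<dots> = (\<integral>\<^sup>+t. (\<integral>\<^sup>+y. (\<integral>\<^sup>+x. H x y t \<partial>lborel) \<partial>lborel) \<partial>lborel)"
    by (intro pair_sigma_finite.Fubini'[OF pair_sigma_finite_lborel]) measurable
  also have "\<dots> \<le> (\<integral>\<^sup>+t. 8 * emeasure lborel K * I * indicator {0..1::real} t \<partial>lborel)"
  proof (rule nn_integral_mono)
    fix t :: real
    consider "t \<notin> {0..1}" | "t \<in> {0..1}" "1/2 \<le> t" | "t \<in> {0..1}" "1/2 \<le> 1 - t" by fastforce
    then show "(\<integral>\<^sup>+y. (\<integral>\<^sup>+x. H x y t \<partial>lborel) \<partial>lborel) \<le> 8 * emeasure lborel K * I * indicator {0..1} t"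
    proof cases
      case 1 then show ?thesis by (simp add: H_def)
    next
      case 2
      have "(\<integral>\<^sup>+y. (\<integral>\<^sup>+x. H x y t \<partial>lborel) \<partial>lborel) \<le> (\<integral>\<^sup>+y. 8 * I * indicator K y \<partial>lborel)"
      proof (rule nn_integral_mono)
        fix y
        have "(\<integral>\<^sup>+x. H x y t \<partial>lborel) \<le> (\<integral>\<^sup>+x. G ((1 - t) *\<^sub>R y + t *\<^sub>R x) * indicator K y \<partial>lborel)"
          by (intro nn_integral_mono) (auto simp: H_def indicator_def algebra_simps)
        also have "\<dots> = (\<integral>\<^sup>+x. G ((1 - t) *\<^sub>R y + t *\<^sub>R x) \<partial>lborel) * indicator K y"
          by (intro nn_integral_multc) measurable
        also have "\<dots> \<le> 8 * I * indicator K y"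
          unfolding I_def using 2 by (intro mult_right_mono nn_integral_lborel_affine_le) auto
        finally show "(\<integral>\<^sup>+x. H x y t \<partial>lborel) \<le> 8 * I * indicator K y" .
      qed
      also have "\<dots> = 8 * I * emeasure lborel K" by (simp add: nn_integral_cmult)
      finally show ?thesis using 2 by (simp add: mult_ac)
    next
      case 3
      have "(\<integral>\<^sup>+y. (\<integral>\<^sup>+x. H x y t \<partial>lborel) \<partial>lborel) = (\<integral>\<^sup>+x. (\<integral>\<^sup>+y. H x y t \<partial>lborel) \<partial>lborel)"
        by (intro pair_sigma_finite.Fubini'[OF pair_sigma_finite_lborel]) measurable
      also have "\<dots> \<le> (\<integral>\<^sup>+x. 8 * I * indicator K x \<partial>lborel)"
      proof (rule nn_integral_mono)
        fix x
        have "(\<integral>\<^sup>+y. H x y t \<partial>lborel) \<le> (\<integral>\<^sup>+y. G (t *\<^sub>R x + (1 - t) *\<^sub>R y) * indicator K x \<partial>lborel)"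
          by (intro nn_integral_mono) (auto simp: H_def indicator_def algebra_simps)
        also have "\<dots> = (\<integral>\<^sup>+y. G (t *\<^sub>R x + (1 - t) *\<^sub>R y) \<partial>lborel) * indicator K x"
          by (intro nn_integral_multc) measurable
        also have "\<dots> \<le> 8 * I * indicator K x"
          unfolding I_def using 3 by (intro mult_right_mono nn_integral_lborel_affine_le) auto
        finally show "(\<integral>\<^sup>+y. H x y t \<partial>lborel) \<le> 8 * I * indicator K x" .
      qed
      also have "\<dots> = 8 * I * emeasure lborel K" by (simp add: nn_integral_cmult)
      finally show ?thesis using 3 by (simp add: mult_ac)
    qed
  qed
  also have "\<dots> = 8 * emeasure lborel K * I" by (simp add: nn_integral_cmult)
  finally show ?thesis by (simp add: I_def G_def mult_left_mono)
qed

lemma integrable_continuous_lebesgue_on: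
  fixes f :: "real^3 \<Rightarrow> real"
  assumes "bounded K" "open K" "continuous_on UNIV f"
  shows "integrable (lebesgue_on K) f"
  using L2_on_inner_integrable[OF L2_on_continuous[OF assms] L2_on_continuous[OF assms(1,2) continuous_on_const], of 1]
  by simp

text \<open>The integral of (\<phi>(x) - \<phi>(y))^2 over K x K is 2 m times the squared distance
  of \<phi> from its mean, where m is the volume of K. Dividing the double integral bound with its
  factor 8 m by 2 m leaves the constant 4 D^2.\<close>

lemma poincare_inequality:
  assumes K: "bounded K" "open K" "convex K" "K \<noteq> {}"
  obtains C where "\<And>\<phi>. smooth_on UNIV \<phi> \<Longrightarrow>
    (LINT x|lebesgue_on K. (\<phi> x - (LINT y|lebesgue_on K. \<phi> y) / measure lebesgue K)\<^sup>2)
      \<le> C * (LINT x|lebesgue_on K. (norm (gradient \<phi> x))\<^sup>2)"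
proof -
  define m where "m = measure lebesgue K"
  define M where "M = lebesgue_on K"
  have Kb: "K \<in> sets borel" and Kl: "K \<in> sets lebesgue" using K by auto
  have em: "emeasure lborel K = ennreal m"
    using emeasure_bounded_finite[OF K(1)] Kb
    by (simp add: m_def emeasure_eq_ennreal_measure measure_completion)
  have mM: "(LINT x|M. c) = m * c" for c :: real
    using Kl by (simp add: M_def m_def measure_restrict_space)
  have mS: "measure M (space M) = m" using mM[of 1] by simp
  have "\<not> negligible K" using K(2,4) by (rule open_not_negligible)
  then have "m \<noteq> 0" using Kb em by (auto simp: negligible_iff_null_sets null_sets_def)
  then have m: "m > 0" by (simp add: m_def zero_less_measure_iff)
  obtain D where D: "\<And>x y. x \<in> K \<Longrightarrow> y \<in> K \<Longrightarrow> norm (x - y) \<le> D"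
    using diameter_bounded_bound[OF K(1)] by (metis dist_norm)
  show ?thesis
  proof (rule that[of "4 * D\<^sup>2"], fold M_def m_def)
    fix \<phi> assume \<phi>: "smooth_on UNIV \<phi>"
    have \<phi>_cont: "continuous_on UNIV \<phi>" and G_cont: "continuous_on UNIV (gradient \<phi>)"
      using \<phi> by (simp_all add: smooth_continuous smooth_gradient_continuous)
    have [measurable]: "\<phi> \<in> borel_measurable borel" "gradient \<phi> \<in> borel_measurable borel"
      using \<phi>_cont G_cont by (auto intro: borel_measurable_continuous_onI)
    have int: "integrable M f" if "continuous_on UNIV f" for f :: "real^3 \<Rightarrow> real"
      unfolding M_def by (rule integrable_continuous_lebesgue_on[OF K(1,2) that])
    have ints: "integrable M \<phi>" "integrable M (\<lambda>x. (\<phi> x)\<^sup>2)" "integrable M (\<lambda>x. c)" for c :: real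
      by (rule int[OF \<phi>_cont] int[OF continuous_on_power[OF \<phi>_cont]] int[OF continuous_on_const])+
    define I1 where "I1 = (LINT x|M. \<phi> x)"
    define I2 where "I2 = (LINT x|M. (\<phi> x)\<^sup>2)"
    define E where "E = (LINT x|M. (norm (gradient \<phi> x))\<^sup>2)"
    have A: "(\<integral>\<^sup>+x. ennreal ((\<phi> x - y)\<^sup>2) * indicator K x \<partial>lborel) = ennreal (I2 - 2 * y * I1 + m * y\<^sup>2)" for y
    proof -
      have "(\<integral>\<^sup>+x. ennreal ((\<phi> x - y)\<^sup>2) * indicator K x \<partial>lborel) = (\<integral>\<^sup>+x. ennreal ((\<phi> x - y)\<^sup>2) \<partial>M)"
        unfolding M_def
        by (intro nn_integral_lebesgue_on_lborel[symmetric] Kb) measurable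
      also have "\<dots> = ennreal (LINT x|M. (\<phi> x - y)\<^sup>2)"
        using \<phi>_cont by (intro nn_integral_eq_integral int continuous_intros) auto
      also have "(LINT x|M. (\<phi> x - y)\<^sup>2) = (LINT x|M. (\<phi> x)\<^sup>2 - 2 * y * \<phi> x + y\<^sup>2)"
        by (rule Bochner_Integration.integral_cong) (auto simp: power2_eq_square algebra_simps)
      also have "\<dots> = I2 - 2 * y * I1 + m * y\<^sup>2"
        using ints by (simp add: I1_def I2_def mM mS)
      finally show ?thesis .
    qed
    \<comment> \<open>Nonnegativity for every y allows the inner integral, a polynomial in
      \<open>\<phi> y\<close>, to be integrated as a real function in the outer variable.\<close>
    have A0: "0 \<le> I2 - 2 * y * I1 + m * y\<^sup>2" for y
    proof -
      have "0 \<le> (LINT x|M. (\<phi> x - y)\<^sup>2)" by simp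
      also have "\<dots> = (LINT x|M. (\<phi> x)\<^sup>2 - 2 * y * \<phi> x + y\<^sup>2)"
        by (rule Bochner_Integration.integral_cong) (auto simp: power2_eq_square algebra_simps)
      also have "\<dots> = I2 - 2 * y * I1 + m * y\<^sup>2"
        using ints by (simp add: I1_def I2_def mM mS)
      finally show ?thesis .
    qed
    have "(\<integral>\<^sup>+y. (\<integral>\<^sup>+x. ennreal ((\<phi> x - \<phi> y)\<^sup>2) * indicator K x \<partial>lborel) * indicator K y \<partial>lborel)
      = (\<integral>\<^sup>+y. ennreal (I2 - 2 * \<phi> y * I1 + m * (\<phi> y)\<^sup>2) \<partial>M)"
      unfolding M_def A
      by (intro nn_integral_lebesgue_on_lborel[symmetric] Kb) measurable
    also have "\<dots> = ennreal (LINT y|M. I2 - 2 * \<phi> y * I1 + m * (\<phi> y)\<^sup>2)"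
      using \<phi>_cont A0 by (intro nn_integral_eq_integral int continuous_intros) auto
    also have "(LINT y|M. I2 - 2 * \<phi> y * I1 + m * (\<phi> y)\<^sup>2) = 2 * (m * I2 - I1\<^sup>2)"
    proof -
      have "(LINT y|M. I2 - 2 * \<phi> y * I1 + m * (\<phi> y)\<^sup>2) = m * I2 - 2 * I1 * I1 + m * I2"
        using ints by (simp add: mM mS I1_def[symmetric] I2_def[symmetric])
      then show ?thesis by (simp add: power2_eq_square)
    qed
    finally have 1: "(\<integral>\<^sup>+y. (\<integral>\<^sup>+x. ennreal ((\<phi> x - \<phi> y)\<^sup>2) * indicator K x \<partial>lborel) * indicator K y \<partial>lborel)
      = ennreal (2 * (m * I2 - I1\<^sup>2))" .
    have 2: "(\<integral>\<^sup>+z. ennreal ((norm (gradient \<phi> z))\<^sup>2) * indicator K z \<partial>lborel) = ennreal E"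
    proof -
      have "(\<integral>\<^sup>+z. ennreal ((norm (gradient \<phi> z))\<^sup>2) * indicator K z \<partial>lborel) = (\<integral>\<^sup>+z. ennreal ((norm (gradient \<phi> z))\<^sup>2) \<partial>M)"
        unfolding M_def
        by (intro nn_integral_lebesgue_on_lborel[symmetric] Kb) measurable
      also have "\<dots> = ennreal E"
        unfolding E_def using G_cont by (intro nn_integral_eq_integral int continuous_intros) auto
      finally show ?thesis .
    qed
    have E0: "E \<ge> 0" by (simp add: E_def)
    have "ennreal (2 * (m * I2 - I1\<^sup>2)) \<le> ennreal (D\<^sup>2) * (8 * ennreal m * ennreal E)"
      using poincare_double_integral[OF K(2,3) D \<phi>] by (simp add: 1 2 em)
    also have "\<dots> = ennreal (D\<^sup>2 * (8 * m * E))"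
      using m E0 by (simp add: ennreal_mult)
    finally have "2 * (m * I2 - I1\<^sup>2) \<le> D\<^sup>2 * (8 * m * E)"
      using m E0 by (subst (asm) ennreal_le_iff) auto
    then have le: "I2 - I1\<^sup>2 / m \<le> 4 * D\<^sup>2 * E"
      using m by (simp add: field_simps)
    have "(LINT x|M. (\<phi> x - I1 / m)\<^sup>2) = (LINT x|M. (\<phi> x)\<^sup>2 - 2 * (I1 / m) * \<phi> x + (I1 / m)\<^sup>2)"
      by (rule Bochner_Integration.integral_cong) (auto simp: power2_eq_square algebra_simps)
    also have "\<dots> = I2 - 2 * (I1 / m) * I1 + m * (I1 / m)\<^sup>2"
      using ints by (simp add: I1_def[symmetric] I2_def[symmetric] mM mS)
    also have "\<dots> = I2 - I1\<^sup>2 / m" using m by (simp add: field_simps power2_eq_square)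
    finally show "(LINT x|M. (\<phi> x - (LINT y|M. \<phi> y) / m)\<^sup>2) \<le> 4 * D\<^sup>2 * (LINT x|M. (norm (gradient \<phi> x))\<^sup>2)"
      using le by (simp add: I1_def E_def)
  qed
qed

text \<open>A density with zero mean does not see constants, so \<phi> may be replaced by \<phi>
  minus its mean before Cauchy-Schwarz and the Poincare inequality are applied.\<close>

lemma poincare_functional_bound:
  assumes K: "bounded K" "open K" "convex K" "K \<noteq> {}"
    and f: "L2_on K f" "(LINT x|lebesgue_on K. f x) = (0::real)"
  obtains C where "\<And>\<phi>. smooth_on UNIV \<phi> \<Longrightarrow>
    (LINT x|lebesgue_on K. f x * \<phi> x)\<^sup>2 \<le> C * (LINT x|lebesgue_on K. (norm (gradient \<phi> x))\<^sup>2)"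
proof -
  obtain C where C: "\<And>\<phi>. smooth_on UNIV \<phi> \<Longrightarrow>
    (LINT x|lebesgue_on K. (\<phi> x - (LINT y|lebesgue_on K. \<phi> y) / measure lebesgue K)\<^sup>2)
      \<le> C * (LINT x|lebesgue_on K. (norm (gradient \<phi> x))\<^sup>2)"
    using poincare_inequality[OF K] by blast
  let ?F = "LINT x|lebesgue_on K. (norm (f x))\<^sup>2"
  show ?thesis
  proof (rule that[of "?F * C"])
    fix \<phi> assume \<phi>: "smooth_on UNIV \<phi>"
    define a where "a = (LINT y|lebesgue_on K. \<phi> y) / measure lebesgue K"
    have \<phi>L: "L2_on K \<phi>" "L2_on K (\<lambda>x. \<phi> x - a)" "L2_on K (\<lambda>x. 1 :: real)"
      using K smooth_continuous[OF \<phi>] by (auto intro!: L2_on_continuous continuous_intros)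
    have "(LINT x|lebesgue_on K. f x * \<phi> x) = (LINT x|lebesgue_on K. f x * (\<phi> x - a))"
      using L2_on_inner_integrable[OF f(1) \<phi>L(1)] L2_on_inner_integrable[OF f(1) \<phi>L(3)] f(2)
      by (simp add: right_diff_distrib)
    then have "(LINT x|lebesgue_on K. f x * \<phi> x)\<^sup>2 \<le> ?F * (LINT x|lebesgue_on K. (\<phi> x - a)\<^sup>2)"
      using L2_Cauchy_Schwarz[OF f(1) \<phi>L(2)] by simp
    also have "\<dots> \<le> ?F * (C * (LINT x|lebesgue_on K. (norm (gradient \<phi> x))\<^sup>2))"
      unfolding a_def by (intro mult_left_mono C \<phi>) simp
    finally show "(LINT x|lebesgue_on K. f x * \<phi> x)\<^sup>2 \<le> ?F * C * (LINT x|lebesgue_on K. (norm (gradient \<phi> x))\<^sup>2)"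
      by (simp add: mult.assoc)
  qed
qed

section \<open>Green's formula on a cone over a triangle\<close>

text \<open>The constant is the absolute value of the determinant of A. It can be hidden behind an
  existential because the field in \<open>cone_green\<close> divides by it.\<close>

lemma lborel_linear_image:
  fixes A :: "real^3 \<Rightarrow> real^3"
  assumes A: "linear A" "inj A"
  obtains \<kappa> where "\<kappa> > 0" "lborel = density (distr lborel borel A) (\<lambda>_. ennreal \<kappa>)"
proof (rule that)
  let ?k = "\<bar>det (matrix A)\<bar>"
  have surj: "surj A" using A linear_injective_imp_surjective by blast
  show "?k > 0" using A by (simp add: det_nz_iff_inj)
  have A_meas: "A \<in> borel_measurable borel"
    using A(1) by (intro borel_measurable_continuous_onI linear_continuous_on) (simp add: linear_conv_bounded_linear)
  show "lborel = density (distr lborel borel A) (\<lambda>_. ennreal ?k)"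
  proof (rule lborel_eqI)
    fix l u :: "real^3" assume lu: "\<And>b. b \<in> Basis \<Longrightarrow> l \<bullet> b \<le> u \<bullet> b"
    define X where "X = A -` box l u"
    have AX: "A ` X = box l u" unfolding X_def using surj by (simp add: surj_image_vimage_eq)
    have X_eq: "X = inv A ` box l u" unfolding X_def using A(2) surj by (simp add: bij_def bij_vimage_eq_inv_image)
    obtain B where B: "linear B" "B \<circ> A = id" using A linear_injective_left_inverse by blast
    have "inv A = B" using B(2) A(2) surj
      by (metis comp_assoc comp_id id_comp surj_iff)
    then have "bounded X" unfolding X_eq using B(1) by (simp add: bounded_linear_image bounded_box linear_conv_bounded_linear)
    have "open X" unfolding X_def
      using A(1) by (intro open_vimage linear_continuous_on) (auto simp: linear_conv_bounded_linear)
    have Xb: "X \<in> sets borel" using \<open>open X\<close> by simp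
    have Xl: "X \<in> lmeasurable" using \<open>bounded X\<close> \<open>open X\<close> by (rule lmeasurable_open)
    have "emeasure (density (distr lborel borel A) (\<lambda>_. ennreal ?k)) (box l u) = ennreal ?k * emeasure lborel X"
      using A_meas by (simp add: emeasure_density nn_integral_cmult emeasure_distr X_def)
    also have "\<dots> = ennreal ?k * emeasure lebesgue X"
      using Xb by (simp add: emeasure_completion)
    also have "\<dots> = ennreal (?k * measure lebesgue X)"
      using Xl by (simp add: emeasure_eq_measure2 ennreal_mult)
    also have "\<dots> = ennreal (measure lebesgue (box l u))"
      using measure_linear_image[OF A(1) Xl] by (simp add: AX)
    also have "\<dots> = (\<Prod>b\<in>Basis. (u - l) \<bullet> b)"
      using lu by (simp add: measure_completion)
    finally show "emeasure (density (distr lborel borel A) (\<lambda>_. ennreal ?k)) (box l u) = (\<Prod>b\<in>Basis. (u - l) \<bullet> b)" .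
  qed simp
qed

text \<open>The product is nested so that the first coordinate, the radius of a cone, is separated
  from the pair of transversal coordinates, which is scaled as one point of the plane.\<close>

definition coords :: "real \<times> (real \<times> real) \<Rightarrow> real^3" where
  "coords z = vector [fst z, fst (snd z), snd (snd z)]"

lemma coords_nth [simp]: "coords z $ 1 = fst z" "coords z $ 2 = fst (snd z)" "coords z $ 3 = snd (snd z)"
  by (simp_all add: coords_def)

lemma coords_measurable [measurable]: "coords \<in> borel_measurable borel"
proof -
  have "continuous_on UNIV coords"
  proof (subst continuous_on_componentwise, intro ballI)
    fix b :: "real^3" assume "b \<in> Basis"
    then obtain i where b: "b = axis i 1" by (auto simp: Basis_vec_def)
    have eq: "(\<lambda>z. coords z \<bullet> b) = (\<lambda>z. if i = 1 then fst z else if i = 2 then fst (snd z) else snd (snd z))"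
      using exhaust_3[of i] by (auto simp: b inner_axis)
    show "continuous_on UNIV (\<lambda>z. coords z \<bullet> b)"
      unfolding eq by (cases "i = 1"; cases "i = 2") (auto intro!: continuous_intros)
  qed
  then show ?thesis by (rule borel_measurable_continuous_onI)
qed

lemma lborel_coords: "lborel = distr (lborel \<Otimes>\<^sub>M (lborel \<Otimes>\<^sub>M lborel)) borel coords"
proof (rule lborel_eqI)
  fix l u :: "real^3" assume lu: "\<And>b. b \<in> Basis \<Longrightarrow> l \<bullet> b \<le> u \<bullet> b"
  have le: "l $ i \<le> u $ i" for i using lu[of "axis i 1"] by (simp add: inner_axis axis_in_Basis_iff)
  have pre: "coords -` box l u = {l$1<..<u$1} \<times> ({l$2<..<u$2} \<times> {l$3<..<u$3})"
    by (auto simp: mem_box_cart forall_3)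
  have "emeasure (distr (lborel \<Otimes>\<^sub>M (lborel \<Otimes>\<^sub>M lborel)) borel coords) (box l u)
    = emeasure (lborel \<Otimes>\<^sub>M (lborel \<Otimes>\<^sub>M lborel)) ({l$1<..<u$1} \<times> ({l$2<..<u$2} \<times> {l$3<..<u$3}))"
    using coords_measurable by (subst emeasure_distr) (auto simp: lborel_prod pre)
  also have "\<dots> = ennreal (u$1 - l$1) * (ennreal (u$2 - l$2) * ennreal (u$3 - l$3))"
  proof -
    have e2: "emeasure lborel ({l$2<..<u$2} \<times> {l$3<..<u$3}) = ennreal (u$2 - l$2) * ennreal (u$3 - l$3)"
      using le by (simp add: lborel_prod[symmetric] lborel.emeasure_pair_measure_Times)
    have m: "{l$2<..<u$2} \<times> {l$3<..<u$3} \<in> sets (borel :: (real \<times> real) measure)"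
      by (intro borel_open open_Times open_greaterThanLessThan)
    have m1: "{l$2<..<u$2} \<times> {l$3<..<u$3} \<in> sets lborel" using m unfolding sets_lborel .
    have m0: "{l$1<..<u$1} \<in> sets lborel" by simp
    have "emeasure (lborel \<Otimes>\<^sub>M lborel) ({l$1<..<u$1} \<times> ({l$2<..<u$2} \<times> {l$3<..<u$3}))
        = emeasure lborel {l$1<..<u$1} * emeasure lborel ({l$2<..<u$2} \<times> {l$3<..<u$3})"
      by (rule lborel.emeasure_pair_measure_Times[OF m0 m1])
    also have "emeasure lborel {l$1<..<u$1} = ennreal (u$1 - l$1)" using le by simp
    also note e2
    finally show ?thesis unfolding lborel_prod[where ?'a = real and ?'b = real] .
  qed
  also have "\<dots> = ennreal (\<Prod>i\<in>UNIV. u $ i - l $ i)"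
  proof -
    have "(\<Prod>i\<in>UNIV. u $ i - l $ i) = (u$1 - l$1) * ((u$2 - l$2) * (u$3 - l$3))"
      unfolding UNIV_3 by simp
    moreover have "0 \<le> u$1 - l$1" "0 \<le> u$2 - l$2" "0 \<le> u$3 - l$3" using le by simp_all
    ultimately show ?thesis by (simp only: ennreal_mult mult_nonneg_nonneg)
  qed
  also have "(\<Prod>i\<in>UNIV. u $ i - l $ i) = (\<Prod>b\<in>Basis. (u - l) \<bullet> b)"
  proof -
    have B: "(Basis :: (real^3) set) = (\<lambda>i. axis i 1) ` UNIV" by (auto simp: Basis_vec_def)
    have "inj (\<lambda>i. axis i 1 :: real^3)" by (auto simp: inj_on_def axis_eq_axis)
    then show ?thesis unfolding B by (subst prod.reindex) (auto simp: inner_axis)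
  qed
  finally show "emeasure (distr (lborel \<Otimes>\<^sub>M (lborel \<Otimes>\<^sub>M lborel)) borel coords) (box l u) = (\<Prod>b\<in>Basis. (u - l) \<bullet> b)" .
qed (simp add: lborel_prod)

section \<open>Parametrised triangles and cones\<close>

definition std_triangle :: "(real \<times> real) set" where
  "std_triangle = {(s, t). 0 \<le> s \<and> 0 \<le> t \<and> s + t \<le> 1}"

lemma closed_std_triangle: "closed std_triangle"
proof -
  have eq: "std_triangle = {z. 0 \<le> fst z} \<inter> {z. 0 \<le> snd z} \<inter> {z. fst z + snd z \<le> 1}"
    by (auto simp: std_triangle_def)
  show ?thesis unfolding eq by (intro closed_Int closed_Collect_le continuous_intros)
qed

lemma std_triangle_borel [measurable]: "std_triangle \<in> sets borel"
  using closed_std_triangle by simp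

lemma bounded_std_triangle: "bounded std_triangle"
proof -
  have "std_triangle \<subseteq> cbox (0, 0) (1, 1)" by (auto simp: std_triangle_def)
  then show ?thesis using bounded_cbox bounded_subset by blast
qed

definition affine_param :: "real^3 \<Rightarrow> real^3 \<Rightarrow> real^3 \<Rightarrow> real \<times> real \<Rightarrow> real^3" where
  "affine_param a b c w = a + fst w *\<^sub>R (b - a) + snd w *\<^sub>R (c - a)"

lemma affine_param_image: "affine_param a b c ` std_triangle = convex hull {a, b, c}"
proof (intro equalityI subsetI)
  fix x assume "x \<in> affine_param a b c ` std_triangle"
  then obtain s t where "0 \<le> s" "0 \<le> t" "s + t \<le> 1" "x = a + s *\<^sub>R (b - a) + t *\<^sub>R (c - a)"
    by (auto simp: affine_param_def std_triangle_def)
  then show "x \<in> convex hull {a, b, c}" unfolding convex_hull_3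
    by (intro CollectI exI[of _ "1 - s - t"] exI[of _ s] exI[of _ t]) (auto simp: algebra_simps)
next
  fix x assume "x \<in> convex hull {a, b, c}"
  then obtain u v w where "0 \<le> u" "0 \<le> v" "0 \<le> w" "u + v + w = 1" "x = u *\<^sub>R a + v *\<^sub>R b + w *\<^sub>R c"
    unfolding convex_hull_3 by blast
  moreover from this have "u = 1 - v - w" by simp
  ultimately show "x \<in> affine_param a b c ` std_triangle"
    by (intro image_eqI[of _ _ "(v, w)"]) (auto simp: affine_param_def std_triangle_def algebra_simps)
qed

lemma continuous_affine_param: "continuous_on UNIV (affine_param a b c)"
  unfolding affine_param_def by (intro continuous_intros)

lemma affine_param_measurable [measurable]: "affine_param a b c \<in> borel_measurable borel"
  by (intro borel_measurable_continuous_onI continuous_affine_param)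

lemma cone_in_hull_iff:
  assumes "G \<noteq> {}" "convex G"
  shows "x \<in> convex hull (insert P G) \<longleftrightarrow> (\<exists>v\<in>{0..1}. \<exists>y\<in>G. x = P + v *\<^sub>R (y - P))"
proof
  assume "x \<in> convex hull (insert P G)"
  then obtain u v b where "0 \<le> u" "0 \<le> v" "u + v = 1" "b \<in> G" "x = u *\<^sub>R P + v *\<^sub>R b"
    using assms by (auto simp: convex_hull_insert hull_same)
  moreover from this have "u = 1 - v" by simp
  ultimately show "\<exists>v\<in>{0..1}. \<exists>y\<in>G. x = P + v *\<^sub>R (y - P)"
    by (intro bexI[of _ v] bexI[of _ b]) (auto simp: algebra_simps)
next
  assume "\<exists>v\<in>{0..1}. \<exists>y\<in>G. x = P + v *\<^sub>R (y - P)"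
  then obtain v y where "v \<in> {0..1}" "y \<in> G" "x = P + v *\<^sub>R (y - P)" by blast
  then show "x \<in> convex hull (insert P G)"
    unfolding convex_hull_insert[OF assms(1)] hull_same[of convex G, OF assms(2)]
    by (intro CollectI exI[of _ "1 - v"] conjI exI[of _ v] exI[of _ y]) (auto simp: algebra_simps)
qed

definition cone_param :: "real^3 \<Rightarrow> real^3 \<Rightarrow> real^3 \<Rightarrow> real^3 \<Rightarrow> (real \<times> real) \<times> real \<Rightarrow> real^3" where
  "cone_param P a b c z = P + snd z *\<^sub>R (affine_param a b c (fst z) - P)"

lemma cone_param_measurable [measurable]:
  "cone_param P a b c \<in> borel_measurable (lborel \<Otimes>\<^sub>M lborel)"
  unfolding cone_param_def by measurable

text \<open>The linear map A sends (r, r w) to the point at radius r above the base point with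
  parameter w. Were A not onto, the cone would lie in a translate of a proper subspace and have
  empty interior.\<close>

lemma nondegenerate_cone:
  fixes P a b c :: "real^3"
  assumes A_def: "\<And>z. A z = z$1 *\<^sub>R (a - P) + z$2 *\<^sub>R (b - a) + z$3 *\<^sub>R (c - a)"
    and int: "interior (convex hull (insert P (convex hull {a, b, c}))) \<noteq> {}"
  shows "linear A" "inj A"
    and "\<And>w r. P + A (coords (r, (r *\<^sub>R w))) = cone_param P a b c (w, r)"
    and "\<And>w r. P + A (coords (r, w)) \<in> convex hull (insert P (convex hull {a, b, c})) \<longleftrightarrow>
      (\<exists>w'\<in>std_triangle. w = r *\<^sub>R w') \<and> 0 \<le> r \<and> r \<le> 1"
proof -
  show lin: "linear A" unfolding A_def by (intro linearI) (auto simp: algebra_simps)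
  let ?S = "convex hull (insert P (convex hull {a, b, c}))"
  have eq: "P + A (coords (r, r *\<^sub>R w)) = cone_param P a b c (w, r)" for w r
    by (simp add: A_def cone_param_def affine_param_def algebra_simps)
  then show "\<And>w r. P + A (coords (r, (r *\<^sub>R w))) = cone_param P a b c (w, r)" .
  have S_iff: "x \<in> ?S \<longleftrightarrow> (\<exists>v\<in>{0..1}. \<exists>w\<in>std_triangle. x = P + A (coords (v, v *\<^sub>R w)))" for x
  proof -
    have "x \<in> ?S \<longleftrightarrow> (\<exists>v\<in>{0..1}. \<exists>y\<in>convex hull {a, b, c}. x = P + v *\<^sub>R (y - P))"
      by (rule cone_in_hull_iff) auto
    then show ?thesis unfolding eq cone_param_def affine_param_image[symmetric] by simp
  qed
  have "surj A"
  proof (rule ccontr)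
    assume "\<not> surj A"
    have sub: "subspace (range A)" using lin by (simp add: linear_subspace_image)
    have "dim (range A) \<noteq> DIM(real^3)"
      using dim_eq_full[of "range A"] \<open>\<not> surj A\<close> sub by (simp add: span_eq_iff[THEN iffD2])
    moreover have "dim (range A) \<le> DIM(real^3)" by (rule dim_subset_UNIV)
    ultimately have "interior (range A) = {}" by (intro empty_interior_lowdim) simp
    then have "interior ((+) P ` range A) = {}" by (simp add: interior_translation)
    moreover have "?S \<subseteq> (+) P ` range A" using S_iff by auto
    ultimately show False using int interior_mono by blast
  qed
  then show inj: "inj A" using lin linear_surjective_imp_injective by blast
  fix w r
  show "P + A (coords (r, w)) \<in> ?S \<longleftrightarrow> (\<exists>w'\<in>std_triangle. w = r *\<^sub>R w') \<and> 0 \<le> r \<and> r \<le> 1"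
  proof -
    have "A (coords (r, w)) = A (coords (v, v *\<^sub>R w')) \<longleftrightarrow> r = v \<and> w = v *\<^sub>R w'" for v w'
      unfolding inj_eq[OF inj] by (auto simp: vec_eq_iff forall_3 prod_eq_iff)
    then show ?thesis unfolding S_iff by auto
  qed
qed

text \<open>Polar coordinates with apex \<open>P\<close>: no Jacobian determinant beyond the constant of the linear
  map \<open>A\<close> and the factor \<open>r\<^sup>2\<close> from scaling the two transversal coordinates is needed.\<close>

lemma cone_nn_integral:
  fixes P a b c :: "real^3"
  assumes int: "interior (convex hull (insert P (convex hull {a, b, c}))) \<noteq> {}"
  obtains \<kappa> where "\<kappa> > 0"
    "density lborel (\<lambda>x. ennreal (indicator (convex hull (insert P (convex hull {a, b, c}))) x)) =
     distr (density (lborel \<Otimes>\<^sub>M lborel)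
       (\<lambda>z. ennreal (\<kappa> * (snd z)\<^sup>2 * indicator std_triangle (fst z) * indicator {0..1} (snd z))))
       borel (cone_param P a b c)"
proof -
  define S where "S = convex hull (insert P (convex hull {a, b, c}))"
  define A where "A z = z$1 *\<^sub>R (a - P) + z$2 *\<^sub>R (b - a) + z$3 *\<^sub>R (c - a)" for z :: "real^3"
  note nd = nondegenerate_cone[OF A_def int, folded S_def]
  have [measurable]: "A \<in> borel_measurable borel"
    using nd(1) by (intro borel_measurable_continuous_onI linear_continuous_on) (simp add: linear_conv_bounded_linear)
  have "compact S" unfolding S_def
    by (intro compact_convex_hull compact_insert) (simp add: compact_convex_hull finite_imp_compact)
  then have [measurable]: "S \<in> sets borel" by (simp add: borel_compact)
  obtain \<kappa> where \<kappa>: "\<kappa> > 0" "lborel = density (distr lborel borel A) (\<lambda>_. ennreal \<kappa>)"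
    using lborel_linear_image[OF nd(1,2)] .
  show ?thesis
  proof (rule that[OF \<kappa>(1)], fold S_def, rule measure_eqI)
    show "sets (density lborel (\<lambda>x. ennreal (indicator S x)))
      = sets (distr (density (lborel \<Otimes>\<^sub>M lborel)
       (\<lambda>z. ennreal (\<kappa> * (snd z)\<^sup>2 * indicator std_triangle (fst z) * indicator {0..1} (snd z))))
       borel (cone_param P a b c))" by simp
    fix X assume "X \<in> sets (density lborel (\<lambda>x. ennreal (indicator S x)))"
    then have [measurable]: "X \<in> sets borel" by simp
    define F where "F x = (indicator S x * indicator X x :: ennreal)" for x
    have [measurable]: "F \<in> borel_measurable borel" unfolding F_def by measurable
    have "emeasure (density lborel (\<lambda>x. ennreal (indicator S x))) X = (\<integral>\<^sup>+x. F x \<partial>lborel)"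
      by (simp add: emeasure_density F_def ennreal_indicator)
    also have "\<dots> = (\<integral>\<^sup>+x. F (P + x) \<partial>lborel)"
      using nn_integral_lborel_affine[of F 1 P] by simp
    also have "\<dots> = \<kappa> * (\<integral>\<^sup>+z. F (P + A z) \<partial>lborel)"
      by (subst \<kappa>(2)) (simp add: nn_integral_density nn_integral_distr nn_integral_cmult)
    also have "(\<integral>\<^sup>+z. F (P + A z) \<partial>lborel) = (\<integral>\<^sup>+z. F (P + A (coords z)) \<partial>(lborel \<Otimes>\<^sub>M (lborel \<Otimes>\<^sub>M lborel)))"
      by (subst lborel_coords) (simp add: nn_integral_distr lborel_prod)
    also have "\<dots> = (\<integral>\<^sup>+r. \<integral>\<^sup>+w. F (P + A (coords (r, w))) \<partial>lborel \<partial>lborel)"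
    proof -
      have "(\<lambda>z. F (P + A (coords z))) \<in> borel_measurable borel" by measurable
      then have "(\<lambda>z. F (P + A (coords z))) \<in> borel_measurable (lborel \<Otimes>\<^sub>M lborel)" by (simp add: lborel_prod)
      from lborel.nn_integral_fst[OF this] show ?thesis
        unfolding lborel_prod[where ?'a = real and ?'b = real] by simp
    qed
    also have "\<dots> = (\<integral>\<^sup>+r. \<integral>\<^sup>+w. ennreal (r\<^sup>2 * indicator std_triangle w * indicator {0..1} r)
        * indicator X (cone_param P a b c (w, r)) \<partial>lborel \<partial>lborel)"
    proof (rule nn_integral_cong_AE)
      \<comment> \<open>The slice r = 0 is set aside because the substitution
        \<open>r *\<^sub>R w\<close> for the transversal coordinates degenerates there.\<close>
      have "AE r in lborel. r \<noteq> (0::real)" by (rule AE_lborel_singleton)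
      then show "AE r in lborel. (\<integral>\<^sup>+w. F (P + A (coords (r, w))) \<partial>lborel) =
        (\<integral>\<^sup>+w. ennreal (r\<^sup>2 * indicator std_triangle w * indicator {0..1} r)
        * indicator X (cone_param P a b c (w, r)) \<partial>lborel)"
      proof eventually_elim
        case (elim r)
        show ?case
        proof (cases "r \<in> {0..1}")
          case False
          then have "F (P + A (coords (r, w))) = 0" for w using nd(4)[of r w] by (auto simp: F_def indicator_def)
          then show ?thesis using False by simp
        next
          case True
          have iff: "(\<exists>w'\<in>std_triangle. r *\<^sub>R w = r *\<^sub>R w') \<longleftrightarrow> w \<in> std_triangle" for w using elim by auto
          have "(\<integral>\<^sup>+w. F (P + A (coords (r, w))) \<partial>lborel)
            = ennreal (\<bar>r\<bar> ^ DIM(real \<times> real)) * (\<integral>\<^sup>+w. F (P + A (coords (r, 0 + r *\<^sub>R w))) \<partial>lborel)"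
            by (subst lborel_affine[OF elim, of 0]) (simp add: nn_integral_density nn_integral_distr nn_integral_cmult)
          also have "\<dots> = ennreal (r\<^sup>2) * (\<integral>\<^sup>+w. indicator std_triangle w * indicator X (cone_param P a b c (w, r)) \<partial>lborel)"
          proof -
            have "F (P + A (coords (r, r *\<^sub>R w))) = indicator std_triangle w * indicator X (cone_param P a b c (w, r))" for w
              using nd(4)[of r "r *\<^sub>R w"] iff[of w] True
              by (cases "w \<in> std_triangle") (auto simp: F_def nd(3))
            then show ?thesis by (simp add: power2_eq_square)
          qed
          also have "\<dots> = (\<integral>\<^sup>+w. ennreal (r\<^sup>2) * (indicator std_triangle w * indicator X (cone_param P a b c (w, r))) \<partial>lborel)"
            by (intro nn_integral_cmult[symmetric]) measurable
          also have "\<dots> = (\<integral>\<^sup>+w. ennreal (r\<^sup>2 * indicator std_triangle w * indicator {0..1} r)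
              * indicator X (cone_param P a b c (w, r)) \<partial>lborel)"
            using True by (intro nn_integral_cong) (auto simp: indicator_def)
          finally show ?thesis .
        qed
      qed
    qed
    also have "\<dots> = (\<integral>\<^sup>+w. \<integral>\<^sup>+r. ennreal (r\<^sup>2 * indicator std_triangle w * indicator {0..1} r)
        * indicator X (cone_param P a b c (w, r)) \<partial>lborel \<partial>lborel)"
      by (intro pair_sigma_finite.Fubini'[OF pair_sigma_finite_lborel]) measurable
    also have "\<dots> = (\<integral>\<^sup>+z. ennreal ((snd z)\<^sup>2 * indicator std_triangle (fst z) * indicator {0..1} (snd z))
        * indicator X (cone_param P a b c z) \<partial>(lborel \<Otimes>\<^sub>M lborel))"
      by (subst lborel.nn_integral_fst[symmetric]) simp_all
    also have "\<kappa> * \<dots> = (\<integral>\<^sup>+z. \<kappa> * (ennreal ((snd z)\<^sup>2 * indicator std_triangle (fst z) * indicator {0..1} (snd z))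
        * indicator X (cone_param P a b c z)) \<partial>(lborel \<Otimes>\<^sub>M lborel))"
      by (intro nn_integral_cmult[symmetric]) measurable
    also have "\<dots> = (\<integral>\<^sup>+z. ennreal (\<kappa> * (snd z)\<^sup>2 * indicator std_triangle (fst z) * indicator {0..1} (snd z))
        * indicator X (cone_param P a b c z) \<partial>(lborel \<Otimes>\<^sub>M lborel))"
      using \<kappa>(1) by (intro nn_integral_cong) (simp add: ennreal_mult mult_ac indicator_def)
    also have "\<dots> = emeasure (distr (density (lborel \<Otimes>\<^sub>M lborel)
       (\<lambda>z. ennreal (\<kappa> * (snd z)\<^sup>2 * indicator std_triangle (fst z) * indicator {0..1} (snd z))))
       borel (cone_param P a b c)) X"
    proof -
      let ?N = "density (lborel \<Otimes>\<^sub>M lborel)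
       (\<lambda>z. ennreal (\<kappa> * (snd z)\<^sup>2 * indicator std_triangle (fst z) * indicator {0..1} (snd z)))"
      have "emeasure (distr ?N borel (cone_param P a b c)) X
        = (\<integral>\<^sup>+x. indicator X x \<partial>distr ?N borel (cone_param P a b c))"
        by (rule nn_integral_indicator[symmetric]) simp
      also have "\<dots> = (\<integral>\<^sup>+z. indicator X (cone_param P a b c z) \<partial>?N)"
        by (rule nn_integral_distr) measurable
      also have "\<dots> = (\<integral>\<^sup>+z. ennreal (\<kappa> * (snd z)\<^sup>2 * indicator std_triangle (fst z) * indicator {0..1} (snd z))
        * indicator X (cone_param P a b c z) \<partial>(lborel \<Otimes>\<^sub>M lborel))"
        by (rule nn_integral_density) measurable
      finally show ?thesis by (rule sym)
    qed
    finally show "emeasure (density lborel (\<lambda>x. ennreal (indicator S x))) X = emeasure (distr (density (lborel \<Otimes>\<^sub>M lborel)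
       (\<lambda>z. ennreal (\<kappa> * (snd z)\<^sup>2 * indicator std_triangle (fst z) * indicator {0..1} (snd z))))
       borel (cone_param P a b c)) X" .
  qed
qed

text \<open>The field \<open>g(y) (x - P)\<close>, with \<open>y\<close> the central projection of \<open>x\<close> from the vertex \<open>P\<close> onto the
  opposite face, is tangential to the other faces, and its divergence is \<open>3 g(y)\<close>.\<close>

lemma cone_green:
  fixes P a b c :: "real^3" and g :: "real^3 \<Rightarrow> real"
  defines "S \<equiv> convex hull (insert P (convex hull {a, b, c}))"
  assumes int: "interior S \<noteq> {}" and g[measurable]: "g \<in> borel_measurable borel" and g_bd: "\<And>x. \<bar>g x\<bar> \<le> Cg"
  obtains V D C where "V \<in> borel_measurable borel" "D \<in> borel_measurable borel"
    "\<And>x. x \<in> interior S \<Longrightarrow> norm (V x) \<le> C" "\<And>x. x \<in> interior S \<Longrightarrow> \<bar>D x\<bar> \<le> C"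
    "\<And>\<phi>. smooth_on UNIV \<phi> \<Longrightarrow>
      (LINT x|lebesgue_on (interior S). V x \<bullet> gradient \<phi> x) + (LINT x|lebesgue_on (interior S). D x * \<phi> x)
      = norm (cross3 (b - a) (c - a)) * (LINT p|lebesgue_on std_triangle. g (affine_param a b c p) * \<phi> (affine_param a b c p))"
proof -
  define K where "K = interior S"
  define A where "A z = z$1 *\<^sub>R (a - P) + z$2 *\<^sub>R (b - a) + z$3 *\<^sub>R (c - a)" for z :: "real^3"
  note nd = nondegenerate_cone[OF A_def int[unfolded S_def], folded S_def]
  obtain B where B: "linear B" "B \<circ> A = id" using nd(1,2) linear_injective_left_inverse by blast
  have BA: "B (A z) = z" for z using B(2) by (metis comp_apply id_apply)
  have [measurable]: "B \<in> borel_measurable borel"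
    using B(1) by (intro borel_measurable_continuous_onI linear_continuous_on) (simp add: linear_conv_bounded_linear)
  \<comment> \<open>In the coordinates of A the radius is a linear function of x, so the central
    projection is recovered by a single division. At radius 0 division by zero gives the default
    value P.\<close>
  define \<rho> where "\<rho> x = B (x - P) $ 1" for x
  have [measurable]: "(\<lambda>v::real^3. v $ 1) \<in> borel_measurable borel"
    by (intro borel_measurable_continuous_onI continuous_intros)
  have [measurable]: "\<rho> \<in> borel_measurable borel" unfolding \<rho>_def by measurable
  define y where "y x = P + (1 / \<rho> x) *\<^sub>R (x - P)" for x
  have [measurable]: "y \<in> borel_measurable borel" unfolding y_def by measurable
  have \<rho>_cone: "\<rho> (cone_param P a b c (w, r)) = r" for w r
    unfolding nd(3)[symmetric] by (simp add: \<rho>_def BA)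
  have y_cone: "y (cone_param P a b c (w, r)) = affine_param a b c w" if "r \<noteq> 0" for w r
    using that unfolding y_def \<rho>_cone by (simp add: cone_param_def)
  obtain \<kappa> where \<kappa>: "\<kappa> > 0" "density lborel (\<lambda>x. ennreal (indicator S x)) =
     distr (density (lborel \<Otimes>\<^sub>M lborel)
       (\<lambda>z. ennreal (\<kappa> * (snd z)\<^sup>2 * indicator std_triangle (fst z) * indicator {0..1} (snd z))))
       borel (cone_param P a b c)"
    using cone_nn_integral[OF int[unfolded S_def], folded S_def] .
  \<comment> \<open>The Jacobian constant \<kappa> of the cone coordinates is divided out and
    replaced by the area factor of the parametrised base.\<close>
  define \<beta> where "\<beta> = norm (cross3 (b - a) (c - a)) / \<kappa>"
  define V where "V x = (\<beta> * g (y x)) *\<^sub>R (x - P)" for x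
  define D where "D x = 3 * \<beta> * g (y x)" for x
  have V_meas [measurable]: "V \<in> borel_measurable borel" unfolding V_def by measurable
  have D_meas [measurable]: "D \<in> borel_measurable borel" unfolding D_def by measurable
  have S_compact: "compact S" unfolding S_def
    by (intro compact_convex_hull compact_insert) (simp add: compact_convex_hull finite_imp_compact)
  have S_convex: "convex S" by (simp add: S_def)
  have [measurable]: "S \<in> sets borel" using S_compact by (simp add: borel_compact)
  have K: "bounded K" "open K" "K \<in> sets borel" using S_compact interior_subset[of S] unfolding K_def
    by (auto intro: bounded_subset[OF compact_imp_bounded])
  obtain R where R: "\<And>x. x \<in> K \<Longrightarrow> norm (x - P) \<le> R"
    using bounded_translation_minus[OF K(1), of P] by (auto simp: bounded_iff)
  define C where "C = \<bar>\<beta>\<bar> * Cg * \<bar>R\<bar> + 3 * \<bar>\<beta>\<bar> * Cg"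
  have Cg: "Cg \<ge> 0" using g_bd[of 0] by linarith
  have bg: "\<bar>\<beta> * g x\<bar> \<le> \<bar>\<beta>\<bar> * Cg" for x using g_bd[of x] by (simp add: abs_mult mult_left_mono)
  have V_bd: "norm (V x) \<le> C" if "x \<in> K" for x
  proof -
    have "norm (V x) \<le> (\<bar>\<beta>\<bar> * Cg) * \<bar>R\<bar>"
      unfolding V_def norm_scaleR using R[OF that] Cg by (intro mult_mono bg) auto
    also have "\<dots> \<le> C" using Cg by (simp add: C_def)
    finally show ?thesis .
  qed
  have D_bd: "\<bar>D x\<bar> \<le> C" for x
  proof -
    have "\<bar>D x\<bar> = 3 * \<bar>\<beta> * g (y x)\<bar>" by (simp add: D_def abs_mult)
    also have "\<dots> \<le> 3 * (\<bar>\<beta>\<bar> * Cg)" by (intro mult_left_mono bg) simp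
    also have "\<dots> \<le> C" using Cg by (simp add: C_def)
    finally show ?thesis .
  qed
  \<comment> \<open>The cone formula lives on the closed cone, the function spaces on its interior;
    the frontier of a convex set is null.\<close>
  have AE_SK: "AE x in lborel. indicator K x = (indicator S x :: real)"
  proof -
    have "negligible (frontier S)" by (rule negligible_convex_frontier[OF S_convex])
    then have "frontier S \<in> null_sets lborel"
      by (auto simp: negligible_iff_null_sets null_sets_completion_iff)
    then have "AE x in lborel. x \<notin> frontier S" by (rule AE_not_in)
    then show ?thesis
    proof eventually_elim
      case (elim x)
      then show ?case using interior_subset[of S] S_compact
        by (auto simp: K_def indicator_def frontier_def closure_closed compact_imp_closed)
    qed
  qed
  show ?thesis
  proof (rule that[OF V_meas D_meas], fold K_def)
    show "norm (V x) \<le> C" if "x \<in> K" for x by (rule V_bd[OF that])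
    show "\<bar>D x\<bar> \<le> C" if "x \<in> K" for x by (rule D_bd)
    fix \<phi> assume \<phi>: "smooth_on UNIV \<phi>"
    have \<phi>_cont: "continuous_on UNIV \<phi>" and G_cont: "continuous_on UNIV (gradient \<phi>)"
      using \<phi> by (simp_all add: smooth_continuous smooth_gradient_continuous)
    have [measurable]: "\<phi> \<in> borel_measurable borel" "gradient \<phi> \<in> borel_measurable borel"
      using \<phi>_cont G_cont by (auto intro: borel_measurable_continuous_onI)
    define h where "h x = V x \<bullet> gradient \<phi> x + D x * \<phi> x" for x
    have h_meas [measurable]: "h \<in> borel_measurable borel" unfolding h_def by measurable
    have int1: "integrable (lebesgue_on K) (\<lambda>x. V x \<bullet> gradient \<phi> x)"
      using K V_bd by (intro L2_on_inner_integrable L2_on_continuous G_cont L2_on_bounded[where C = C]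
          borel_measurable_lebesgue_onI V_meas)
    have int2: "integrable (lebesgue_on K) (\<lambda>x. D x * \<phi> x)"
      using L2_on_inner_integrable[OF L2_on_bounded[OF K(1,2) borel_measurable_lebesgue_onI[OF D_meas]]
        L2_on_continuous[OF K(1,2) \<phi>_cont], of C] D_bd by simp
    have inth: "integrable (lebesgue_on K) h" unfolding h_def using int1 int2 by simp
    have inth': "integrable lborel (\<lambda>x. indicator S x *\<^sub>R h x)"
    proof -
      have "integrable lborel (\<lambda>x. indicator K x *\<^sub>R h x)"
        using inth lebesgue_on_lborel(2)[OF K(3) h_meas] by simp
      moreover have "AE x in lborel. indicator K x *\<^sub>R h x = indicator S x *\<^sub>R h x"
        using AE_SK by eventually_elim simp
      ultimately show ?thesis
        using K(3) by (subst integrable_cong_AE[symmetric, of "\<lambda>x. indicator K x *\<^sub>R h x"]) auto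
    qed
    define k where "k z = \<kappa> * (snd z)\<^sup>2 * indicator std_triangle (fst z) * indicator {0..1} (snd z)"
      for z :: "(real \<times> real) \<times> real"
    have k_meas [measurable]: "k \<in> borel_measurable (lborel \<Otimes>\<^sub>M lborel)" unfolding k_def by measurable
    have k_nn: "0 \<le> k z" for z using \<kappa>(1) by (simp add: k_def)
    have hc_meas [measurable]: "(\<lambda>z. h (cone_param P a b c z)) \<in> borel_measurable (lborel \<Otimes>\<^sub>M lborel)" by measurable
    have "(LINT x|lebesgue_on K. V x \<bullet> gradient \<phi> x) + (LINT x|lebesgue_on K. D x * \<phi> x) = (LINT x|lebesgue_on K. h x)"
      using int1 int2 by (simp add: h_def)
    also have "\<dots> = (LINT x|lborel. indicator K x *\<^sub>R h x)" by (rule lebesgue_on_lborel(1)[OF K(3) h_meas])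
    also have "\<dots> = (LINT x|lborel. indicator S x *\<^sub>R h x)"
      using K(3) AE_SK by (intro integral_cong_AE) auto
    also have "\<dots> = (LINT x|density lborel (\<lambda>x. ennreal (indicator S x)). h x)"
      by (subst integral_density) auto
    also have "\<dots> = (LINT z|density (lborel \<Otimes>\<^sub>M lborel) (\<lambda>z. ennreal (k z)). h (cone_param P a b c z))"
      unfolding \<kappa>(2) k_def[symmetric] by (rule integral_distr) auto
    also have "\<dots> = (LINT z|(lborel \<Otimes>\<^sub>M lborel). k z *\<^sub>R h (cone_param P a b c z))"
      by (rule integral_density) (auto simp: k_nn)
    also have "\<dots> = (LINT w|lborel. LINT r|lborel. k (w, r) *\<^sub>R h (cone_param P a b c (w, r)))"
    proof (rule pair_sigma_finite.integral_fst'[OF pair_sigma_finite_lborel, symmetric])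
      have "integrable (density lborel (\<lambda>x. ennreal (indicator S x))) h"
        using inth' by (subst integrable_density) auto
      then have "integrable (density (lborel \<Otimes>\<^sub>M lborel) (\<lambda>z. ennreal (k z))) (\<lambda>z. h (cone_param P a b c z))"
        unfolding \<kappa>(2) k_def[symmetric] by (subst (asm) integrable_distr_eq) auto
      then show "integrable (lborel \<Otimes>\<^sub>M lborel) (\<lambda>z. k z *\<^sub>R h (cone_param P a b c z))"
        by (subst (asm) integrable_density) (auto simp: k_nn)
    qed
    also have "\<dots> = (LINT w|lborel. indicator std_triangle w *\<^sub>R
        (norm (cross3 (b - a) (c - a)) * (g (affine_param a b c w) * \<phi> (affine_param a b c w))))"
    proof (rule Bochner_Integration.integral_cong[OF refl])
      fix w :: "real \<times> real"
      define Y where "Y = affine_param a b c w"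
      define \<psi> where "\<psi> r = \<phi> (P + r *\<^sub>R (Y - P))" for r
      define \<psi>' where "\<psi>' r = gradient \<phi> (P + r *\<^sub>R (Y - P)) \<bullet> (Y - P)" for r
      have der: "(\<psi> has_real_derivative \<psi>' r) (at r)" for r
        unfolding \<psi>_def \<psi>'_def by (rule has_real_derivative_line[OF \<phi>])
      have G_cont': "continuous_on UNIV (\<lambda>r. gradient \<phi> (P + r *\<^sub>R (Y - P)))"
        by (rule continuous_on_compose2[OF G_cont]) (auto intro!: continuous_intros)
      have cont': "continuous_on UNIV \<psi>'" unfolding \<psi>'_def by (intro continuous_intros G_cont')
      have cont: "continuous_on UNIV \<psi>" using der[THEN DERIV_isCont] by (simp add: continuous_on_eq_continuous_at)
      \<comment> \<open>The volume element r^2 times the radial integrand r \<psi>' + 3 \<psi> is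
        the derivative of r^3 \<psi>. The integral over a ray is therefore the value at r = 1, on
        the base, and the apex contributes nothing.\<close>
      define f where "f r = 3 * r\<^sup>2 * \<psi> r + r ^ 3 * \<psi>' r" for r
      have f_cont: "isCont f r" for r
      proof -
        have "continuous_on UNIV f" unfolding f_def by (intro continuous_intros cont cont')
        then show ?thesis by (simp add: continuous_on_eq_continuous_at)
      qed
      have der3: "((\<lambda>r. r ^ 3 * \<psi> r) has_real_derivative f r) (at r)" for r
        unfolding f_def by (auto intro!: derivative_eq_intros der)
      have FTC: "(LINT r|lborel. f r * indicator {0..1} r) = \<phi> Y"
        using integral_FTC_Icc_real[of 0 1, OF _ der3 f_cont] by (simp add: \<psi>_def)
      have [measurable]: "\<psi> \<in> borel_measurable borel" "\<psi>' \<in> borel_measurable borel" "f \<in> borel_measurable borel"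
        using cont cont' f_cont by (auto intro!: borel_measurable_continuous_onI simp: continuous_on_eq_continuous_at)
      have "(LINT r|lborel. k (w, r) *\<^sub>R h (cone_param P a b c (w, r)))
        = (LINT r|lborel. (\<kappa> * \<beta> * indicator std_triangle w * g Y) * (f r * indicator {0..1} r))"
      proof (rule integral_cong_AE)
        have "AE r in lborel. r \<noteq> (0::real)" by (rule AE_lborel_singleton)
        then show "AE r in lborel. k (w, r) *\<^sub>R h (cone_param P a b c (w, r))
          = (\<kappa> * \<beta> * indicator std_triangle w * g Y) * (f r * indicator {0..1} r)"
        proof eventually_elim
          case (elim r)
          have "cone_param P a b c (w, r) = P + r *\<^sub>R (Y - P)" by (simp add: cone_param_def Y_def)
          moreover from this have "y (P + r *\<^sub>R (Y - P)) = Y" using y_cone[OF elim, of w] by (simp add: Y_def)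
          ultimately have "h (cone_param P a b c (w, r)) = \<beta> * g Y * (r * \<psi>' r + 3 * \<psi> r)"
            by (simp add: h_def V_def D_def \<psi>_def \<psi>'_def distrib_left inner_commute[of "Y - P"] mult_ac)
          then show ?case by (simp add: k_def f_def algebra_simps power2_eq_square power3_eq_cube)
        qed
        show "(\<lambda>r. k (w, r) *\<^sub>R h (cone_param P a b c (w, r))) \<in> borel_measurable lborel"
          unfolding k_def cone_param_def fst_conv snd_conv by measurable
      qed measurable
      also have "\<dots> = (\<kappa> * \<beta> * indicator std_triangle w * g Y) * \<phi> Y" using FTC by simp
      also have "\<dots> = indicator std_triangle w *\<^sub>R (norm (cross3 (b - a) (c - a)) * (g Y * \<phi> Y))"
        using \<kappa>(1) by (simp add: \<beta>_def)
      finally show "(LINT r|lborel. k (w, r) *\<^sub>R h (cone_param P a b c (w, r))) =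
        indicator std_triangle w *\<^sub>R (norm (cross3 (b - a) (c - a)) * (g (affine_param a b c w) * \<phi> (affine_param a b c w)))"
        by (simp add: Y_def)
    qed
    also have "\<dots> = (LINT w|lebesgue_on std_triangle. norm (cross3 (b - a) (c - a)) * (g (affine_param a b c w) * \<phi> (affine_param a b c w)))"
      by (rule lebesgue_on_lborel(1)[symmetric]) measurable
    also have "\<dots> = norm (cross3 (b - a) (c - a)) * (LINT w|lebesgue_on std_triangle. g (affine_param a b c w) * \<phi> (affine_param a b c w))"
      by simp
    finally show "(LINT x|lebesgue_on K. V x \<bullet> gradient \<phi> x) + (LINT x|lebesgue_on K. D x * \<phi> x) = \<dots>" .
  qed
qed

section \<open>Lifting boundary data into the tetrahedron\<close>

lemma triangle_integral_param:
  assumes "G = convex hull {a0, b0, c0}"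
  obtains a b c where "G = convex hull {a, b, c}"
    "\<And>f. triangle_integral G f = norm (cross3 (b - a) (c - a)) * (LINT p|lebesgue_on std_triangle. f (affine_param a b c p))"
proof -
  \<comment> \<open>The labelling picked by \<open>SOME\<close> is known only to span G. The same
    labelling is kept throughout, so independence of the choice does not arise.\<close>
  obtain a b c where abc: "(SOME (a, b, c). G = convex hull {a, b, c}) = (a, b, c)" by (metis prod.exhaust)
  have "case (SOME (a, b, c). G = convex hull {a, b, c}) of (a, b, c) \<Rightarrow> G = convex hull {a, b, c}"
    by (rule someI[where x = "(a0, b0, c0)"]) (simp add: assms)
  then have "G = convex hull {a, b, c}" by (simp add: abc)
  moreover have "triangle_integral G f = norm (cross3 (b - a) (c - a)) * (LINT p|lebesgue_on std_triangle. f (affine_param a b c p))" for f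
    by (simp add: triangle_integral_def abc std_triangle_def affine_param_def)
  ultimately show ?thesis by (rule that)
qed

text \<open>A facet is the hull of all vertices but one, and the closed tetrahedron is the cone over
  the facet with the omitted vertex P as apex; this is the shape that \<open>cone_green\<close> asks
  for.\<close>

lemma open_tetrahedron_props:
  assumes "open_tetrahedron K"
  shows "open K" "bounded K" "convex K" "K \<noteq> {}" "compact (closure K)" "interior (closure K) = K"
    "polytope (closure K)" "finite {G. G facet_of closure K}"
    "\<And>G. G facet_of closure K \<Longrightarrow>
      \<exists>P a b c. G = convex hull {a, b, c} \<and> \<not> affine_dependent {a, b, c} \<and> card {a, b, c} = 3 \<and>
        closure K = convex hull (insert P G)"
proof -
  obtain S where S: "3 simplex S" "K = interior S" using assms by (auto simp: open_tetrahedron_def)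
  obtain C where C: "\<not> affine_dependent C" "int (card C) = 3 + 1" "S = convex hull C"
    using S(1) by (auto simp: simplex_def)
  have card: "card C = 4" and fin: "finite C" using C by (auto intro: aff_independent_finite)
  have ne: "interior S \<noteq> {}" using C card fin interior_convex_hull_eq_empty[of C] by simp
  have conv: "convex S" and comp: "compact S" using C fin by (auto simp: compact_convex_hull finite_imp_compact)
  have cl: "closure K = S"
    using convex_closure_interior[OF conv ne] comp by (simp add: S(2) compact_imp_closed)
  show "open K" "bounded K" "convex K" "K \<noteq> {}" "compact (closure K)" "interior (closure K) = K"
    using ne conv comp cl S(2) bounded_subset[OF compact_imp_bounded[OF comp] interior_subset]
    by (auto simp: convex_interior)
  show "polytope (closure K)" using cl C(3) fin by (auto simp: polytope_def)
  then show "finite {G. G facet_of closure K}" by (rule finite_polytope_facets)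
  fix G assume "G facet_of closure K"
  then obtain u where u: "u \<in> C" "G = convex hull (C - {u})"
    using facet_of_convex_hull_affine_independent[OF C(1)] cl C(3) by auto
  have "card (C - {u}) = 3" using u card fin by simp
  then obtain a b c where abc: "C - {u} = {a, b, c}" by (metis card_3_iff)
  have "closure K = convex hull (insert u (C - {u}))" using cl C(3) u(1) by (simp add: insert_absorb)
  then have "closure K = convex hull (insert u G)" using hull_insert[of convex u "C - {u}"] u(2) by simp
  moreover have "\<not> affine_dependent {a, b, c}" using C(1) abc affine_dependent_subset[of "{a,b,c}" C] by blast
  ultimately show "\<exists>P a b c. G = convex hull {a, b, c} \<and> \<not> affine_dependent {a, b, c} \<and> card {a, b, c} = 3 \<and>
        closure K = convex hull (insert P G)"
    using u abc \<open>card (C - {u}) = 3\<close> by metis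
qed

text \<open>For each facet the whole of K is the cone over it, and the corresponding cone field has
  flux only through that facet. The fluxes of the fields of all facets therefore add up without
  interference.\<close>

lemma boundary_lifting:
  assumes K: "open_tetrahedron K" and g: "g \<in> borel_measurable borel" "\<And>x. \<bar>g x\<bar> \<le> Cg"
  obtains V D C where "V \<in> borel_measurable borel" "D \<in> borel_measurable borel"
    "\<And>x. x \<in> K \<Longrightarrow> norm (V x) \<le> C" "\<And>x. x \<in> K \<Longrightarrow> \<bar>D x\<bar> \<le> C"
    "\<And>\<phi>. smooth_on UNIV \<phi> \<Longrightarrow>
      (LINT x|lebesgue_on K. V x \<bullet> gradient \<phi> x) + (LINT x|lebesgue_on K. D x * \<phi> x)
      = boundary_integral K (\<lambda>x. g x * \<phi> x)"
proof -
  note Kp = open_tetrahedron_props[OF K]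
  define I where "I = {G. G facet_of closure K}"
  have fin: "finite I" using Kp(8) by (simp add: I_def)
  define Q where "Q G V D C \<longleftrightarrow> V \<in> borel_measurable borel \<and> D \<in> borel_measurable borel \<and>
    (\<forall>x\<in>K. norm (V x) \<le> C) \<and> (\<forall>x\<in>K. \<bar>D x\<bar> \<le> C) \<and>
    (\<forall>\<phi>. smooth_on UNIV \<phi> \<longrightarrow>
      (LINT x|lebesgue_on K. V x \<bullet> gradient \<phi> x) + (LINT x|lebesgue_on K. D x * \<phi> x)
      = triangle_integral G (\<lambda>x. g x * \<phi> x))" for G V D C
  have "\<exists>V D C. Q G V D C" if "G \<in> I" for G
  proof -
    have "G facet_of closure K" using that by (simp add: I_def)
    then obtain P a0 b0 c0 where G: "G = convex hull {a0, b0, c0}" "closure K = convex hull (insert P G)"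
      using Kp(9) by blast
    obtain a b c where abc: "G = convex hull {a, b, c}"
      "\<And>f. triangle_integral G f = norm (cross3 (b - a) (c - a)) * (LINT p|lebesgue_on std_triangle. f (affine_param a b c p))"
      by (rule triangle_integral_param[OF G(1)]) (rule that)
    have S: "convex hull (insert P (convex hull {a, b, c})) = closure K" using G(2) abc(1) by simp
    have "interior (convex hull (insert P (convex hull {a, b, c}))) \<noteq> {}" unfolding S Kp(6) by (rule Kp(4))
    from cone_green[OF this g(1) g(2), unfolded S Kp(6)] obtain V D C where "V \<in> borel_measurable borel" "D \<in> borel_measurable borel"
      "\<And>x. x \<in> K \<Longrightarrow> norm (V x) \<le> C" "\<And>x. x \<in> K \<Longrightarrow> \<bar>D x\<bar> \<le> C"
      "\<And>\<phi>. smooth_on UNIV \<phi> \<Longrightarrow>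
      (LINT x|lebesgue_on K. V x \<bullet> gradient \<phi> x) + (LINT x|lebesgue_on K. D x * \<phi> x)
      = norm (cross3 (b - a) (c - a)) * (LINT p|lebesgue_on std_triangle. g (affine_param a b c p) * \<phi> (affine_param a b c p))"
      by blast
    then show ?thesis unfolding Q_def abc(2) by blast
  qed
  then obtain V D C where Q: "\<And>G. G \<in> I \<Longrightarrow> Q G (V G) (D G) (C G)" by metis
  have VDC: "\<And>G. G \<in> I \<Longrightarrow> V G \<in> borel_measurable borel" "\<And>G. G \<in> I \<Longrightarrow> D G \<in> borel_measurable borel"
    "\<And>G x. G \<in> I \<Longrightarrow> x \<in> K \<Longrightarrow> norm (V G x) \<le> C G" "\<And>G x. G \<in> I \<Longrightarrow> x \<in> K \<Longrightarrow> \<bar>D G x\<bar> \<le> C G"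
    "\<And>G \<phi>. G \<in> I \<Longrightarrow> smooth_on UNIV \<phi> \<Longrightarrow>
      (LINT x|lebesgue_on K. V G x \<bullet> gradient \<phi> x) + (LINT x|lebesgue_on K. D G x * \<phi> x)
      = triangle_integral G (\<lambda>x. g x * \<phi> x)"
    using Q unfolding Q_def by blast+
  show ?thesis
  proof (rule that[of "\<lambda>x. \<Sum>G\<in>I. V G x" "\<lambda>x. \<Sum>G\<in>I. D G x" "\<Sum>G\<in>I. C G"])
    show "(\<lambda>x. \<Sum>G\<in>I. V G x) \<in> borel_measurable borel" "(\<lambda>x. \<Sum>G\<in>I. D G x) \<in> borel_measurable borel"
      using VDC by (auto intro!: borel_measurable_sum)
    show "norm (\<Sum>G\<in>I. V G x) \<le> (\<Sum>G\<in>I. C G)" if "x \<in> K" for x using VDC that by (intro sum_norm_le) auto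
    show "\<bar>\<Sum>G\<in>I. D G x\<bar> \<le> (\<Sum>G\<in>I. C G)" if "x \<in> K" for x
      using VDC that by (intro order_trans[OF sum_abs] sum_mono) auto
    fix \<phi> assume \<phi>: "smooth_on UNIV \<phi>"
    have int1: "integrable (lebesgue_on K) (\<lambda>x. V G x \<bullet> gradient \<phi> x)" if "G \<in> I" for G
      using L2_on_inner_integrable[OF L2_on_bounded[OF Kp(2,1) borel_measurable_lebesgue_onI[OF VDC(1)[OF that]] VDC(3)[OF that]]
        L2_on_continuous[OF Kp(2,1) smooth_gradient_continuous[OF \<phi>]]] .
    have int2: "integrable (lebesgue_on K) (\<lambda>x. D G x * \<phi> x)" if "G \<in> I" for G
      using L2_on_inner_integrable[OF L2_on_bounded[OF Kp(2,1) borel_measurable_lebesgue_onI[OF VDC(2)[OF that]]]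
        L2_on_continuous[OF Kp(2,1) smooth_continuous[OF \<phi>]], of "C G"] VDC(4)[OF that] by simp
    have "(LINT x|lebesgue_on K. (\<Sum>G\<in>I. V G x) \<bullet> gradient \<phi> x) + (LINT x|lebesgue_on K. (\<Sum>G\<in>I. D G x) * \<phi> x)
      = (\<Sum>G\<in>I. (LINT x|lebesgue_on K. V G x \<bullet> gradient \<phi> x) + (LINT x|lebesgue_on K. D G x * \<phi> x))"
      using int1 int2 by (simp add: inner_sum_left sum_distrib_right Bochner_Integration.integral_sum sum.distrib)
    also have "\<dots> = boundary_integral K (\<lambda>x. g x * \<phi> x)"
      using VDC(5) \<phi> by (simp add: boundary_integral_def I_def)
    finally show "(LINT x|lebesgue_on K. (\<Sum>G\<in>I. V G x) \<bullet> gradient \<phi> x) + (LINT x|lebesgue_on K. (\<Sum>G\<in>I. D G x) * \<phi> x)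
      = boundary_integral K (\<lambda>x. g x * \<phi> x)" .
  qed
qed

section \<open>Curl-free fields\<close>

lemma continuous_kernel_measurable:
  fixes k :: "real^3 \<Rightarrow> real^3 \<Rightarrow> real"
  assumes "continuous_on UNIV (\<lambda>z. k (fst z) (snd z))"
  shows "(\<lambda>z. k (fst z) (snd z)) \<in> borel_measurable (lebesgue_on K \<Otimes>\<^sub>M lebesgue_on L)"
proof -
  have "(\<lambda>z. (fst z, snd z)) \<in> measurable (lebesgue_on K \<Otimes>\<^sub>M lebesgue_on L) (borel \<Otimes>\<^sub>M borel)"
    by (intro measurable_Pair measurable_compose[OF measurable_fst id_measurable_lebesgue_on]
        measurable_compose[OF measurable_snd id_measurable_lebesgue_on])
  then have "(\<lambda>z. z) \<in> measurable (lebesgue_on K \<Otimes>\<^sub>M lebesgue_on L) borel" by (simp add: borel_prod)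
  from measurable_compose[OF this borel_measurable_continuous_onI[OF assms]] show ?thesis by simp
qed

lemma continuous_kernel_slice:
  assumes "continuous_on UNIV (\<lambda>z. k (fst z) (snd z))"
  shows "continuous_on UNIV (k x)"
  using continuous_on_compose2[OF assms, where f = "\<lambda>y. (x, y)" and s = UNIV] by (simp add: continuous_on_Pair)

text \<open>Schur's test. Splitting k into two square roots, Cauchy-Schwarz in y uses the row
  integrals 1, and after exchanging the integrals the column bound 8 becomes the bound on the
  squared operator norm.\<close>

lemma kernel_operator_L2:
  fixes k :: "real^3 \<Rightarrow> real^3 \<Rightarrow> real" and u :: "real^3 \<Rightarrow> real"
  assumes K: "bounded K" "open K"
    and k: "continuous_on UNIV (\<lambda>z. k (fst z) (snd z))" "\<And>x y. 0 \<le> k x y"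
    and k1: "\<And>x. x \<in> K \<Longrightarrow> (\<integral>\<^sup>+y. ennreal (k x y) \<partial>lebesgue_on K) = 1"
    and k2: "\<And>y. y \<in> K \<Longrightarrow> (\<integral>\<^sup>+x. ennreal (k x y) \<partial>lebesgue_on K) \<le> 8"
    and u: "L2_on K u"
  shows "\<And>x. integrable (lebesgue_on K) (\<lambda>y. u y * k x y)"
    and "L2_on K (\<lambda>x. LINT y|lebesgue_on K. u y * k x y)"
    and "(LINT x|lebesgue_on K. (LINT y|lebesgue_on K. u y * k x y)\<^sup>2) \<le> 8 * (LINT x|lebesgue_on K. (u x)\<^sup>2)"
proof -
  define M where "M = lebesgue_on K"
  interpret finite_measure M unfolding M_def using K by (intro finite_measure_lebesgue_on) auto
  have sf: "sigma_finite_measure M" by (rule sigma_finite_measure_axioms)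
  have space: "space M = K" by (simp add: M_def)
  have u_meas [measurable]: "u \<in> borel_measurable M" using u by (simp add: L2_on_def M_def)
  have k_meas [measurable]: "(\<lambda>z. k (fst z) (snd z)) \<in> borel_measurable (M \<Otimes>\<^sub>M M)"
    unfolding M_def by (rule continuous_kernel_measurable[OF k(1)])
  have kx_meas [measurable]: "k x \<in> borel_measurable M" for x
    unfolding M_def by (intro borel_measurable_lebesgue_onI borel_measurable_continuous_onI continuous_kernel_slice[OF k(1)])
  show int: "integrable (lebesgue_on K) (\<lambda>y. u y * k x y)" for x
    using L2_on_inner_integrable[OF u L2_on_continuous[OF K continuous_kernel_slice[OF k(1)]]] by simp
  define U where "U x = (LINT y|M. u y * k x y)" for x
  have U_meas [measurable]: "U \<in> borel_measurable M"
  proof -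
    have "(\<lambda>z. u (snd z) * k (fst z) (snd z)) \<in> borel_measurable (M \<Otimes>\<^sub>M M)" by measurable
    then have "case_prod (\<lambda>x y. u y * k x y) \<in> borel_measurable (M \<Otimes>\<^sub>M M)" by (simp add: case_prod_beta')
    then show ?thesis unfolding U_def by (rule borel_measurable_lebesgue_integral)
  qed
  have usq: "(\<integral>\<^sup>+y. ennreal ((u y)\<^sup>2) \<partial>M) = ennreal (LINT y|M. (u y)\<^sup>2)"
    using u by (intro nn_integral_eq_integral) (auto simp: L2_on_def M_def)
  have pt: "ennreal ((U x)\<^sup>2) \<le> (\<integral>\<^sup>+y. ennreal ((u y)\<^sup>2 * k x y) \<partial>M)" if x: "x \<in> K" for x
  proof -
    have "ennreal (norm (U x)) \<le> (\<integral>\<^sup>+y. ennreal (norm (u y * k x y)) \<partial>M)"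
      unfolding U_def by (rule integral_norm_bound_ennreal) (use int in \<open>simp add: M_def\<close>)
    also have "\<dots> = (\<integral>\<^sup>+y. ennreal (\<bar>u y\<bar> * sqrt (k x y)) * ennreal (sqrt (k x y)) \<partial>M)"
      using k(2) by (intro nn_integral_cong) (simp add: ennreal_mult[symmetric] abs_mult mult.assoc)
    finally have "(ennreal (norm (U x)))\<^sup>2 \<le> (\<integral>\<^sup>+y. ennreal (\<bar>u y\<bar> * sqrt (k x y)) * ennreal (sqrt (k x y)) \<partial>M)\<^sup>2"
      by (intro power_mono) auto
    also have "\<dots> \<le> (\<integral>\<^sup>+y. (ennreal (\<bar>u y\<bar> * sqrt (k x y)))\<^sup>2 \<partial>M) * (\<integral>\<^sup>+y. (ennreal (sqrt (k x y)))\<^sup>2 \<partial>M)"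
      by (rule Cauchy_Schwarz_nn_integral) measurable
    also have "(\<integral>\<^sup>+y. (ennreal (\<bar>u y\<bar> * sqrt (k x y)))\<^sup>2 \<partial>M) = (\<integral>\<^sup>+y. ennreal ((u y)\<^sup>2 * k x y) \<partial>M)"
      using k(2) by (intro nn_integral_cong) (simp add: ennreal_power power_mult_distrib)
    also have "(\<integral>\<^sup>+y. (ennreal (sqrt (k x y)))\<^sup>2 \<partial>M) = (\<integral>\<^sup>+y. ennreal (k x y) \<partial>M)"
      using k(2) by (intro nn_integral_cong) (simp add: ennreal_power)
    also have "\<dots> = 1" unfolding M_def by (rule k1[OF x])
    finally show ?thesis by (simp add: ennreal_power)
  qed
  have "(\<integral>\<^sup>+x. ennreal ((U x)\<^sup>2) \<partial>M) \<le> (\<integral>\<^sup>+x. \<integral>\<^sup>+y. ennreal ((u y)\<^sup>2 * k x y) \<partial>M \<partial>M)"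
    using pt space by (intro nn_integral_mono) auto
  also have "\<dots> = (\<integral>\<^sup>+y. \<integral>\<^sup>+x. ennreal ((u y)\<^sup>2 * k x y) \<partial>M \<partial>M)"
  proof (rule pair_sigma_finite.Fubini'[symmetric])
    show "pair_sigma_finite M M" by (intro pair_sigma_finite.intro sf)
    have "(\<lambda>z. ennreal ((u (snd z))\<^sup>2 * k (fst z) (snd z))) \<in> borel_measurable (M \<Otimes>\<^sub>M M)" by measurable
    then show "case_prod (\<lambda>x y. ennreal ((u y)\<^sup>2 * k x y)) \<in> borel_measurable (M \<Otimes>\<^sub>M M)"
      by (simp add: case_prod_beta')
  qed
  also have "\<dots> \<le> (\<integral>\<^sup>+y. 8 * ennreal ((u y)\<^sup>2) \<partial>M)"
  proof (rule nn_integral_mono)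
    fix y assume "y \<in> space M"
    then have y: "y \<in> K" by (simp add: space)
    have ky: "(\<lambda>x. k x y) \<in> borel_measurable M"
      unfolding M_def
      by (intro borel_measurable_lebesgue_onI borel_measurable_continuous_onI)
         (use continuous_on_compose2[OF k(1), where f = "\<lambda>x. (x, y)" and s = UNIV] in \<open>simp add: continuous_on_Pair\<close>)
    have "(\<integral>\<^sup>+x. ennreal ((u y)\<^sup>2 * k x y) \<partial>M) = ennreal ((u y)\<^sup>2) * (\<integral>\<^sup>+x. ennreal (k x y) \<partial>M)"
      using k(2) ky by (simp add: ennreal_mult nn_integral_cmult)
    also have "\<dots> \<le> ennreal ((u y)\<^sup>2) * 8" unfolding M_def by (intro mult_left_mono k2 y) auto
    finally show "(\<integral>\<^sup>+x. ennreal ((u y)\<^sup>2 * k x y) \<partial>M) \<le> 8 * ennreal ((u y)\<^sup>2)" by (simp add: mult.commute)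
  qed
  also have "\<dots> = ennreal (8 * (LINT y|M. (u y)\<^sup>2))"
    by (simp add: nn_integral_cmult usq ennreal_mult)
  finally have le: "(\<integral>\<^sup>+x. ennreal ((U x)\<^sup>2) \<partial>M) \<le> ennreal (8 * (LINT y|M. (u y)\<^sup>2))" .
  have intU: "integrable M (\<lambda>x. (U x)\<^sup>2)"
    using le by (intro integrableI_bounded) (auto simp: le_less_trans)
  have "ennreal (LINT x|M. (U x)\<^sup>2) \<le> ennreal (8 * (LINT y|M. (u y)\<^sup>2))"
    using le nn_integral_eq_integral[OF intU] by simp
  then have "(LINT x|M. (U x)\<^sup>2) \<le> 8 * (LINT y|M. (u y)\<^sup>2)" by (subst (asm) ennreal_le_iff) auto
  then show "(LINT x|lebesgue_on K. (LINT y|lebesgue_on K. u y * k x y)\<^sup>2) \<le> 8 * (LINT x|lebesgue_on K. (u x)\<^sup>2)"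
    by (simp add: U_def M_def)
  have "L2_on K U" using intU U_meas by (simp add: L2_on_def M_def)
  then show "L2_on K (\<lambda>x. LINT y|lebesgue_on K. u y * k x y)" by (simp add: U_def[abs_def] M_def)
qed

text \<open>Only weak convergence is claimed, against one fixed a. A test function p close to u is
  moved uniformly little, because the kernels concentrate near the diagonal and p is uniformly
  continuous; the remainder u - p is controlled by the uniform operator bound.\<close>

lemma kernel_approximation:
  fixes k :: "nat \<Rightarrow> real^3 \<Rightarrow> real^3 \<Rightarrow> real" and a u :: "real^3 \<Rightarrow> real"
  assumes K: "bounded K" "open K"
    and k: "\<And>n. continuous_on UNIV (\<lambda>z. k n (fst z) (snd z))" "\<And>n x y. 0 \<le> k n x y"
    and k1: "\<And>n x. x \<in> K \<Longrightarrow> (\<integral>\<^sup>+y. ennreal (k n x y) \<partial>lebesgue_on K) = 1"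
    and k2: "\<And>n y. y \<in> K \<Longrightarrow> (\<integral>\<^sup>+x. ennreal (k n x y) \<partial>lebesgue_on K) \<le> 8"
    and r: "\<And>n x y. x \<in> K \<Longrightarrow> k n x y \<noteq> 0 \<Longrightarrow> dist y x \<le> r n" "r \<longlonglongrightarrow> 0"
    and a: "L2_on K a" and u: "L2_on K u"
  shows "(\<lambda>n. LINT x|lebesgue_on K. a x * (LINT y|lebesgue_on K. u y * k n x y)) \<longlonglongrightarrow> (LINT x|lebesgue_on K. a x * u x)"
proof (rule LIMSEQ_I)
  fix e :: real assume e: "e > 0"
  define M where "M = lebesgue_on K"
  have kop: "integrable M (\<lambda>y. f y * k n x y)" "L2_on K (\<lambda>x. LINT y|M. f y * k n x y)"
    "(LINT x|M. (LINT y|M. f y * k n x y)\<^sup>2) \<le> 8 * (LINT x|M. (f x)\<^sup>2)" if f: "L2_on K f" for f n x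
    unfolding M_def by (rule kernel_operator_L2[OF K k(1) k(2) _ _ f]; rule k1 k2; assumption)+
  define T where "T n f x = (LINT y|M. f y * k n x y)" for n x and f :: "real^3 \<Rightarrow> real"
  have int2: "integrable M (\<lambda>x. f x * g x)" if "L2_on K f" "L2_on K g" for f g :: "real^3 \<Rightarrow> real"
    using L2_on_inner_integrable[OF that] by (simp add: M_def)
  have CS: "\<bar>LINT x|M. f x * g x\<bar> \<le> sqrt (LINT x|M. (f x)\<^sup>2) * sqrt (LINT x|M. (g x)\<^sup>2)"
    if "L2_on K f" "L2_on K g" for f g :: "real^3 \<Rightarrow> real"
    using L2_Cauchy_Schwarz[OF that] by (simp add: M_def real_sqrt_mult[symmetric] real_le_rsqrt)
  have TL2: "L2_on K (T n f)" if "L2_on K f" for n f using kop(2)[OF that, of n] by (simp add: T_def[abs_def])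
  define A where "A = sqrt (LINT x|M. (a x)\<^sup>2)"
  have A: "A \<ge> 0" by (simp add: A_def)
  obtain \<phi> where \<phi>: "\<And>n. test_function K (\<phi> n)" "(\<lambda>n. LINT x|lebesgue_on K. (\<phi> n x - u x)\<^sup>2) \<longlonglongrightarrow> 0"
    by (rule test_functions_dense_L2[OF K u]) (rule that)
  \<comment> \<open>The remainder u - p enters once directly and once through the operator, whose
    norm, at most the square root of 8, is rounded up to 3. Together they cost 4 A e1 <= e/2; the 1
    guards against A = 0.\<close>
  define e1 where "e1 = e / (8 * (A + 1))"
  have e1: "e1 > 0" using e A by (simp add: e1_def)
  obtain m where m: "(LINT x|M. (\<phi> m x - u x)\<^sup>2) < e1\<^sup>2"
    using order_tendstoD(2)[OF \<phi>(2), of "e1\<^sup>2"] e1 by (auto simp: eventually_sequentially M_def)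
  define p where "p = \<phi> m"
  have p: "test_function K p" "continuous_on UNIV p"
    using \<phi>(1) by (auto simp: p_def intro: smooth_continuous test_function_smooth)
  have pL: "L2_on K p" by (rule L2_on_continuous[OF K p(2)])
  define d where "d x = u x - p x" for x
  have dL: "L2_on K d" unfolding d_def by (rule L2_on_diff[OF u pL])
  have d_small: "sqrt (LINT x|M. (d x)\<^sup>2) \<le> e1"
  proof -
    have "(LINT x|M. (d x)\<^sup>2) \<le> e1\<^sup>2" using m by (simp add: d_def p_def power2_commute)
    then show ?thesis using e1 by (intro real_le_lsqrt) auto
  qed
  have Td_small: "sqrt (LINT x|M. (T n d x)\<^sup>2) \<le> 3 * e1" for n
  proof -
    have "(LINT x|M. (T n d x)\<^sup>2) \<le> 8 * (LINT x|M. (d x)\<^sup>2)" using kop(3)[OF dL, of n] by (simp add: T_def)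
    also have "\<dots> \<le> 9 * e1\<^sup>2"
    proof -
      have "(LINT x|M. (d x)\<^sup>2) \<le> e1\<^sup>2" using m by (simp add: d_def p_def power2_commute)
      moreover have "0 \<le> e1\<^sup>2" by simp
      ultimately show ?thesis by linarith
    qed
    also have "\<dots> = (3 * e1)\<^sup>2" by (simp add: power_mult_distrib)
    finally show ?thesis using e1 by (intro real_le_lsqrt) auto
  qed
  define I where "I = (LINT x|M. \<bar>a x\<bar>)"
  have I: "I \<ge> 0" by (simp add: I_def)
  have aint: "integrable M (\<lambda>x. \<bar>a x\<bar>)"
    using int2[OF a L2_on_continuous[OF K continuous_on_const], of 1] by simp
  \<comment> \<open>The uniform error on p costs at most I e2 <= e/4, which leaves the total
    strictly below e.\<close>
  define e2 where "e2 = e / (4 * (I + 1))"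
  have e2: "e2 > 0" using e I by (simp add: e2_def)
  have "compact (closure K)" using K(1) by (simp add: compact_closure)
  then have "uniformly_continuous_on (closure K) p"
    using p(2) by (intro compact_uniformly_continuous) (auto intro: continuous_on_subset)
  then obtain s where s: "s > 0" "\<And>x y. x \<in> closure K \<Longrightarrow> y \<in> closure K \<Longrightarrow> dist y x < s \<Longrightarrow> dist (p y) (p x) < e2"
    unfolding uniformly_continuous_on_def using e2 by metis
  obtain N where N: "\<And>n. n \<ge> N \<Longrightarrow> r n < s"
    using order_tendstoD(2)[OF r(2) s(1)] by (auto simp: eventually_sequentially)
  have Tp: "\<bar>T n p x - p x\<bar> \<le> e2" if n: "n \<ge> N" and x: "x \<in> K" for n x
  proof -
    have kint: "integrable M (k n x)"
      using kop(1)[where f = "\<lambda>_. 1" and n = n and x = x, OF L2_on_continuous[OF K continuous_on_const]] by simp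
    have k_one: "(LINT y|M. k n x y) = 1"
    proof -
      have "ennreal (LINT y|M. k n x y) = 1"
        using nn_integral_eq_integral[OF kint] k(2) k1[OF x, of n] by (simp add: M_def)
      then show ?thesis by (metis ennreal_eq_1)
    qed
    have "T n p x - p x = (LINT y|M. p y * k n x y) - p x * (LINT y|M. k n x y)" by (simp add: k_one T_def)
    also have "\<dots> = (LINT y|M. (p y - p x) * k n x y)"
      using kop(1)[OF pL, of n x] kint by (simp add: left_diff_distrib)
    also have "\<bar>\<dots>\<bar> \<le> (LINT y|M. e2 * k n x y)"
    proof (rule order_trans[OF integral_abs_bound], rule integral_mono)
      show "integrable M (\<lambda>y. \<bar>(p y - p x) * k n x y\<bar>)"
        using kop(1)[OF pL, of n x] kint by (simp add: left_diff_distrib)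
      show "integrable M (\<lambda>y. e2 * k n x y)" using kint by simp
      fix y assume "y \<in> space M"
      then have y: "y \<in> K" by (simp add: M_def)
      show "\<bar>(p y - p x) * k n x y\<bar> \<le> e2 * k n x y"
      proof (cases "k n x y = 0")
        case False
        have "dist y x < s" using r(1)[OF x False] N[OF n] by simp
        then have "\<bar>p y - p x\<bar> \<le> e2" using s(2)[of x y] x y closure_subset by (force simp: dist_real_def)
        then show ?thesis using k(2)[of n x y] by (simp add: abs_mult mult_right_mono)
      qed simp
    qed
    also have "\<dots> = e2" by (simp add: k_one)
    finally show ?thesis .
  qed
  have "\<bar>(LINT x|M. a x * T n u x) - (LINT x|M. a x * u x)\<bar> < e" if n: "n \<ge> N" for n
  proof -
    have Tu: "T n u x = T n d x + T n p x" for x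
      using kop(1)[OF dL, of n x] kop(1)[OF pL, of n x]
      by (simp add: T_def d_def left_diff_distrib flip: Bochner_Integration.integral_add)
    have "(LINT x|M. a x * T n u x) - (LINT x|M. a x * u x)
      = (LINT x|M. a x * T n d x) + (LINT x|M. a x * (T n p x - p x)) - (LINT x|M. a x * d x)"
      using int2[OF a TL2[OF dL]] int2[OF a TL2[OF pL]] int2[OF a pL] int2[OF a u]
      by (simp add: Tu d_def distrib_left right_diff_distrib)
    moreover have "\<bar>LINT x|M. a x * T n d x\<bar> \<le> A * (3 * e1)"
      by (rule order_trans[OF CS[OF a TL2[OF dL]]], fold A_def) (intro mult_left_mono Td_small A)
    moreover have "\<bar>LINT x|M. a x * d x\<bar> \<le> A * e1"
      by (rule order_trans[OF CS[OF a dL]], fold A_def) (intro mult_left_mono d_small A)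
    moreover have "\<bar>LINT x|M. a x * (T n p x - p x)\<bar> \<le> I * e2"
    proof -
      have "\<bar>LINT x|M. a x * (T n p x - p x)\<bar> \<le> (LINT x|M. \<bar>a x\<bar> * e2)"
      proof (rule order_trans[OF integral_abs_bound], rule integral_mono)
        show "integrable M (\<lambda>x. \<bar>a x * (T n p x - p x)\<bar>)"
          using int2[OF a L2_on_diff[OF TL2[OF pL] pL]] by simp
        show "integrable M (\<lambda>x. \<bar>a x\<bar> * e2)" using aint by simp
        show "\<bar>a x * (T n p x - p x)\<bar> \<le> \<bar>a x\<bar> * e2" if "x \<in> space M" for x
          using Tp[OF n, of x] that by (simp add: M_def abs_mult mult_left_mono)
      qed
      then show ?thesis by (simp add: I_def)
    qed
    moreover have "A * (3 * e1) + A * e1 \<le> e / 2"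
    proof -
      have "(A + 1) * e1 = e / 8" using A by (simp add: e1_def divide_simps algebra_simps)
      moreover have "A * e1 \<le> (A + 1) * e1" using e1 by (intro mult_right_mono) auto
      ultimately show ?thesis by simp
    qed
    moreover have "I * e2 \<le> e / 4"
    proof -
      have "(I + 1) * e2 = e / 4" using I by (simp add: e2_def divide_simps algebra_simps)
      moreover have "I * e2 \<le> (I + 1) * e2" using e2 by (intro mult_right_mono) auto
      ultimately show ?thesis by simp
    qed
    ultimately show ?thesis using e by linarith
  qed
  then show "\<exists>no. \<forall>n\<ge>no. norm ((LINT x|lebesgue_on K. a x * (LINT y|lebesgue_on K. u y * k n x y)) - (LINT x|lebesgue_on K. a x * u x)) < e"
    by (auto simp: T_def M_def)
qed

text \<open>Every ray from \<open>p - \<nabla>f(p)\<close> meets the surface at most once near \<open>p\<close>.\<close>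

lemma C2_surface_negligible:
  assumes "C2_surface \<Gamma>"
  shows "negligible \<Gamma>"
proof (rule locally_negligible_alt[THEN iffD2], rule ballI)
  fix p assume p: "p \<in> \<Gamma>"
  then have "\<exists>U f. open U \<and> p \<in> U \<and> Ck_on 2 U f \<and> (\<forall>x\<in>U. gradient f x \<noteq> 0) \<and> \<Gamma> \<inter> U = {x\<in>U. f x = 0}"
    using assms unfolding C2_surface_def by (elim ballE) auto
  then obtain U f where Uf0: "open U \<and> p \<in> U \<and> Ck_on 2 U f \<and> (\<forall>x\<in>U. gradient f x \<noteq> 0) \<and> \<Gamma> \<inter> U = {x\<in>U. f x = 0}"
    by (elim exE)
  note Uf = Uf0[THEN conjunct1] Uf0[THEN conjunct2, THEN conjunct1] Uf0[THEN conjunct2, THEN conjunct2, THEN conjunct1]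
    Uf0[THEN conjunct2, THEN conjunct2, THEN conjunct2, THEN conjunct2]
  have grad_nz: "gradient f p \<noteq> 0" using Uf0 by simp
  have diff: "f differentiable (at x)" if "x \<in> U" for x
    using Uf(3) that by (simp add: numeral_2_eq_2)
  have grad_cont: "continuous_on U (gradient f)"
  proof -
    have "continuous_on U (partial i f)" for i
      using Uf(3) by (intro Ck_on_continuous[of "Suc 0"]) (simp add: numeral_2_eq_2)
    then show ?thesis unfolding gradient_def by (intro continuous_on_vec_lambda)
  qed
  define q where "q = gradient f p"
  have q: "norm q > 0" using grad_nz by (simp add: q_def)
  obtain e1 where e1: "e1 > 0" "cball p e1 \<subseteq> U" using Uf(1,2) open_contains_cball by blast
  obtain e2 where e2: "e2 > 0" "\<And>y. y \<in> U \<Longrightarrow> dist y p < e2 \<Longrightarrow> dist (gradient f y) q < norm q / 4"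
    using grad_cont Uf(2) q unfolding continuous_on_iff q_def
    by (metis divide_pos_pos zero_less_numeral)
  \<comment> \<open>Halving e2 makes the gradient estimate strict on the closed ball, and the bound
    by a quarter of |q| keeps the ball away from the centre p - q of the rays.\<close>
  define e where "e = min (min e1 (e2 / 2)) (norm q / 4)"
  have e: "e > 0" "e \<le> e1" "e < e2" "e \<le> norm q / 4" using e1 e2 q by (auto simp: e_def)
  have cU: "cball p e \<subseteq> U" using e e1 by auto
  define T where "T = {x \<in> cball p e. f x = 0}"
  have "continuous_on (cball p e) f"
    using diff cU by (intro differentiable_at_imp_continuous_on) auto
  then have "closed T" unfolding T_def by (rule continuous_closed_preimage_constant) simp
  have pos: "gradient f y \<bullet> x > 0" if y: "y \<in> cball p e" and x: "(p - q) + x \<in> cball p e" for x y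
  proof -
    define s where "s = (p - q) + x"
    have sp: "norm (s - p) \<le> norm q / 4" using x e(4) by (simp add: s_def dist_norm norm_minus_commute)
    have d: "norm (gradient f y - q) \<le> norm q / 4"
      using e2(2)[of y] y cU e by (auto simp: dist_norm norm_minus_commute)
    \<comment> \<open>Here x = q + (s - p) and the gradient is q plus an error. The three error
      terms are at most 1/4, 1/4 and 1/16 of |q|^2, so the main term |q|^2 dominates.\<close>
    have "gradient f y \<bullet> x = q \<bullet> q + (gradient f y - q) \<bullet> q + q \<bullet> (s - p) + (gradient f y - q) \<bullet> (s - p)"
      by (simp add: s_def inner_diff_left inner_diff_right inner_add_left inner_add_right)
    moreover have "\<bar>(gradient f y - q) \<bullet> q\<bar> \<le> norm q / 4 * norm q"
      by (rule order_trans[OF Cauchy_Schwarz_ineq2 mult_right_mono[OF d]]) simp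
    moreover have "\<bar>q \<bullet> (s - p)\<bar> \<le> norm q * (norm q / 4)"
      by (rule order_trans[OF Cauchy_Schwarz_ineq2 mult_left_mono[OF sp]]) simp
    moreover have "\<bar>(gradient f y - q) \<bullet> (s - p)\<bar> \<le> norm q / 4 * (norm q / 4)"
      by (rule order_trans[OF Cauchy_Schwarz_ineq2 mult_mono[OF d sp]]) auto
    moreover have "q \<bullet> q = norm q * norm q" by (simp add: dot_square_norm power2_eq_square)
    moreover have "norm q * norm q > 0" using q by simp
    ultimately show ?thesis by linarith
  qed
  have no: False
    if lu: "l < u" and T: "(p - q) + l *\<^sub>R x \<in> T" "(p - q) + u *\<^sub>R x \<in> T" and x: "(p - q) + x \<in> T" for l u x
  proof -
    \<comment> \<open>Convexity of the ball keeps the whole piece of the ray between two zeros where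
      the radial derivative of f is positive; the mean value theorem then gives the
      contradiction.\<close>
    have mem: "(p - q) + t *\<^sub>R x \<in> cball p e" if "l \<le> t" "t \<le> u" for t
    proof -
      define v where "v = (t - l) / (u - l)"
      have v: "0 \<le> v" "v \<le> 1" using that lu by (auto simp: v_def divide_simps)
      have vt: "t = l + v * (u - l)" using lu by (simp add: v_def)
      have "(1 - v) *\<^sub>R ((p - q) + l *\<^sub>R x) + v *\<^sub>R ((p - q) + u *\<^sub>R x) \<in> cball p e"
        using T v by (intro convexD_alt[OF convex_cball]) (auto simp: T_def)
      also have "(1 - v) *\<^sub>R ((p - q) + l *\<^sub>R x) + v *\<^sub>R ((p - q) + u *\<^sub>R x) = (p - q) + t *\<^sub>R x"
        unfolding vt by (simp add: algebra_simps)
      finally show ?thesis .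
    qed
    have "((\<lambda>t. f ((p - q) + t *\<^sub>R x)) has_real_derivative gradient f ((p - q) + t *\<^sub>R x) \<bullet> x) (at t)"
      if "l \<le> t" "t \<le> u" for t
    proof -
      have "((\<lambda>t. f ((p - q) + t *\<^sub>R x)) has_derivative (\<lambda>h. gradient f ((p - q) + t *\<^sub>R x) \<bullet> (h *\<^sub>R x))) (at t)"
        using has_derivative_compose[OF has_derivative_add[OF has_derivative_const
              has_derivative_scaleR_left[OF has_derivative_ident]]
            has_derivative_gradient[OF diff]] mem[OF that] cU by auto
      then show ?thesis by (simp add: has_field_derivative_def mult_commute_abs)
    qed
    from MVT2[OF lu this] obtain z where z: "l < z" "z < u"
      "f ((p - q) + u *\<^sub>R x) - f ((p - q) + l *\<^sub>R x) = (u - l) * (gradient f ((p - q) + z *\<^sub>R x) \<bullet> x)"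
      by auto
    have "gradient f ((p - q) + z *\<^sub>R x) \<bullet> x > 0"
      using z x by (intro pos mem) (auto simp: T_def)
    with z(3) T lu show False by (auto simp: T_def)
  qed
  have "negligible T"
  proof (rule starlike_negligible[OF \<open>closed T\<close>])
    fix c x assume cx: "(p - q) + c *\<^sub>R x \<in> T" "0 \<le> c" "(p - q) + x \<in> T"
    show "c = 1"
      using no[of c 1 x] no[of 1 c x] cx by (cases c "1::real" rule: linorder_cases) auto
  qed
  have sub: "\<Gamma> \<inter> ball p e \<subseteq> T"
  proof
    fix x assume x: "x \<in> \<Gamma> \<inter> ball p e"
    then have "x \<in> \<Gamma> \<inter> U" using cU ball_subset_cball[of p e] by blast
    then have "f x = 0" unfolding Uf(4) by simp
    with x show "x \<in> T" by (simp add: T_def)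
  qed
  show "\<exists>V. openin (top_of_set \<Gamma>) V \<and> p \<in> V \<and> negligible V"
    using p e(1) negligible_subset[OF \<open>negligible T\<close> sub]
    by (intro exI[of _ "\<Gamma> \<inter> ball p e"]) (auto simp: openin_open_Int)
qed

section \<open>Weakly symmetric Jacobians and the Poincare lemma\<close>

lemma weak_curl_zero_symmetric:
  assumes w: "has_weak_curl K w (\<lambda>_. 0)" and K: "bounded K" "open K" and \<psi>: "test_function K \<psi>"
  shows "(LINT x|lebesgue_on K. w x $ i * partial j \<psi> x) = (LINT x|lebesgue_on K. w x $ j * partial i \<psi> x)"
proof -
  have wL: "L2_on K w" using w by (simp add: has_weak_curl_def)
  have int: "integrable (lebesgue_on K) (\<lambda>x. w x $ i * partial j \<psi> x)" for i j
  proof -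
    have cont: "continuous_on UNIV (\<lambda>x. partial j \<psi> x *\<^sub>R (axis i 1 :: real^3))"
      by (intro continuous_intros smooth_continuous smooth_partial test_function_smooth[OF \<psi>])
    from L2_on_inner_integrable[OF wL L2_on_continuous[OF K this]]
    show ?thesis by (simp add: inner_axis mult.commute)
  qed
  \<comment> \<open>A test field with a single nonzero component has a curl of two terms, so each
    unit direction isolates one pair of partial derivatives.\<close>
  define \<Psi> where "\<Psi> m x = (\<chi> i. if i = m then \<psi> x else 0)" for m :: 3 and x
  have test: "test_field K (\<Psi> m)" for m
  proof -
    have "test_function K (\<lambda>x. 0)" by (simp add: test_function_def smooth_const)
    then have "test_function K (\<lambda>x. \<Psi> m x $ i)" for i
      using \<psi> by (cases "i = m") (simp_all add: \<Psi>_def)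
    then show ?thesis by (simp add: test_field_def)
  qed
  have comp: "(\<lambda>y. \<Psi> m y $ i) = (if i = m then \<psi> else (\<lambda>_. 0))" for m i by (auto simp: \<Psi>_def)
  have curl0: "(LINT x|lebesgue_on K. w x \<bullet> curl (\<Psi> m) x) = 0" for m
    using w test[of m] by (simp add: has_weak_curl_def)
  have 1: "(LINT x|lebesgue_on K. w x $ 2 * partial 3 \<psi> x) = (LINT x|lebesgue_on K. w x $ 3 * partial 2 \<psi> x)"
    using curl0[of 1] int by (simp add: curl_def comp inner_vec_def sum_3)
  have 2: "(LINT x|lebesgue_on K. w x $ 3 * partial 1 \<psi> x) = (LINT x|lebesgue_on K. w x $ 1 * partial 3 \<psi> x)"
    using curl0[of 2] int by (simp add: curl_def comp inner_vec_def sum_3)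
  have 3: "(LINT x|lebesgue_on K. w x $ 1 * partial 2 \<psi> x) = (LINT x|lebesgue_on K. w x $ 2 * partial 1 \<psi> x)"
    using curl0[of 3] int by (simp add: curl_def comp inner_vec_def sum_3)
  show ?thesis using 1 2 3 exhaust_3[of i] exhaust_3[of j] by auto
qed

text \<open>The potential is the line integral of W along the segment from x0 to x. Symmetry of the
  Jacobian turns the j-th derivative of its integrand into the t-derivative of t W_j, whose integral
  is the value of W_j at x. Smoothness is global, but symmetry is available only on K, hence the
  convexity.\<close>

lemma poincare_lemma:
  fixes W :: "3 \<Rightarrow> real^3 \<Rightarrow> real"
  assumes W: "\<And>i. smooth_on UNIV (W i)" and x0: "x0 \<in> K" and K: "convex K"
    and sym: "\<And>i j x. x \<in> K \<Longrightarrow> partial j (W i) x = partial i (W j) x"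
  obtains \<phi> where "smooth_on UNIV \<phi>" "\<And>x i. x \<in> K \<Longrightarrow> gradient \<phi> x $ i = W i x"
proof -
  \<comment> \<open>The difference of coordinates is written as a sum to fit the closure rules of
    \<open>PC\<close>.\<close>
  define f where "f x t = (\<Sum>i\<in>UNIV. W i (t *\<^sub>R x + (1 - t) *\<^sub>R x0) * (x $ i + - (x0 $ i)))" for x and t :: real
  have Wt: "PC k (\<lambda>x t. W i (t *\<^sub>R x + (1 - t) *\<^sub>R x0))" for i k
    using W[of i] by (intro PC_affine) (auto simp: smooth_on_def intro!: continuous_intros)
  have f_PC: "PC k f" for k
    unfolding f_def
    by (intro PC_sum PC_mult PC_add PC_coord PC_const Wt) auto
  define M where "M = restrict_space lborel {0..1::real}"
  have one: "integrable M (\<lambda>t. 1 :: real)"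
    unfolding M_def by (subst integrable_restrict_space) auto
  have AE01: "AE t in M. t \<in> {0..1}" unfolding M_def by (subst AE_restrict_space_iff) auto
  have id: "(\<lambda>t. t) \<in> borel_measurable M" unfolding M_def by (simp add: measurable_restrict_space1)
  define \<phi> where "\<phi> x = (LINT t|M. 1 * f x t)" for x
  have "smooth_on UNIV \<phi>" unfolding \<phi>_def
    by (rule smooth_parametric_integral[OF f_PC one compact_Icc AE01 id])
  moreover have "gradient \<phi> x $ j = W j x" if x: "x \<in> K" for x j
  proof -
    define X where "X t = x0 + t *\<^sub>R (x - x0)" for t
    have X_eq: "t *\<^sub>R x + (1 - t) *\<^sub>R x0 = X t" for t by (simp add: X_def algebra_simps)
    have XK: "X t \<in> K" if "0 \<le> t" "t \<le> 1" for t
      using convexD_alt[OF K x0 x that] by (simp add: X_def algebra_simps)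
    define F' where "F' t = W j (X t) + t * (gradient (W j) (X t) \<bullet> (x - x0))" for t
    have der: "((\<lambda>t. t * W j (X t)) has_real_derivative F' t) (at t)" for t
      using has_real_derivative_line[OF W[of j], of x0 "x - x0" t UNIV]
      unfolding X_def F'_def by (auto intro!: derivative_eq_intros simp: mult.commute)
    have X_cont: "continuous_on UNIV X" unfolding X_def by (intro continuous_intros)
    have "continuous_on UNIV F'"
      unfolding F'_def
      by (intro continuous_intros continuous_on_compose2[OF smooth_continuous[OF W] X_cont]
          continuous_on_compose2[OF smooth_gradient_continuous[OF W] X_cont]) auto
    then have isc: "isCont F' t" for t by (simp add: continuous_on_eq_continuous_at)
    have FTC: "(LINT t|lborel. F' t * indicator {0..1} t) = W j x"
      using integral_FTC_Icc_real[of 0 1, OF _ der isc] by (simp add: X_def)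
    have pf: "partial j (\<lambda>x. f x t) x = F' t" if t: "0 \<le> t" "t \<le> 1" for t
    proof -
      have D: "((\<lambda>x. W i (t *\<^sub>R x + (1 - t) *\<^sub>R x0) * (x $ i + - (x0 $ i))) has_derivative
        (\<lambda>h. W i (X t) * h $ i + (gradient (W i) (X t) \<bullet> (t *\<^sub>R h)) * (x $ i - x0 $ i))) (at x)" for i
      proof -
        have 1: "((\<lambda>x. W i (t *\<^sub>R x + (1 - t) *\<^sub>R x0)) has_derivative (\<lambda>h. gradient (W i) (X t) \<bullet> (t *\<^sub>R h))) (at x)"
          unfolding X_eq[symmetric]
          by (rule has_derivative_compose[where f = "\<lambda>x. t *\<^sub>R x + (1 - t) *\<^sub>R x0" and f' = "\<lambda>h. t *\<^sub>R h" and s = UNIV,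
              OF _ has_derivative_gradient[OF smooth_differentiable[OF W]]]) (auto intro!: derivative_eq_intros)
        have 2: "((\<lambda>x. x $ i + - (x0 $ i)) has_derivative (\<lambda>h. h $ i)) (at x)"
          by (auto intro!: derivative_eq_intros bounded_linear.has_derivative[OF bounded_linear_vec_nth])
        show ?thesis using has_derivative_mult[OF 1 2] by (simp add: X_eq)
      qed
      have "partial j (\<lambda>x. f x t) x = (\<Sum>i\<in>UNIV. W i (X t) * axis j 1 $ i + (gradient (W i) (X t) \<bullet> (t *\<^sub>R axis j 1)) * (x $ i - x0 $ i))"
        unfolding f_def by (rule partial_eqI[OF has_derivative_sum[OF D]])
      also have "\<dots> = (\<Sum>i\<in>UNIV. W i (X t) * axis j 1 $ i) + t * (\<Sum>i\<in>UNIV. partial j (W i) (X t) * (x $ i - x0 $ i))"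
        by (simp add: inner_axis sum.distrib sum_distrib_left mult.assoc)
      also have "(\<Sum>i\<in>UNIV. W i (X t) * axis j 1 $ i) = W j (X t)"
        by (simp add: axis_def if_distrib cong: if_cong)
      \<comment> \<open>The symmetry is used here: differentiating all components in direction j
        equals differentiating component j along the segment.\<close>
      also have "(\<Sum>i\<in>UNIV. partial j (W i) (X t) * (x $ i - x0 $ i)) = gradient (W j) (X t) \<bullet> (x - x0)"
        using sym[OF XK[OF t], of j] by (simp add: inner_vec_def)
      finally show ?thesis by (simp add: F'_def)
    qed
    have "gradient \<phi> x $ j = (LINT t|M. 1 * partial j (\<lambda>x. f x t) x)"
      unfolding gradient_nth \<phi>_def by (rule partial_parametric_integral[OF f_PC one compact_Icc AE01 id])
    also have "\<dots> = (LINT t|lborel. indicator {0..1} t *\<^sub>R (1 * partial j (\<lambda>x. f x t) x))"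
      unfolding M_def by (rule integral_restrict_space) simp
    also have "\<dots> = (LINT t|lborel. F' t * indicator {0..1} t)"
      by (rule Bochner_Integration.integral_cong) (auto simp: indicator_def pf)
    finally show ?thesis using FTC by simp
  qed
  ultimately show ?thesis by (rule that)
qed

section \<open>Mollification adapted to a convex set\<close>

lemma ex_mollifier:
  assumes K: "open K" "K \<noteq> {}"
  obtains \<rho> where "test_function K \<rho>" "\<And>x. 0 \<le> \<rho> x" "(\<integral>\<^sup>+x. ennreal (\<rho> x) \<partial>lborel) = 1"
proof -
  obtain x0 where x0: "x0 \<in> K" using K by blast
  obtain a b where ab: "x0 \<in> box a b" "cbox a b \<subseteq> K"
    by (rule open_contains_cbox[OF K(1) x0]) (rule that)
  define B where "B = box_bump 0 a b"
  have Bt: "test_function K B" unfolding B_def by (rule box_bump_test_function[OF ab(2)])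
  have B0: "0 \<le> B x" for x by (simp add: B_def box_bump_bounds)
  have [measurable]: "B \<in> borel_measurable borel"
    by (intro borel_measurable_continuous_onI smooth_continuous test_function_smooth[OF Bt])
  define I where "I = (\<integral>\<^sup>+x. ennreal (B x) \<partial>lborel)"
  have "I \<le> (\<integral>\<^sup>+x. indicator (box a b) x \<partial>lborel)"
    unfolding I_def B_def using box_bump_bounds[of 0 a b] box_bump_eq_0[of _ a b 0]
    by (intro nn_integral_mono) (auto simp: indicator_def ennreal_le_1)
  also have "\<dots> < \<infinity>" using emeasure_lborel_box_finite[of a b] by simp
  finally have fin: "I < \<infinity>" .
  have "I \<noteq> 0"
  proof
    assume "I = 0"
    then have "AE x in lborel. ennreal (B x) = 0" unfolding I_def by (subst (asm) nn_integral_0_iff_AE) auto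
    then have "AE x in lborel. x \<notin> box a b"
      by eventually_elim (use box_bump_pos[of _ a b 0] B0 in \<open>force simp: B_def ennreal_eq_0_iff\<close>)
    then have "box a b \<in> null_sets lborel" by (subst (asm) AE_iff_null) auto
    then have "negligible (box a b)" by (auto simp: negligible_iff_null_sets null_sets_completion_iff)
    then show False using open_not_negligible[OF open_box] ab(1) by blast
  qed
  define c where "c = enn2real I"
  have c: "c > 0" "I = ennreal c" using fin \<open>I \<noteq> 0\<close> by (auto simp: c_def enn2real_positive_iff less_top zero_less_iff_neq_zero)
  show ?thesis
  proof (rule that[of "\<lambda>x. inverse c * B x"])
    show "test_function K (\<lambda>x. inverse c * B x)" by (intro test_function_mult_smooth[OF Bt] smooth_const)
    show "0 \<le> inverse c * B x" for x using c B0 by simp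
    have "(\<integral>\<^sup>+x. ennreal (inverse c * B x) \<partial>lborel) = ennreal (inverse c) * I"
      unfolding I_def using c B0 by (simp add: ennreal_mult nn_integral_cmult)
    also have "\<dots> = 1" using c by (simp add: ennreal_mult[symmetric])
    finally show "(\<integral>\<^sup>+x. ennreal (inverse c * B x) \<partial>lborel) = 1" .
  qed
qed

text \<open>As a function of y this is the probability density of the point (1 - \<delta>) x +
  \<delta> z when z has density \<rho>. Taking \<rho> supported in K itself, not near the origin,
  makes this point a convex combination of points of K.\<close>

definition dilated_kernel :: "(real^3 \<Rightarrow> real) \<Rightarrow> real \<Rightarrow> real^3 \<Rightarrow> real^3 \<Rightarrow> real" where
  "dilated_kernel \<rho> \<delta> x y = (1 / \<delta>) ^ 3 * \<rho> (- ((1 - \<delta>) / \<delta>) *\<^sub>R x + (1 / \<delta>) *\<^sub>R y)"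

lemma dilated_kernel_PC:
  assumes "smooth_on UNIV \<rho>"
  shows "PC k (dilated_kernel \<rho> \<delta>)"
proof -
  have "PC k (\<lambda>x y. (1 / \<delta>) ^ 3 * \<rho> ((- ((1 - \<delta>) / \<delta>)) *\<^sub>R x + (1 / \<delta>) *\<^sub>R y))"
    using assms by (intro PC_mult PC_const PC_affine) (auto simp: smooth_on_def intro!: continuous_intros)
  then show ?thesis by (simp add: dilated_kernel_def[abs_def])
qed

text \<open>x and y enter through one affine combination, so an x-derivative is a multiple of a
  y-derivative and the weak formulation in y becomes applicable. The factor is the same for all
  directions and therefore harmless in symmetry statements.\<close>

lemma dilated_kernel_partials:
  assumes \<rho>: "smooth_on UNIV \<rho>" and \<delta>: "0 < \<delta>"
  shows "partial j (\<lambda>x. dilated_kernel \<rho> \<delta> x y) x = - (1 - \<delta>) * partial j (dilated_kernel \<rho> \<delta> x) y"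
proof -
  define s where "s = - ((1 - \<delta>) / \<delta>)"
  define t where "t = 1 / \<delta>"
  have aff: "(\<lambda>x. \<rho> (s *\<^sub>R x + d)) differentiable (at z)" "partial j (\<lambda>x. \<rho> (s *\<^sub>R x + d)) z = s * partial j \<rho> (s *\<^sub>R z + d)"
    for s d z
    using partial_affine[OF smooth_differentiable[OF \<rho>]] by blast+
  have scaled: "partial j (\<lambda>x. t ^ 3 * \<rho> (s *\<^sub>R x + d)) z = t ^ 3 * (s * partial j \<rho> (s *\<^sub>R z + d))" for s d z
    by (subst partial_mult[OF differentiable_const aff(1)]) (simp add: aff(2))
  have 1: "(\<lambda>x. dilated_kernel \<rho> \<delta> x y) = (\<lambda>x. t ^ 3 * \<rho> (s *\<^sub>R x + t *\<^sub>R y))"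
    by (simp add: dilated_kernel_def s_def t_def)
  have 2: "dilated_kernel \<rho> \<delta> x = (\<lambda>y. t ^ 3 * \<rho> (t *\<^sub>R y + s *\<^sub>R x))"
    by (simp add: dilated_kernel_def[abs_def] s_def t_def add.commute)
  have "s = - (1 - \<delta>) * t"
    by (simp only: s_def t_def mult_minus_left times_divide_eq_right mult_1_right)
  then show ?thesis unfolding 1 2 scaled by (simp add: add.commute)
qed

lemma dilated_kernel_support:
  assumes "dilated_kernel \<rho> \<delta> x y \<noteq> 0" "test_function K \<rho>" "0 < \<delta>"
  shows "\<exists>z\<in>K. y = (1 - \<delta>) *\<^sub>R x + \<delta> *\<^sub>R z"
proof -
  define z where "z = - ((1 - \<delta>) / \<delta>) *\<^sub>R x + (1 / \<delta>) *\<^sub>R y"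
  have "\<rho> z \<noteq> 0" using assms(1) by (simp add: dilated_kernel_def z_def)
  then have "z \<in> K" using test_function_eq_0[OF assms(2)] by blast
  moreover have "y = (1 - \<delta>) *\<^sub>R x + \<delta> *\<^sub>R z" using assms(3) by (simp add: z_def scaleR_add_right scaleR_diff_right)
  ultimately show ?thesis by blast
qed

text \<open>The support in y lies in the image of the support of \<rho> under z -> (1 - \<delta>) x
  + \<delta> z, a compact set that convexity keeps inside K. The kernel is thus an admissible test
  function in the weak curl condition, for every x in K.\<close>

lemma dilated_kernel_test_function:
  assumes \<rho>: "test_function K \<rho>" and K: "convex K" "x \<in> K" and \<delta>: "0 < \<delta>" "\<delta> < 1"
  shows "test_function K (dilated_kernel \<rho> \<delta> x)"
proof -
  define S where "S = closure {z. \<rho> z \<noteq> 0}"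
  have S: "compact S" "S \<subseteq> K" using \<rho> by (auto simp: test_function_def S_def)
  define S' where "S' = (\<lambda>z. (1 - \<delta>) *\<^sub>R x + \<delta> *\<^sub>R z) ` S"
  have S'c: "compact S'" unfolding S'_def by (intro compact_continuous_image continuous_intros S)
  have S'K: "S' \<subseteq> K" unfolding S'_def using S(2) K \<delta> by (auto intro!: convexD)
  have "test_function S \<rho>" using \<rho> by (simp add: test_function_def S_def)
  then have "{y. dilated_kernel \<rho> \<delta> x y \<noteq> 0} \<subseteq> S'"
    using dilated_kernel_support[of \<rho> \<delta> x _ S] \<delta>(1) by (auto simp: S'_def)
  then have sub: "closure {y. dilated_kernel \<rho> \<delta> x y \<noteq> 0} \<subseteq> S'"
    using S'c by (simp add: closure_minimal compact_imp_closed)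
  have "compact (closure {y. dilated_kernel \<rho> \<delta> x y \<noteq> 0})"
    using compact_Int_closed[OF S'c closed_closure, of "{y. dilated_kernel \<rho> \<delta> x y \<noteq> 0}"] sub by (simp add: inf.absorb2)
  moreover have "smooth_on UNIV (dilated_kernel \<rho> \<delta> x)"
  proof -
    have "PC k (\<lambda>y (t::real). (1 / \<delta>) ^ 3 * \<rho> ((1 / \<delta>) *\<^sub>R y + (- ((1 - \<delta>) / \<delta>) *\<^sub>R x)))" for k
      using test_function_smooth[OF \<rho>]
      by (intro PC_mult PC_const PC_affine) (auto simp: smooth_on_def intro!: continuous_intros)
    then show ?thesis by (simp add: smooth_on_def Ck_on_UNIV_iff dilated_kernel_def add.commute)
  qed
  ultimately show ?thesis using sub S'K unfolding test_function_def by blast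
qed

text \<open>Contracting towards the support of \<open>\<rho>\<close> while mollifying keeps the support of
  \<open>y \<mapsto> k(x,y)\<close> inside \<open>K\<close>, also for \<open>x\<close> near the boundary.\<close>

lemma dilated_kernel_integrals:
  assumes \<rho>: "test_function K \<rho>" "\<And>x. 0 \<le> \<rho> x" "(\<integral>\<^sup>+x. ennreal (\<rho> x) \<partial>lborel) = 1"
    and K: "convex K" "open K" and \<delta>: "0 < \<delta>" "\<delta> \<le> 1/2"
  shows "x \<in> K \<Longrightarrow> (\<integral>\<^sup>+y. ennreal (dilated_kernel \<rho> \<delta> x y) \<partial>lebesgue_on K) = 1"
    and "(\<integral>\<^sup>+x. ennreal (dilated_kernel \<rho> \<delta> x y) \<partial>lebesgue_on K) \<le> 8"
proof -
  have Kb: "K \<in> sets borel" using K by auto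
  have \<rho>_cont: "continuous_on UNIV \<rho>" by (intro smooth_continuous test_function_smooth[OF \<rho>(1)])
  have [measurable]: "\<rho> \<in> borel_measurable borel" by (rule borel_measurable_continuous_onI[OF \<rho>_cont])
  have m1: "(\<lambda>y. ennreal (dilated_kernel \<rho> \<delta> x y)) \<in> borel_measurable borel" for x
    unfolding dilated_kernel_def by measurable
  have m2: "(\<lambda>x. ennreal (dilated_kernel \<rho> \<delta> x y)) \<in> borel_measurable borel" for y
    unfolding dilated_kernel_def by measurable
  have split: "ennreal ((1 / \<delta>) ^ 3 * \<rho> z) = ennreal ((1 / \<delta>) ^ 3) * ennreal (\<rho> z)" for z
    using \<delta> \<rho>(2) by (intro ennreal_mult) auto
  {
    assume x: "x \<in> K"
    have "dilated_kernel \<rho> \<delta> x y = 0" if "y \<notin> K" for y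
      using test_function_eq_0[OF dilated_kernel_test_function[OF \<rho>(1) K(1) x \<delta>(1)] that] \<delta>(2) by simp
    then have "(\<integral>\<^sup>+y. ennreal (dilated_kernel \<rho> \<delta> x y) \<partial>lebesgue_on K) = (\<integral>\<^sup>+y. ennreal (dilated_kernel \<rho> \<delta> x y) \<partial>lborel)"
      unfolding nn_integral_lebesgue_on_lborel[OF Kb m1] by (intro nn_integral_cong) (auto simp: indicator_def)
    also have "\<dots> = ennreal ((1 / \<delta>) ^ 3) * (\<integral>\<^sup>+y. ennreal (\<rho> (- ((1 - \<delta>) / \<delta>) *\<^sub>R x + (1 / \<delta>) *\<^sub>R y)) \<partial>lborel)"
      unfolding dilated_kernel_def split by (intro nn_integral_cmult) measurable
    also have "\<dots> = (\<integral>\<^sup>+x. ennreal (\<rho> x) \<partial>lborel)"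
      using nn_integral_lborel_affine[of "\<lambda>x. ennreal (\<rho> x)" "1 / \<delta>" "- ((1 - \<delta>) / \<delta>) *\<^sub>R x"] \<delta>
      by simp
    finally show "(\<integral>\<^sup>+y. ennreal (dilated_kernel \<rho> \<delta> x y) \<partial>lebesgue_on K) = 1" using \<rho>(3) by simp
  }
  define s where "s = (1 - \<delta>) / \<delta>"
  have s: "s > 0" using \<delta> by (simp add: s_def)
  \<comment> \<open>Over the whole space the integral in x is (1 - \<delta>)^(-3), which is at most
    8 because \<delta> <= 1/2.\<close>
  have s_le: "(1 / \<delta>) ^ 3 \<le> 8 * s ^ 3"
  proof -
    have "1 / \<delta> \<le> 2 * s" using \<delta> by (simp add: s_def field_simps)
    then have "(1 / \<delta>) ^ 3 \<le> (2 * s) ^ 3" using \<delta> by (intro power_mono) auto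
    then show ?thesis by (simp add: power_mult_distrib)
  qed
  have "(\<integral>\<^sup>+x. ennreal (dilated_kernel \<rho> \<delta> x y) \<partial>lebesgue_on K) \<le> (\<integral>\<^sup>+x. ennreal (dilated_kernel \<rho> \<delta> x y) \<partial>lborel)"
    unfolding nn_integral_lebesgue_on_lborel[OF Kb m2] by (intro nn_integral_mono) (auto simp: indicator_def)
  also have "\<dots> = ennreal ((1 / \<delta>) ^ 3) * (\<integral>\<^sup>+x. ennreal (\<rho> ((1 / \<delta>) *\<^sub>R y + (- s) *\<^sub>R x)) \<partial>lborel)"
    unfolding dilated_kernel_def split s_def[symmetric] add.commute[of _ "(1 / \<delta>) *\<^sub>R y"]
    by (intro nn_integral_cmult) measurable
  also have "\<dots> \<le> ennreal (8 * s ^ 3) * (\<integral>\<^sup>+x. ennreal (\<rho> ((1 / \<delta>) *\<^sub>R y + (- s) *\<^sub>R x)) \<partial>lborel)"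
    by (intro mult_right_mono ennreal_leI s_le) auto
  also have "\<dots> = 8 * (ennreal (s ^ 3) * (\<integral>\<^sup>+x. ennreal (\<rho> ((1 / \<delta>) *\<^sub>R y + (- s) *\<^sub>R x)) \<partial>lborel))"
    using s by (simp add: ennreal_mult mult.assoc)
  also have "\<dots> = 8 * (\<integral>\<^sup>+x. ennreal (\<rho> x) \<partial>lborel)"
    using nn_integral_lborel_affine[of "\<lambda>x. ennreal (\<rho> x)" "- s" "(1 / \<delta>) *\<^sub>R y"] s by simp
  finally show "(\<integral>\<^sup>+x. ennreal (dilated_kernel \<rho> \<delta> x y) \<partial>lebesgue_on K) \<le> 8" using \<rho>(3) by simp
qed

lemma curl_free_orthogonal:
  assumes K: "bounded K" "open K" "convex K" "K \<noteq> {}"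
    and v: "L2_on K v" and w: "has_weak_curl K w (\<lambda>_. 0)"
    and orth: "\<And>\<phi>. smooth_on UNIV \<phi> \<Longrightarrow> (LINT x|lebesgue_on K. v x \<bullet> gradient \<phi> x) = 0"
  shows "(LINT x|lebesgue_on K. v x \<bullet> w x) = 0"
proof -
  have wL: "L2_on K w" using w by (simp add: has_weak_curl_def)
  have comp: "L2_on K (\<lambda>x. f x $ i)" if "L2_on K f" for f :: "real^3 \<Rightarrow> real^3" and i
  proof -
    have m: "(\<lambda>x. f x $ i) \<in> borel_measurable (lebesgue_on K)"
    proof -
      have "f \<in> borel_measurable (lebesgue_on K)" using that by (simp add: L2_on_def)
      from measurable_compose[OF this, of "\<lambda>v. v $ i"] show ?thesis
        by (simp add: borel_measurable_continuous_onI continuous_on_component)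
    qed
    have "integrable (lebesgue_on K) (\<lambda>x. (norm (f x $ i))\<^sup>2)"
    proof (rule Bochner_Integration.integrable_bound)
      show "integrable (lebesgue_on K) (\<lambda>x. (norm (f x))\<^sup>2)" using that by (simp add: L2_on_def)
      show "(\<lambda>x. (norm (f x $ i))\<^sup>2) \<in> borel_measurable (lebesgue_on K)" using m by measurable
      show "AE x in lebesgue_on K. norm ((norm (f x $ i))\<^sup>2) \<le> norm ((norm (f x))\<^sup>2)"
      proof (intro AE_I2)
        fix x
        have "\<bar>f x $ i\<bar>\<^sup>2 \<le> (norm (f x))\<^sup>2" by (intro power_mono component_le_norm_cart) auto
        then show "norm ((norm (f x $ i))\<^sup>2) \<le> norm ((norm (f x))\<^sup>2)" by simp
      qed
    qed
    with m show ?thesis by (simp add: L2_on_def)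
  qed
  have wi: "L2_on K (\<lambda>x. w x $ i)" and vi: "L2_on K (\<lambda>x. v x $ i)" for i using comp v wL by auto
  have one: "L2_on K (\<lambda>x. 1 :: real)" by (intro L2_on_continuous K continuous_on_const)
  have wint: "integrable (lebesgue_on K) (\<lambda>x. w x $ i)" for i
    using L2_on_inner_integrable[OF wi one] by simp
  obtain \<rho> where \<rho>: "test_function K \<rho>" "\<And>x. 0 \<le> \<rho> x" "(\<integral>\<^sup>+x. ennreal (\<rho> x) \<partial>lborel) = 1"
    using ex_mollifier[OF K(2,4)] by blast
  \<comment> \<open>The shift by two gives \<delta> <= 1/2 from the start, as the column bound of
    the kernel requires.\<close>
  define \<delta> where "\<delta> n = inverse (real (Suc (Suc n)))" for n
  have \<delta>: "0 < \<delta> n" "\<delta> n \<le> 1/2" "\<delta> n < 1" for n by (auto simp: \<delta>_def field_simps)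
  have \<delta>_lim: "\<delta> \<longlonglongrightarrow> 0"
    unfolding \<delta>_def using LIMSEQ_Suc[OF LIMSEQ_inverse_real_of_nat] by simp
  define k where "k n = dilated_kernel \<rho> (\<delta> n)" for n
  have k_PC: "PC l (k n)" for l n unfolding k_def by (rule dilated_kernel_PC[OF test_function_smooth[OF \<rho>(1)]])
  have k_nn: "0 \<le> k n x y" for n x y using \<rho>(2) \<delta>(1)[of n] by (simp add: k_def dilated_kernel_def)
  obtain D where D: "\<And>x y. x \<in> K \<Longrightarrow> y \<in> K \<Longrightarrow> dist x y \<le> D"
    using diameter_bounded_bound[OF K(1)] by metis
  define W where "W n i x = (LINT y|lebesgue_on K. w y $ i * k n x y)" for n i x
  have compact: "compact (closure K)" using K(1) by (simp add: compact_closure)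
  have AE_K: "AE y in lebesgue_on K. y \<in> closure K" using closure_subset by (intro AE_I2) auto
  have W_smooth: "smooth_on UNIV (W n i)" for n i
    unfolding W_def by (rule smooth_parametric_integral[OF k_PC wint compact AE_K id_measurable_lebesgue_on])
  \<comment> \<open>The derivative is passed from x to y, where the kernel is a test function; weak
    symmetry of w then becomes classical symmetry of the mollified field.\<close>
  have W_sym: "partial j (W n i) x = partial i (W n j) x" if x: "x \<in> K" for n i j x
  proof -
    have "partial j (W n i) x = - (1 - \<delta> n) * (LINT y|lebesgue_on K. w y $ i * partial j (k n x) y)" for i j
    proof -
      have "partial j (W n i) x = (LINT y|lebesgue_on K. w y $ i * partial j (\<lambda>x. k n x y) x)"
        unfolding W_def by (rule partial_parametric_integral[OF k_PC wint compact AE_K id_measurable_lebesgue_on])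
      also have "\<dots> = (LINT y|lebesgue_on K. - (1 - \<delta> n) * (w y $ i * partial j (k n x) y))"
        unfolding k_def dilated_kernel_partials[OF test_function_smooth[OF \<rho>(1)] \<delta>(1)]
        by (simp add: mult.left_commute)
      finally show ?thesis by simp
    qed
    moreover have "test_function K (k n x)"
      unfolding k_def by (rule dilated_kernel_test_function[OF \<rho>(1) K(3) x \<delta>(1,3)])
    ultimately show ?thesis using weak_curl_zero_symmetric[OF w K(1,2)] by simp
  qed
  obtain x0 where x0: "x0 \<in> K" using K(4) by blast
  have zero: "(\<Sum>i\<in>UNIV. LINT x|lebesgue_on K. v x $ i * W n i x) = 0" for n
  proof -
    obtain \<phi> where \<phi>: "smooth_on UNIV \<phi>" "\<And>x i. x \<in> K \<Longrightarrow> gradient \<phi> x $ i = W n i x"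
      by (rule poincare_lemma[of "W n", OF W_smooth x0 K(3) W_sym]) (assumption, rule that)
    have int: "integrable (lebesgue_on K) (\<lambda>x. v x $ i * W n i x)" for i
      using L2_on_inner_integrable[OF vi L2_on_continuous[OF K(1,2) smooth_continuous[OF W_smooth]]] by simp
    have "0 = (LINT x|lebesgue_on K. v x \<bullet> gradient \<phi> x)" using orth[OF \<phi>(1)] by simp
    also have "\<dots> = (LINT x|lebesgue_on K. (\<Sum>i\<in>UNIV. v x $ i * W n i x))"
      using \<phi>(2) by (intro Bochner_Integration.integral_cong refl) (simp add: inner_vec_def)
    also have "\<dots> = (\<Sum>i\<in>UNIV. LINT x|lebesgue_on K. v x $ i * W n i x)"
      using int by (intro Bochner_Integration.integral_sum)
    finally show ?thesis by simp
  qed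
  have "(\<lambda>n. LINT x|lebesgue_on K. v x $ i * W n i x) \<longlonglongrightarrow> (LINT x|lebesgue_on K. v x $ i * w x $ i)" for i
    unfolding W_def
  proof (rule kernel_approximation[OF K(1,2) _ k_nn _ _ _ _ vi wi, where r = "\<lambda>n. \<delta> n * D"])
    show "continuous_on UNIV (\<lambda>z. k n (fst z) (snd z))" for n by (rule PC_continuous[OF k_PC])
    show "(\<integral>\<^sup>+y. ennreal (k n x y) \<partial>lebesgue_on K) = 1" if "x \<in> K" for n x
      unfolding k_def by (rule dilated_kernel_integrals(1)[OF \<rho> K(3,2) \<delta>(1,2) that])
    show "(\<integral>\<^sup>+x. ennreal (k n x y) \<partial>lebesgue_on K) \<le> 8" for n y
      unfolding k_def by (rule dilated_kernel_integrals(2)[OF \<rho> K(3,2) \<delta>(1,2)])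
    show "dist y x \<le> \<delta> n * D" if x: "x \<in> K" and nz: "k n x y \<noteq> 0" for n x y
    proof -
      obtain z where z: "z \<in> K" "y = (1 - \<delta> n) *\<^sub>R x + \<delta> n *\<^sub>R z"
        using dilated_kernel_support[OF nz[unfolded k_def] \<rho>(1) \<delta>(1)] by blast
      then have "y - x = \<delta> n *\<^sub>R (z - x)" by (simp add: algebra_simps)
      then have "dist y x = \<delta> n * dist z x" using \<delta>(1)[of n] by (simp add: dist_norm)
      with D[OF z(1) x] \<delta>(1)[of n] show ?thesis by (simp add: mult_left_mono)
    qed
    have "(\<lambda>n. \<delta> n * D) \<longlonglongrightarrow> 0 * D" by (intro tendsto_intros \<delta>_lim)
    then show "(\<lambda>n. \<delta> n * D) \<longlonglongrightarrow> 0" by simp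
  qed
  then have "(\<lambda>n. \<Sum>i\<in>UNIV. LINT x|lebesgue_on K. v x $ i * W n i x) \<longlonglongrightarrow> (\<Sum>i\<in>UNIV. LINT x|lebesgue_on K. v x $ i * w x $ i)"
    by (intro tendsto_sum) auto
  then have "(\<Sum>i\<in>UNIV. LINT x|lebesgue_on K. v x $ i * w x $ i) = 0"
    unfolding zero using LIMSEQ_unique tendsto_const by blast
  moreover have "(LINT x|lebesgue_on K. v x \<bullet> w x) = (\<Sum>i\<in>UNIV. LINT x|lebesgue_on K. v x $ i * w x $ i)"
    using L2_on_inner_integrable[OF vi wi] by (simp add: inner_vec_def Bochner_Integration.integral_sum)
  ultimately show ?thesis by simp
qed

section \<open>The Neumann problem\<close>

text \<open>This rests on completeness of Lebesgue measure. It is applied to the product of \<alpha>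
  with a field, where \<alpha> is known only up to a null set.\<close>

lemma borel_measurable_AE_lebesgue_on:
  fixes f g :: "'a::euclidean_space \<Rightarrow> 'b::euclidean_space"
  assumes K: "K \<in> sets borel" and f: "f \<in> borel_measurable (lebesgue_on K)" and fg: "AE x in lebesgue_on K. f x = g x"
  shows "g \<in> borel_measurable (lebesgue_on K)"
proof -
  have Kl: "K \<in> sets lebesgue" using K by auto
  have ae: "AE x in lebesgue. indicator K x *\<^sub>R f x = indicator K x *\<^sub>R g x"
    using fg unfolding AE_lebesgue_on_iff[OF Kl] by eventually_elim (auto simp: indicator_def)
  have "(\<lambda>x. indicator K x *\<^sub>R f x) \<in> borel_measurable lebesgue"
    using f Kl borel_measurable_restrict_space_iff[of K lebesgue f] by simp
  from borel_measurable_AE[OF this ae] show ?thesis using Kl borel_measurable_restrict_space_iff[of K lebesgue g] by simp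
qed

section \<open>Gradients have zero weak curl\<close>

lemma integral_test_function_lborel:
  assumes K: "open K" and \<phi>: "test_function K \<phi>"
  shows "(LINT x|lebesgue_on K. \<phi> x) = (LINT x|lborel. \<phi> x)"
proof -
  have \<phi>_meas: "\<phi> \<in> borel_measurable borel"
    by (intro borel_measurable_continuous_onI smooth_continuous test_function_smooth[OF \<phi>])
  have "indicator K x *\<^sub>R \<phi> x = \<phi> x" for x using test_function_eq_0[OF \<phi>, of x] by (auto simp: indicator_def)
  then show ?thesis using lebesgue_on_lborel(1)[OF borel_open[OF K] \<phi>_meas] by presburger
qed

text \<open>Integrating by parts on either side, with the compactly supported \<eta> absorbing the
  boundary terms, leaves mixed second derivatives of \<phi>, and these commute.\<close>

lemma integral_partials_swap:
  assumes K: "bounded K" "open K" and \<phi>: "smooth_on UNIV \<phi>" and \<eta>: "test_function K \<eta>"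
  shows "(LINT x|lebesgue_on K. partial i \<phi> x * partial j \<eta> x) = (LINT x|lebesgue_on K. partial j \<phi> x * partial i \<eta> x)"
proof -
  have \<eta>s: "smooth_on UNIV \<eta>" by (rule test_function_smooth[OF \<eta>])
  have parts: "(LINT x|lebesgue_on K. partial i \<phi> x * partial j \<eta> x) = - (LINT x|lebesgue_on K. partial j (partial i \<phi>) x * \<eta> x)" for i j
  proof -
    have t: "test_function K (\<lambda>x. partial i \<phi> x * \<eta> x)"
      by (rule test_function_mult_smooth[OF \<eta> smooth_partial[OF \<phi>]])
    have "0 = (LINT x|lborel. partial j (\<lambda>x. partial i \<phi> x * \<eta> x) x)"
      using integral_partial_test_function[OF t] by simp
    also have "\<dots> = (LINT x|lebesgue_on K. partial j (\<lambda>x. partial i \<phi> x * \<eta> x) x)"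
      by (rule integral_test_function_lborel[OF K(2) test_function_partial[OF t], symmetric])
    also have "\<dots> = (LINT x|lebesgue_on K. partial i \<phi> x * partial j \<eta> x + partial j (partial i \<phi>) x * \<eta> x)"
      by (intro Bochner_Integration.integral_cong refl partial_mult smooth_differentiable smooth_partial \<phi> \<eta>s)
    also have "\<dots> = (LINT x|lebesgue_on K. partial i \<phi> x * partial j \<eta> x) + (LINT x|lebesgue_on K. partial j (partial i \<phi>) x * \<eta> x)"
      by (intro Bochner_Integration.integral_add integrable_continuous_lebesgue_on[OF K] continuous_on_mult
          smooth_continuous smooth_partial \<phi> \<eta>s)
    finally show ?thesis by simp
  qed
  show ?thesis unfolding parts using partial_commute[OF \<phi>] by simp
qed

lemma curl_nth:
  "curl \<psi> x $ 1 = partial 2 (\<lambda>y. \<psi> y $ 3) x - partial 3 (\<lambda>y. \<psi> y $ 2) x"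
  "curl \<psi> x $ 2 = partial 3 (\<lambda>y. \<psi> y $ 1) x - partial 1 (\<lambda>y. \<psi> y $ 3) x"
  "curl \<psi> x $ 3 = partial 1 (\<lambda>y. \<psi> y $ 2) x - partial 2 (\<lambda>y. \<psi> y $ 1) x"
  by (simp_all add: curl_def)

lemma test_field_curl_continuous:
  assumes "test_field K \<psi>"
  shows "continuous_on UNIV (curl \<psi>)"
proof (subst continuous_on_componentwise, intro ballI)
  fix b :: "real^3" assume "b \<in> Basis"
  then obtain i where b: "b = axis i 1" by (auto simp: Basis_vec_def)
  have p: "continuous_on UNIV (partial j (\<lambda>y. \<psi> y $ i))" for i j
    using assms
    by (intro smooth_continuous smooth_partial test_function_smooth[of K]) (simp add: test_field_def)
  have "continuous_on UNIV (\<lambda>x. curl \<psi> x $ i)"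
    using exhaust_3[of i] by (auto simp: curl_nth intro!: continuous_on_diff p)
  then show "continuous_on UNIV (\<lambda>x. curl \<psi> x \<bullet> b)" by (simp add: b inner_axis)
qed

text \<open>The six products in the inner product cancel in pairs once the derivatives are swapped.
  \<phi> may be arbitrary up to the boundary, since the test field has compact support.\<close>

lemma gradient_curl_orthogonal:
  assumes K: "bounded K" "open K" and \<phi>: "smooth_on UNIV \<phi>" and \<psi>: "test_field K \<psi>"
  shows "(LINT x|lebesgue_on K. gradient \<phi> x \<bullet> curl \<psi> x) = 0"
proof -
  define J where "J i j k = (LINT x|lebesgue_on K. partial i \<phi> x * partial j (\<lambda>y. \<psi> y $ k) x)" for i j k
  have t: "test_function K (\<lambda>y. \<psi> y $ k)" for k using \<psi> by (simp add: test_field_def)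
  have int: "integrable (lebesgue_on K) (\<lambda>x. partial i \<phi> x * partial j (\<lambda>y. \<psi> y $ k) x)" for i j k
    by (intro integrable_continuous_lebesgue_on[OF K] continuous_on_mult smooth_continuous smooth_partial \<phi>
        test_function_smooth[OF t])
  have sym: "J i j k = J j i k" for i j k unfolding J_def by (rule integral_partials_swap[OF K \<phi> t])
  have "(LINT x|lebesgue_on K. gradient \<phi> x \<bullet> curl \<psi> x)
    = (J 1 2 3 - J 1 3 2) + (J 2 3 1 - J 2 1 3) + (J 3 1 2 - J 3 2 1)"
    using int by (simp add: inner_vec_def sum_3 curl_nth right_diff_distrib J_def)
  then show ?thesis using sym[of 1 2 3] sym[of 1 3 2] sym[of 2 3 1] by simp
qed

text \<open>This removes the boundary term for test functions: a facet is a proper face, hence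
  disjoint from the relative interior of the closed tetrahedron, which is K.\<close>

lemma boundary_integral_outside:
  assumes K: "open_tetrahedron K" and f: "\<And>x. x \<notin> K \<Longrightarrow> f x = 0"
  shows "boundary_integral K f = 0"
  unfolding boundary_integral_def
proof (intro sum.neutral ballI)
  note Kp = open_tetrahedron_props[OF K]
  fix G assume "G \<in> {G. G facet_of closure K}"
  then have G: "G facet_of closure K" by simp
  have "rel_interior (closure K) = K" using rel_interior_nonempty_interior[of "closure K"] Kp(4,6) by simp
  then have disj: "G \<inter> K = {}"
    using face_of_disjoint_rel_interior[OF facet_of_imp_face_of[OF G]] G facet_of_irrefl by metis
  obtain P a0 b0 c0 where G0: "G = convex hull {a0, b0, c0}" using Kp(9)[OF G] by blast
  obtain a b c where abc: "G = convex hull {a, b, c}"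
    "\<And>f. triangle_integral G f = norm (cross3 (b - a) (c - a)) * (LINT p|lebesgue_on std_triangle. f (affine_param a b c p))"
    by (rule triangle_integral_param[OF G0]) (rule that)
  have "f (affine_param a b c p) = 0" if "p \<in> std_triangle" for p
  proof -
    have "affine_param a b c p \<in> G" unfolding abc(1) affine_param_image[symmetric] using that by blast
    then show ?thesis using disj f by blast
  qed
  then have "(LINT p|lebesgue_on std_triangle. f (affine_param a b c p)) = (LINT p|lebesgue_on std_triangle. 0)"
    by (intro Bochner_Integration.integral_cong) auto
  then show "triangle_integral G f = 0" unfolding abc(2) by simp
qed

lemma gradient_comb:
  assumes "smooth_on UNIV \<phi>" "smooth_on UNIV \<eta>"
  shows "gradient (\<lambda>x. \<phi> x + c * \<eta> x) x = gradient \<phi> x + c *\<^sub>R gradient \<eta> x"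
proof -
  have "partial i (\<lambda>x. \<phi> x + c * \<eta> x) x = partial i \<phi> x + c * partial i \<eta> x" for i
  proof -
    have "partial i (\<lambda>x. \<phi> x + c * \<eta> x) x = partial i \<phi> x + partial i (\<lambda>x. c * \<eta> x) x"
      using assms by (intro partial_add smooth_differentiable smooth_mult smooth_const)
    also have "partial i (\<lambda>x. c * \<eta> x) x = c * partial i \<eta> x"
      using assms by (subst partial_mult) (auto intro: smooth_differentiable)
    finally show ?thesis .
  qed
  then show ?thesis by (simp add: vec_eq_iff)
qed

lemma smooth_comb: "smooth_on UNIV \<phi> \<Longrightarrow> smooth_on UNIV \<eta> \<Longrightarrow> smooth_on UNIV (\<lambda>x. \<phi> x + c * \<eta> x)"
  by (intro smooth_add smooth_mult smooth_const)

text \<open>Lax--Milgram on the closure of the gradients. The boundary functional is bounded because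
  it equals a volume functional up to one of zero mean.\<close>

lemma neumann_solution:
  fixes \<alpha> a :: "real^3 \<Rightarrow> real" and g :: "real^3 \<Rightarrow> real"
  assumes K: "open_tetrahedron K"
    and a: "a \<in> borel_measurable borel" "\<And>x. lo \<le> a x" "\<And>x. a x \<le> hi" "0 < lo"
    and \<alpha>: "AE x in lebesgue_on K. \<alpha> x = a x"
    and g: "g \<in> borel_measurable borel" "\<And>x. \<bar>g x\<bar> \<le> Cg"
  obtains v c where "has_weak_div K v (\<lambda>_. c)" "has_normal_trace K v g" "has_weak_curl K (\<lambda>x. \<alpha> x *\<^sub>R v x) (\<lambda>_. 0)"
proof -
  note Kp = open_tetrahedron_props[OF K]
  define M where "M = lebesgue_on K"
  obtain V D C where VD: "V \<in> borel_measurable borel" "D \<in> borel_measurable borel"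
    "\<And>x. x \<in> K \<Longrightarrow> norm (V x) \<le> C" "\<And>x. x \<in> K \<Longrightarrow> \<bar>D x\<bar> \<le> C"
    "\<And>\<phi>. smooth_on UNIV \<phi> \<Longrightarrow> (LINT x|M. V x \<bullet> gradient \<phi> x) + (LINT x|M. D x * \<phi> x)
      = boundary_integral K (\<lambda>x. g x * \<phi> x)"
    by (rule boundary_lifting[OF K g, folded M_def]) (rule that)
  have VL: "L2_on K V" using VD by (intro L2_on_bounded[OF Kp(2,1)] borel_measurable_lebesgue_onI) auto
  have DL: "L2_on K D" using VD by (intro L2_on_bounded[OF Kp(2,1)] borel_measurable_lebesgue_onI) auto
  have constL: "L2_on K (\<lambda>x. c)" for c :: real by (intro L2_on_continuous Kp continuous_on_const)
  have int: "integrable M (\<lambda>x. p x * q x)" if "L2_on K p" "L2_on K q" for p q :: "real^3 \<Rightarrow> real"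
    using L2_on_inner_integrable[OF that] by (simp add: M_def)
  have intv: "integrable M (\<lambda>x. p x \<bullet> q x)" if "L2_on K p" "L2_on K q" for p q :: "real^3 \<Rightarrow> real^3"
    using L2_on_inner_integrable[OF that] by (simp add: M_def)
  have fL: "L2_on K \<phi>" and gL: "L2_on K (gradient \<phi>)" if "smooth_on UNIV \<phi>" for \<phi>
    using that by (auto intro: L2_on_continuous Kp smooth_continuous smooth_gradient_continuous)
  define m where "m = measure lebesgue K"
  have "\<not> negligible K" using Kp(1,4) by (simp add: open_not_negligible)
  then have m: "m > 0"
    using Kp(1,2) lmeasurable_open[OF Kp(2,1)]
    by (simp add: m_def zero_less_measure_iff negligible_iff_measure)
  have mM: "(LINT x|M. c) = m * c" for c :: real
    using Kp(1) by (simp add: M_def m_def measure_restrict_space)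
  \<comment> \<open>The mean of D becomes the divergence of the solution. Without it the functional
    L vanishes on constants, which is necessary for a bound in terms of gradients alone.\<close>
  define c where "c = (LINT x|M. D x) / m"
  define f where "f x = D x - c" for x
  have fL2: "L2_on K f" unfolding f_def by (rule L2_on_diff[OF DL constL])
  have f0: "(LINT x|M. f x) = 0"
  proof -
    have "(LINT x|M. f x) = (LINT x|M. D x) - (LINT x|M. c)"
      unfolding f_def using int[OF DL constL[of 1]] int[OF constL[of c] constL[of 1]] by simp
    then show ?thesis using m unfolding mM by (simp add: c_def)
  qed
  obtain Cp where Cp: "\<And>\<phi>. smooth_on UNIV \<phi> \<Longrightarrow> (LINT x|M. f x * \<phi> x)\<^sup>2 \<le> Cp * (LINT x|M. (norm (gradient \<phi> x))\<^sup>2)"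
    by (rule poincare_functional_bound[OF Kp(2,1,3,4) fL2 f0[unfolded M_def], folded M_def]) (rule that)
  define L where "L \<phi> = (LINT x|M. V x \<bullet> gradient \<phi> x) + (LINT x|M. f x * \<phi> x)" for \<phi>
  have L_eq: "L \<phi> = boundary_integral K (\<lambda>x. g x * \<phi> x) - c * (LINT x|M. \<phi> x)" if "smooth_on UNIV \<phi>" for \<phi>
    using VD(5)[OF that] int[OF DL fL[OF that]] int[OF constL[of c] fL[OF that]]
    by (simp add: L_def f_def left_diff_distrib)
  \<comment> \<open>The gradient limit is \<open>w\<close>, equal to \<alpha> v almost everywhere,
    so the sought field is \<open>b w\<close> and the energy carries the reciprocal
    coefficient.\<close>
  define b where "b x = inverse (a x)" for x
  have a0: "0 < a x" for x using a(2)[of x] a(4) by linarith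
  have b: "b \<in> borel_measurable borel" "\<And>x. 0 < b x" "\<And>x. b x \<le> inverse lo" "\<And>x. 1 \<le> hi * b x" "\<And>x. a x * b x = 1"
  proof -
    show "b \<in> borel_measurable borel" unfolding b_def using a(1) by measurable
    show "0 < b x" "a x * b x = 1" for x using a0[of x] by (simp_all add: b_def)
    show "b x \<le> inverse lo" for x unfolding b_def using a(2,4) a0 by (intro le_imp_inverse_le) auto
    show "1 \<le> hi * b x" for x using a(3)[of x] a0[of x] by (simp add: b_def field_simps)
  qed
  have bL: "L2_on K (\<lambda>x. b x *\<^sub>R u x)" if "L2_on K u" for u :: "real^3 \<Rightarrow> real^3"
    using b by (intro L2_on_mult_bounded[OF that borel_measurable_lebesgue_onI, of b "inverse lo"]) (auto intro!: AE_I2 simp: abs_of_pos)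
  define B where "B \<phi> \<eta> = (LINT x|M. gradient \<phi> x \<bullet> (b x *\<^sub>R gradient \<eta> x))" for \<phi> \<eta>
  have hi: "hi \<ge> 0" using a(2)[of 0] a(3)[of 0] a(4) by linarith
  have coercive: "(LINT x|M. (norm (u x))\<^sup>2) \<le> hi * (LINT x|M. u x \<bullet> (b x *\<^sub>R u x))" if u: "L2_on K u" for u :: "real^3 \<Rightarrow> real^3"
  proof -
    have "(LINT x|M. (norm (u x))\<^sup>2) \<le> (LINT x|M. hi * (u x \<bullet> (b x *\<^sub>R u x)))"
    proof (rule integral_mono)
      show "integrable M (\<lambda>x. (norm (u x))\<^sup>2)" using u by (simp add: L2_on_def M_def)
      show "integrable M (\<lambda>x. hi * (u x \<bullet> (b x *\<^sub>R u x)))" by (intro integrable_mult_right intv u bL)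
      fix x
      show "(norm (u x))\<^sup>2 \<le> hi * (u x \<bullet> (b x *\<^sub>R u x))"
        using mult_right_mono[OF b(4)[of x] zero_le_power2[of "norm (u x)"]]
        by (simp add: power2_norm_eq_inner mult.assoc)
    qed
    then show ?thesis by simp
  qed
  let ?S = "{\<phi>. smooth_on UNIV \<phi>}"
  have "\<exists>\<phi>::nat \<Rightarrow> _. (\<forall>n. \<phi> n \<in> ?S) \<and>
    (\<forall>e>0. \<exists>N. \<forall>i\<ge>N. \<forall>j\<ge>N. B (\<lambda>x. \<phi> i x + (-1) * \<phi> j x) (\<lambda>x. \<phi> i x + (-1) * \<phi> j x) < e) \<and>
    (\<forall>y\<in>?S. (\<lambda>n. B (\<phi> n) y) \<longlonglongrightarrow> L y)"
  proof (rule riesz_sequence[where comb = "\<lambda>c \<phi> \<eta> x. \<phi> x + c * \<eta> x" and C = "2 * ((LINT x|M. (norm (V x))\<^sup>2) + \<bar>Cp\<bar>) * hi"])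
    show "?S \<noteq> {}" using smooth_const by blast
    show "(\<lambda>x. p x + t * q x) \<in> ?S" if "p \<in> ?S" "q \<in> ?S" for t p q using that by (simp add: smooth_comb)
    show "B (\<lambda>x. p x + t * q x) h = B p h + t * B q h" if "p \<in> ?S" "q \<in> ?S" "h \<in> ?S" for t p q h
      using that intv[OF gL bL[OF gL], of p h] intv[OF gL bL[OF gL], of q h]
      by (simp add: B_def gradient_comb inner_add_left distrib_left mult.left_commute)
    show "B p q = B q p" if "p \<in> ?S" "q \<in> ?S" for p q by (simp add: B_def inner_commute)
    show "0 \<le> B p p" if "p \<in> ?S" for p
      unfolding B_def using b(2) by (intro integral_nonneg_AE AE_I2) (simp add: less_imp_le)
    show "L (\<lambda>x. p x + t * q x) = L p + t * L q" if "p \<in> ?S" "q \<in> ?S" for t p q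
      using that intv[OF VL gL, of p] intv[OF VL gL, of q] int[OF fL2 fL, of p] int[OF fL2 fL, of q]
      by (simp add: L_def gradient_comb inner_add_right distrib_left mult.left_commute)
    fix p assume "p \<in> ?S"
    then have p: "smooth_on UNIV p" by simp
    define E where "E = (LINT x|M. (norm (gradient p x))\<^sup>2)"
    have E: "0 \<le> E" "E \<le> hi * B p p" using coercive[OF gL[OF p]] by (auto simp: E_def B_def)
    have "(L p)\<^sup>2 \<le> 2 * (LINT x|M. V x \<bullet> gradient p x)\<^sup>2 + 2 * (LINT x|M. f x * p x)\<^sup>2"
      unfolding L_def
      using zero_le_power2[of "(LINT x|M. V x \<bullet> gradient p x) - (LINT x|M. f x * p x)"]
      by (simp add: power2_eq_square algebra_simps)
    also have "\<dots> \<le> 2 * ((LINT x|M. (norm (V x))\<^sup>2) * E) + 2 * (\<bar>Cp\<bar> * E)"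
    proof (intro add_mono mult_left_mono)
      show "(LINT x|M. V x \<bullet> gradient p x)\<^sup>2 \<le> (LINT x|M. (norm (V x))\<^sup>2) * E"
        unfolding E_def M_def by (rule L2_Cauchy_Schwarz[OF VL gL[OF p]])
      show "(LINT x|M. f x * p x)\<^sup>2 \<le> \<bar>Cp\<bar> * E"
        using Cp[OF p] mult_right_mono[OF abs_ge_self E(1), of Cp] by (simp add: E_def)
    qed auto
    also have "\<dots> = 2 * ((LINT x|M. (norm (V x))\<^sup>2) + \<bar>Cp\<bar>) * E" by (simp add: algebra_simps)
    also have "\<dots> \<le> 2 * ((LINT x|M. (norm (V x))\<^sup>2) + \<bar>Cp\<bar>) * (hi * B p p)"
      by (intro mult_left_mono E) auto
    finally show "(L p)\<^sup>2 \<le> 2 * ((LINT x|M. (norm (V x))\<^sup>2) + \<bar>Cp\<bar>) * hi * B p p" by (simp add: mult.assoc)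
  qed
  then obtain \<phi> :: "nat \<Rightarrow> _" where \<phi>: "\<And>n. smooth_on UNIV (\<phi> n)"
    "\<And>e. e > 0 \<Longrightarrow> \<exists>N. \<forall>i\<ge>N. \<forall>j\<ge>N. B (\<lambda>x. \<phi> i x + (-1) * \<phi> j x) (\<lambda>x. \<phi> i x + (-1) * \<phi> j x) < e"
    "\<And>y. smooth_on UNIV y \<Longrightarrow> (\<lambda>n. B (\<phi> n) y) \<longlonglongrightarrow> L y"
    by auto
  \<comment> \<open>The sequence is Cauchy in the energy B; coercivity, with the upper bound of a,
    transfers this to the unweighted norm of the gradients.\<close>
  have cauchy: "\<exists>N. \<forall>i\<ge>N. \<forall>j\<ge>N. (LINT x|M. (norm (gradient (\<phi> i) x - gradient (\<phi> j) x))\<^sup>2) < e" if e: "e > 0" for e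
  proof -
    have "e / (hi + 1) > 0" using e hi by simp
    from \<phi>(2)[OF this] obtain N where N: "\<And>i j. i \<ge> N \<Longrightarrow> j \<ge> N \<Longrightarrow>
      B (\<lambda>x. \<phi> i x + (-1) * \<phi> j x) (\<lambda>x. \<phi> i x + (-1) * \<phi> j x) < e / (hi + 1)" by blast
    have "(LINT x|M. (norm (gradient (\<phi> i) x - gradient (\<phi> j) x))\<^sup>2) < e" if ij: "i \<ge> N" "j \<ge> N" for i j
    proof -
      define d where "d x = \<phi> i x + (-1) * \<phi> j x" for x
      have ds: "smooth_on UNIV d" unfolding d_def by (intro smooth_comb \<phi>)
      have gd: "gradient d x = gradient (\<phi> i) x - gradient (\<phi> j) x" for x
        unfolding d_def by (subst gradient_comb[OF \<phi>(1) \<phi>(1)]) simp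
      have "(LINT x|M. (norm (gradient d x))\<^sup>2) \<le> hi * B d d" using coercive[OF gL[OF ds]] by (simp add: B_def)
      also have "\<dots> \<le> hi * (e / (hi + 1))" using N[OF ij] hi by (intro mult_left_mono) (auto simp: d_def[abs_def])
      also have "\<dots> < e" using e hi by (simp add: field_simps)
      finally show ?thesis by (simp add: gd)
    qed
    then show ?thesis by blast
  qed
  \<comment> \<open>Only the gradients converge. No limit of the potentials is taken; every later
    property of w is passed on from the gradients.\<close>
  have "\<exists>w. L2_on K w \<and> (\<lambda>n. LINT x|M. (norm (gradient (\<phi> n) x - w x))\<^sup>2) \<longlonglongrightarrow> 0"
    unfolding M_def by (rule L2_complete[OF Kp(2,1) gL[OF \<phi>(1)] cauchy[unfolded M_def]])
  then obtain w where w: "L2_on K w" "(\<lambda>n. LINT x|M. (norm (gradient (\<phi> n) x - w x))\<^sup>2) \<longlonglongrightarrow> 0"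
    by (elim exE conjE)
  define v where "v x = b x *\<^sub>R w x" for x
  have vL: "L2_on K v" unfolding v_def by (rule bL[OF w(1)])
  have v_weak: "(LINT x|M. v x \<bullet> gradient y x) = L y" if y: "smooth_on UNIV y" for y
  proof -
    have "(\<lambda>n. B (\<phi> n) y) \<longlonglongrightarrow> (LINT x|M. w x \<bullet> (b x *\<^sub>R gradient y x))"
      unfolding B_def M_def by (rule L2_inner_tendsto[OF gL[OF \<phi>(1)] w(1) bL[OF gL[OF y]] w(2)[unfolded M_def]])
    then have "(LINT x|M. w x \<bullet> (b x *\<^sub>R gradient y x)) = L y" using \<phi>(3)[OF y] LIMSEQ_unique by blast
    then show ?thesis by (simp add: v_def)
  qed
  have div: "has_weak_div K v (\<lambda>_. c)"
    unfolding has_weak_div_def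
  proof (intro conjI allI impI vL constL)
    fix y assume y: "test_function K y"
    have "boundary_integral K (\<lambda>x. g x * y x) = 0"
      by (rule boundary_integral_outside[OF K]) (simp add: test_function_eq_0[OF y])
    then show "(LINT x|lebesgue_on K. v x \<bullet> gradient y x) = - (LINT x|lebesgue_on K. c * y x)"
      using v_weak[OF test_function_smooth[OF y]] L_eq[OF test_function_smooth[OF y]] by (simp add: M_def)
  qed
  have trace: "has_normal_trace K v g"
    unfolding has_normal_trace_def
  proof (intro exI[of _ "\<lambda>_. c"] conjI div allI impI)
    fix y assume y: "smooth_on UNIV y"
    show "(LINT x|lebesgue_on K. v x \<bullet> gradient y x) + (LINT x|lebesgue_on K. c * y x) = boundary_integral K (\<lambda>x. g x * y x)"
      using v_weak[OF y] L_eq[OF y] by (simp add: M_def)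
  qed
  have \<alpha>v: "AE x in lebesgue_on K. w x = \<alpha> x *\<^sub>R v x"
    using \<alpha> by eventually_elim (simp add: v_def b(5))
  have \<alpha>v_meas: "(\<lambda>x. \<alpha> x *\<^sub>R v x) \<in> borel_measurable (lebesgue_on K)"
    using w(1) by (intro borel_measurable_AE_lebesgue_on[OF _ _ \<alpha>v]) (auto simp: L2_on_def Kp(1) borel_open)
  have curl: "has_weak_curl K (\<lambda>x. \<alpha> x *\<^sub>R v x) (\<lambda>_. 0)"
    unfolding has_weak_curl_def
  proof (intro conjI allI impI)
    show "L2_on K (\<lambda>x. \<alpha> x *\<^sub>R v x)" by (rule L2_on_cong_AE[OF w(1) \<alpha>v_meas \<alpha>v])
    show "L2_on K (\<lambda>_. 0 :: real^3)" by (rule L2_on_zero)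
    fix \<psi> assume \<psi>: "test_field K \<psi>"
    have cL: "L2_on K (curl \<psi>)" by (intro L2_on_continuous Kp test_field_curl_continuous[OF \<psi>])
    have "(\<lambda>n. LINT x|M. gradient (\<phi> n) x \<bullet> curl \<psi> x) \<longlonglongrightarrow> (LINT x|M. w x \<bullet> curl \<psi> x)"
      unfolding M_def by (rule L2_inner_tendsto[OF gL[OF \<phi>(1)] w(1) cL w(2)[unfolded M_def]])
    then have "(LINT x|M. w x \<bullet> curl \<psi> x) = 0"
      unfolding M_def gradient_curl_orthogonal[OF Kp(2,1) \<phi>(1) \<psi>] using LIMSEQ_unique tendsto_const by blast
    moreover have "(LINT x|lebesgue_on K. (\<alpha> x *\<^sub>R v x) \<bullet> curl \<psi> x) = (LINT x|lebesgue_on K. w x \<bullet> curl \<psi> x)"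
    proof (rule integral_cong_AE)
      show "AE x in lebesgue_on K. (\<alpha> x *\<^sub>R v x) \<bullet> curl \<psi> x = w x \<bullet> curl \<psi> x"
        using \<alpha>v by eventually_elim simp
      have m: "w \<in> borel_measurable (lebesgue_on K)" "curl \<psi> \<in> borel_measurable (lebesgue_on K)"
        using w(1) cL by (auto simp: L2_on_def)
      show "(\<lambda>x. (\<alpha> x *\<^sub>R v x) \<bullet> curl \<psi> x) \<in> borel_measurable (lebesgue_on K)"
        by (rule borel_measurable_inner[OF \<alpha>v_meas m(2)])
      show "(\<lambda>x. w x \<bullet> curl \<psi> x) \<in> borel_measurable (lebesgue_on K)"
        by (rule borel_measurable_inner[OF m])
    qed
    ultimately show "(LINT x|lebesgue_on K. (\<alpha> x *\<^sub>R v x) \<bullet> curl \<psi> x) = (LINT x|lebesgue_on K. 0 \<bullet> \<psi> x)"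
      by (simp add: M_def)
  qed
  show ?thesis by (rule that[OF div trace curl])
qed

section \<open>Normal traces on the triangulated boundary\<close>

text \<open>Nondegeneracy of the triangle is inherited from the cone: its parametrisation is, up to
  translation, the slice of the injective map A on which the first coordinate is 0.\<close>

lemma facet_param:
  assumes K: "open_tetrahedron K" and G: "G facet_of closure K"
  obtains a b c where "G = convex hull {a, b, c}"
    "\<And>f. triangle_integral G f = norm (cross3 (b - a) (c - a)) * (LINT p|lebesgue_on std_triangle. f (affine_param a b c p))"
    "inj (affine_param a b c)" "cross3 (b - a) (c - a) \<noteq> 0"
proof -
  note Kp = open_tetrahedron_props[OF K]
  obtain P a0 b0 c0 where G0: "G = convex hull {a0, b0, c0}" "closure K = convex hull (insert P G)"
    using Kp(9)[OF G] by blast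
  obtain a b c where abc: "G = convex hull {a, b, c}"
    "\<And>f. triangle_integral G f = norm (cross3 (b - a) (c - a)) * (LINT p|lebesgue_on std_triangle. f (affine_param a b c p))"
    by (rule triangle_integral_param[OF G0(1)]) (rule that)
  define A where "A z = z$1 *\<^sub>R (a - P) + z$2 *\<^sub>R (b - a) + z$3 *\<^sub>R (c - a)" for z :: "real^3"
  have "interior (convex hull (insert P (convex hull {a, b, c}))) \<noteq> {}"
    using Kp(4,6) G0(2) abc(1) by simp
  note inj = nondegenerate_cone(2)[OF A_def this]
  have A_eq: "affine_param a b c w = a + A (coords (0, w))" for w by (simp add: affine_param_def A_def)
  have inj': "affine_param a b c w = affine_param a b c w' \<longleftrightarrow> w = w'" for w w'
    unfolding A_eq using inj_eq[OF inj, of "coords (0, w)" "coords (0, w')"]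
    by (auto simp: vec_eq_iff forall_3 prod_eq_iff)
  then have "inj (affine_param a b c)" by (simp add: inj_def)
  moreover have "cross3 (b - a) (c - a) \<noteq> 0"
  proof
    assume "cross3 (b - a) (c - a) = 0"
    then consider "b - a = 0" | "c - a = 0" | k where "c - a = k *\<^sub>R (b - a)"
      unfolding cross_eq_0 collinear_lemma by blast
    then show False
    proof cases
      case 1 then show False using inj'[of "(0, 0)" "(1, 0)"] by (simp add: affine_param_def)
    next
      case 2 then show False using inj'[of "(0, 0)" "(0, 1)"] by (simp add: affine_param_def)
    next
      case 3 then show False using inj'[of "(0, 0)" "(k, -1)"] by (simp add: affine_param_def)
    qed
  qed
  ultimately show ?thesis using that abc by blast
qed

section \<open>The triangulated boundary of a tetrahedron\<close>

locale triangulated_boundary =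
  fixes K :: "(real^3) set" and \<F> :: "(real^3) set set"
  assumes tet: "open_tetrahedron K"
    and simplex: "\<And>F. F \<in> \<F> \<Longrightarrow> 2 simplex F"
    and on_facet: "\<And>F. F \<in> \<F> \<Longrightarrow> \<exists>G. G facet_of closure K \<and> F \<subseteq> G"
    and tri: "\<And>G. G facet_of closure K \<Longrightarrow> triangulation {F\<in>\<F>. F \<subseteq> G}"
    and cover: "\<And>G. G facet_of closure K \<Longrightarrow> \<Union>{F\<in>\<F>. F \<subseteq> G} = G"
begin

lemmas Kp = open_tetrahedron_props[OF tet]

lemma finite_\<F>: "finite \<F>"
proof -
  have "\<F> \<subseteq> (\<Union>G\<in>{G. G facet_of closure K}. {F\<in>\<F>. F \<subseteq> G})" using on_facet by blast
  moreover have "finite (\<Union>G\<in>{G. G facet_of closure K}. {F\<in>\<F>. F \<subseteq> G})"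
    using Kp(8) tri by (intro finite_UN_I) (auto simp: triangulation_def)
  ultimately show ?thesis by (rule finite_subset)
qed

lemma triangle_props:
  assumes "F \<in> \<F>"
  shows "convex F" "closed F" "F \<noteq> {}" "aff_dim F = 2"
proof -
  obtain C where C: "\<not> affine_dependent C" "int (card C) = 2 + 1" "F = convex hull C"
    using simplex[OF assms] by (auto simp: simplex_def)
  then have "finite C" by (intro aff_independent_finite)
  then show "convex F" "closed F" "F \<noteq> {}" using C
    by (auto simp: compact_imp_closed compact_convex_hull finite_imp_compact)
  show "aff_dim F = 2" using C aff_dim_affine_independent[OF C(1)] by (simp add: aff_dim_convex_hull)
qed

text \<open>A face that meets the relative interior of a subset of the closed tetrahedron contains
  the whole subset. This settles which facets can contain a relative interior point of a
  triangle.\<close>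

lemma triangle_in_facet:
  assumes "F \<in> \<F>" "x \<in> rel_interior F" "x \<in> G" "G facet_of closure K"
  shows "F \<subseteq> G"
proof -
  obtain G' where "G' facet_of closure K" "F \<subseteq> G'" using on_facet[OF assms(1)] by blast
  then have "F \<subseteq> closure K" using facet_of_imp_subset by blast
  moreover have "G \<inter> rel_interior F \<noteq> {}" using assms(2,3) by blast
  ultimately show ?thesis by (rule subset_of_face_of[OF facet_of_imp_face_of[OF assms(4)]])
qed

text \<open>The triangulation property holds within one facet at a time, so both triangles are first
  placed in a common facet. There their intersection is a face of each, and a face containing a
  relative interior point is everything.\<close>

lemma rel_interior_disjoint:
  assumes F: "F \<in> \<F>" "F' \<in> \<F>" and x: "x \<in> rel_interior F" "x \<in> rel_interior F'"
  shows "F = F'"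
proof -
  obtain G where G: "G facet_of closure K" "F' \<subseteq> G" using on_facet[OF F(2)] by blast
  have "F \<subseteq> G" using x G rel_interior_subset by (intro triangle_in_facet[OF F(1) x(1) _ G(1)]) blast
  then have faces: "(F \<inter> F') face_of F" "(F' \<inter> F) face_of F'"
    using tri[OF G(1)] G(2) F by (auto simp: triangulation_def)
  have "x \<in> F" "x \<in> F'" using x rel_interior_subset by auto
  then have "F \<subseteq> F \<inter> F'" "F' \<subseteq> F' \<inter> F"
    using subset_of_face_of[OF faces(1) order_refl] subset_of_face_of[OF faces(2) order_refl] x by auto
  then show ?thesis by blast
qed

text \<open>A triangle has affine dimension 2 and three points span no more, so the two planes
  coincide. This recognises points of a facet close to a relative interior point of F as points of
  F.\<close>

lemma facet_affine_hull:
  assumes "F \<in> \<F>" "G facet_of closure K" "F \<subseteq> G" "G = convex hull {a, b, c}"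
  shows "affine hull F = affine hull {a, b, c}"
proof -
  have "aff_dim {a, b, c} \<le> int (card {a, b, c}) - 1" by (rule aff_dim_le_card) simp
  also have "\<dots> \<le> 2" using card_insert_le_m1[of 3 "{b, c}" a] card_insert_le_m1[of 2 "{c}" b] by simp
  finally have "aff_dim G \<le> 2" unfolding assms(4) by (simp add: aff_dim_convex_hull)
  moreover have "aff_dim F \<le> aff_dim G" by (rule aff_dim_subset[OF assms(3)])
  ultimately have "aff_dim F = aff_dim G" using triangle_props(4)[OF assms(1)] by simp
  then have "affine hull F = affine hull G" using aff_dim_eq_full_gen[OF assms(3)] by simp
  then show ?thesis using assms(4) by (simp add: affine_hull_convex_hull)
qed

lemma rel_interior_borel: "F \<in> \<F> \<Longrightarrow> rel_interior F \<in> sets borel"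
proof -
  assume "F \<in> \<F>"
  have "rel_interior F = closure F - rel_frontier F"
    using rel_interior_subset closure_subset by (auto simp: rel_frontier_def)
  then show ?thesis by simp
qed

text \<open>A canonical Borel function with prescribed values on the triangles. At most one summand
  is nonzero at any point, and the value 0 on the edges sits on a set without area.\<close>

definition piecewise :: "((real^3) set \<Rightarrow> real) \<Rightarrow> real^3 \<Rightarrow> real" where
  "piecewise c x = (\<Sum>F\<in>\<F>. c F * indicator (rel_interior F) x)"

lemma piecewise_eq:
  assumes "F \<in> \<F>" "x \<in> rel_interior F"
  shows "piecewise c x = c F"
proof -
  have "c F' * indicator (rel_interior F') x = (if F' = F then c F else 0)" if "F' \<in> \<F>" for F'
  proof (cases "x \<in> rel_interior F'")
    case True
    then have "F' = F" using rel_interior_disjoint[OF that assms(1) _ assms(2)] by simp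
    then show ?thesis using True by simp
  next
    case False
    then have "F' \<noteq> F" using assms(2) by blast
    then show ?thesis using False by simp
  qed
  then have "piecewise c x = (\<Sum>F'\<in>\<F>. if F' = F then c F else 0)"
    unfolding piecewise_def by (intro sum.cong) auto
  then show ?thesis using assms(1) finite_\<F> by simp
qed

lemma piecewise_Bf: "piecewise c \<in> Bf \<F>"
  unfolding Bf_def using piecewise_eq by blast

lemma piecewise_measurable: "piecewise c \<in> borel_measurable borel"
  unfolding piecewise_def using rel_interior_borel by (intro borel_measurable_sum borel_measurable_times) auto

lemma piecewise_bounded: "\<bar>piecewise c x\<bar> \<le> (\<Sum>F\<in>\<F>. \<bar>c F\<bar>)"
  unfolding piecewise_def
  by (intro order_trans[OF sum_abs] sum_mono) (auto simp: abs_mult indicator_def)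

text \<open>Pulled back to the parameter plane, the relative boundary of a triangle lies in the frontier of a
  convex set.\<close>

lemma AE_param_rel_interior:
  assumes G: "G facet_of closure K" "G = convex hull {a, b, c}" and inj: "inj (affine_param a b c)"
  shows "AE p in lebesgue_on std_triangle. \<exists>F\<in>\<F>. affine_param a b c p \<in> rel_interior F"
proof -
  let ?Y = "affine_param a b c"
  define L where "L w = fst w *\<^sub>R (b - a) + snd w *\<^sub>R (c - a)" for w :: "real \<times> real"
  have Y: "?Y w = a + L w" for w by (simp add: affine_param_def L_def)
  have linL: "linear L" unfolding L_def by (intro linearI) (auto simp: algebra_simps)
  have injL: "inj L" using inj by (auto simp: inj_def Y)
  have null: "negligible {p. ?Y p \<in> F - rel_interior F}" if F: "F \<in> \<F>" "F \<subseteq> G" for F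
  proof -
    define E where "E = {p. ?Y p \<in> F}"
    have F_eq: "F = ?Y ` E"
      using F(2) unfolding E_def G(2) affine_param_image[symmetric] by auto
    also have "\<dots> = (+) a ` (L ` E)" by (auto simp: Y image_image)
    finally have F_eq: "F = (+) a ` (L ` E)" .
    have "convex (L ` E)"
      using triangle_props(1)[OF F(1)] F_eq by (simp add: convex_translation_eq)
    then have "convex E" using convex_linear_vimage[OF linL, of "L ` E"] injL by (simp add: inj_vimage_image_eq)
    have "rel_interior F = (+) a ` (L ` rel_interior E)"
      unfolding F_eq using rel_interior_translation[of a "L ` E"] rel_interior_injective_linear_image[of L E] linL injL
      by (simp add: linear_conv_bounded_linear)
    then have "?Y p \<in> rel_interior F" if "p \<in> rel_interior E" for p using that by (auto simp: Y)
    then have "{p. ?Y p \<in> F - rel_interior F} \<subseteq> E - rel_interior E" by (auto simp: E_def)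
    also have "\<dots> \<subseteq> frontier E"
      using interior_subset_rel_interior[of E] closure_subset[of E] by (auto simp: frontier_def)
    finally show ?thesis using negligible_convex_frontier[OF \<open>convex E\<close>] negligible_subset by blast
  qed
  have "negligible (\<Union>F\<in>{F\<in>\<F>. F \<subseteq> G}. {p. ?Y p \<in> F - rel_interior F})"
    using finite_\<F> null by (intro negligible_Union) auto
  then have "AE p in lebesgue. p \<notin> (\<Union>F\<in>{F\<in>\<F>. F \<subseteq> G}. {p. ?Y p \<in> F - rel_interior F})"
    by (intro AE_not_in) (simp add: negligible_iff_null_sets)
  then have "AE p in lebesgue. p \<in> std_triangle \<longrightarrow> (\<exists>F\<in>\<F>. ?Y p \<in> rel_interior F)"
  proof eventually_elim
    case (elim p)
    show ?case
    proof
      assume "p \<in> std_triangle"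
      then have "?Y p \<in> G" unfolding G(2) affine_param_image[symmetric] by blast
      then obtain F where "F \<in> \<F>" "F \<subseteq> G" "?Y p \<in> F" using cover[OF G(1)] by blast
      with elim show "\<exists>F\<in>\<F>. ?Y p \<in> rel_interior F" by blast
    qed
  qed
  then show ?thesis using std_triangle_borel by (subst AE_lebesgue_on_iff) auto
qed

section \<open>Surface integrals over single triangles\<close>

lemma std_triangle_integrable:
  fixes f :: "real \<times> real \<Rightarrow> real"
  assumes "f \<in> borel_measurable borel" "\<And>p. p \<in> std_triangle \<Longrightarrow> \<bar>f p\<bar> \<le> C"
  shows "integrable (lebesgue_on std_triangle) f"
proof -
  interpret finite_measure "lebesgue_on std_triangle"
    by (rule finite_measure_lebesgue_on[OF bounded_std_triangle std_triangle_borel])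
  show ?thesis
    using assms(2) borel_measurable_lebesgue_onI[OF assms(1)]
    by (intro integrable_const_bound[where B = C]) (auto intro!: AE_I2)
qed

lemma continuous_on_std_triangle_bounded:
  fixes \<phi> :: "real^3 \<Rightarrow> real"
  assumes "continuous_on UNIV \<phi>"
  obtains C where "\<And>p. p \<in> std_triangle \<Longrightarrow> \<bar>\<phi> (affine_param a b c p)\<bar> \<le> C"
proof -
  have "compact std_triangle" using bounded_std_triangle closed_std_triangle by (simp add: compact_eq_bounded_closed)
  moreover have "continuous_on UNIV (\<lambda>p. \<phi> (affine_param a b c p))"
    by (rule continuous_on_compose2[OF assms continuous_affine_param]) simp
  ultimately have "compact ((\<lambda>p. \<phi> (affine_param a b c p)) ` std_triangle)"
    by (meson compact_continuous_image continuous_on_subset subset_UNIV)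
  from compact_imp_bounded[OF this] show ?thesis using that by (auto simp: bounded_iff)
qed

definition face_functional :: "(real^3) set \<Rightarrow> (real^3 \<Rightarrow> real) \<Rightarrow> real" where
  "face_functional F \<phi> = boundary_integral K (\<lambda>x. indicator (rel_interior F) x * \<phi> x)"

text \<open>Nothing is known about g on the edges, so measurability and integrability come from
  \<open>piecewise c\<close>, which agrees with g at almost every parameter; Lebesgue measure being
  complete, g inherits them.\<close>

lemma boundary_integral_piecewise:
  assumes g: "\<And>F x. F \<in> \<F> \<Longrightarrow> x \<in> rel_interior F \<Longrightarrow> g x = c F" and \<phi>: "continuous_on UNIV \<phi>"
  shows "boundary_integral K (\<lambda>x. g x * \<phi> x) = (\<Sum>F\<in>\<F>. c F * face_functional F \<phi>)"
proof -
  have tri_eq: "triangle_integral G (\<lambda>x. g x * \<phi> x) = (\<Sum>F\<in>\<F>. c F * triangle_integral G (\<lambda>x. indicator (rel_interior F) x * \<phi> x))"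
    if G: "G facet_of closure K" for G
  proof -
    obtain a b c' where abc: "G = convex hull {a, b, c'}"
      "\<And>f. triangle_integral G f = norm (cross3 (b - a) (c' - a)) * (LINT p|lebesgue_on std_triangle. f (affine_param a b c' p))"
      "inj (affine_param a b c')" "cross3 (b - a) (c' - a) \<noteq> 0"
      by (rule facet_param[OF tet G]) (rule that)
    let ?Y = "affine_param a b c'"
    obtain C where C: "\<And>p. p \<in> std_triangle \<Longrightarrow> \<bar>\<phi> (?Y p)\<bar> \<le> C"
      by (rule continuous_on_std_triangle_bounded[OF \<phi>, of a b c']) (rule that)
    have \<phi>Y: "(\<lambda>p. \<phi> (?Y p)) \<in> borel_measurable borel"
      by (intro borel_measurable_continuous_onI continuous_on_compose2[OF \<phi> continuous_affine_param]) simp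
    have indY: "(\<lambda>p. indicator (rel_interior F) (?Y p) :: real) \<in> borel_measurable borel" if "F \<in> \<F>" for F
      using measurable_compose[OF affine_param_measurable borel_measurable_indicator[of "rel_interior F" borel]]
        rel_interior_borel[OF that] by simp
    have int: "integrable (lebesgue_on std_triangle) (\<lambda>p. indicator (rel_interior F) (?Y p) * \<phi> (?Y p))" if "F \<in> \<F>" for F
      using C indY[OF that] \<phi>Y
      by (intro std_triangle_integrable[of _ C]) (auto simp: indicator_def intro: order_trans[OF abs_ge_zero])
    have pw: "(\<lambda>p. piecewise c (?Y p) * \<phi> (?Y p)) \<in> borel_measurable (lebesgue_on std_triangle)"
      using measurable_compose[OF affine_param_measurable piecewise_measurable] \<phi>Y
      by (intro borel_measurable_lebesgue_onI borel_measurable_times) auto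
    have ae: "AE p in lebesgue_on std_triangle. piecewise c (?Y p) * \<phi> (?Y p) = g (?Y p) * \<phi> (?Y p)"
      using AE_param_rel_interior[OF G abc(1,3)] by eventually_elim (use g piecewise_eq in auto)
    have "(LINT p|lebesgue_on std_triangle. g (?Y p) * \<phi> (?Y p)) = (LINT p|lebesgue_on std_triangle. piecewise c (?Y p) * \<phi> (?Y p))"
      using ae by (intro integral_cong_AE borel_measurable_AE_lebesgue_on[OF std_triangle_borel pw ae] pw) auto
    also have "\<dots> = (LINT p|lebesgue_on std_triangle. (\<Sum>F\<in>\<F>. c F * (indicator (rel_interior F) (?Y p) * \<phi> (?Y p))))"
      by (simp add: piecewise_def sum_distrib_right mult.assoc)
    also have "\<dots> = (\<Sum>F\<in>\<F>. c F * (LINT p|lebesgue_on std_triangle. indicator (rel_interior F) (?Y p) * \<phi> (?Y p)))"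
      using int by (simp add: Bochner_Integration.integral_sum)
    finally show ?thesis unfolding abc(2) by (simp add: sum_distrib_left mult.left_commute)
  qed
  have "boundary_integral K (\<lambda>x. g x * \<phi> x)
    = (\<Sum>G | G facet_of closure K. \<Sum>F\<in>\<F>. c F * triangle_integral G (\<lambda>x. indicator (rel_interior F) x * \<phi> x))"
    unfolding boundary_integral_def by (intro sum.cong refl tri_eq) simp
  also have "\<dots> = (\<Sum>F\<in>\<F>. c F * face_functional F \<phi>)"
    unfolding face_functional_def boundary_integral_def sum_distrib_left by (rule sum.swap)
  finally show ?thesis .
qed

lemma triangle_integral_cong:
  assumes G: "G facet_of closure K" and fg: "\<And>x. x \<in> G \<Longrightarrow> f x = g x"
  shows "triangle_integral G f = triangle_integral G g"
proof -
  obtain a b c where abc: "G = convex hull {a, b, c}"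
    "\<And>f. triangle_integral G f = norm (cross3 (b - a) (c - a)) * (LINT p|lebesgue_on std_triangle. f (affine_param a b c p))"
    "inj (affine_param a b c)" "cross3 (b - a) (c - a) \<noteq> 0"
    by (rule facet_param[OF tet G]) (rule that)
  have "f (affine_param a b c p) = g (affine_param a b c p)" if "p \<in> std_triangle" for p
    using that by (intro fg) (simp add: abc(1) flip: affine_param_image)
  then have "(LINT p|lebesgue_on std_triangle. f (affine_param a b c p)) = (LINT p|lebesgue_on std_triangle. g (affine_param a b c p))"
    by (intro Bochner_Integration.integral_cong) auto
  then show ?thesis unfolding abc(2) by simp
qed

text \<open>A bump around a relative interior point of F0 can be chosen so small that it meets the
  boundary of K only inside F0. It then isolates the coefficient of F0, whose factor is a positive
  integral.\<close>

lemma face_functional_separates: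
  assumes zero: "\<And>\<phi>. smooth_on UNIV \<phi> \<Longrightarrow> (\<Sum>F\<in>\<F>. c F * face_functional F \<phi>) = 0" and F0: "F0 \<in> \<F>"
  shows "c F0 = 0"
proof -
  obtain y0 where y0: "y0 \<in> rel_interior F0"
    using rel_interior_eq_empty[OF triangle_props(1)[OF F0]] triangle_props(3)[OF F0] by blast
  obtain T where T: "open T" "rel_interior F0 = affine hull F0 \<inter> T"
    using openin_rel_interior[of F0] by (auto simp: openin_open)
  \<comment> \<open>T cuts the relative interior of F0 out of its plane. Removing the facets that
    miss y0 ensures that every facet met by the box contains y0, hence contains F0 and lies in the
    plane of F0.\<close>
  define U where "U = T \<inter> (\<Inter>G\<in>{G. G facet_of closure K \<and> y0 \<notin> G}. - G)"
  have closed_facet: "closed G" if "G facet_of closure K" for G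
    using Kp(9)[OF that] by (auto simp: compact_imp_closed compact_convex_hull finite_imp_compact)
  have "open U" unfolding U_def
    using T(1) Kp(8) closed_facet by (intro open_Int open_INT) auto
  moreover have y0U: "y0 \<in> U" using y0 T(2) by (auto simp: U_def)
  ultimately obtain l u where lu: "cbox l u \<subseteq> U" "y0 \<in> box l u" by (rule open_contains_cbox)
  define \<phi> where "\<phi> = box_bump 0 l u"
  have \<phi>: "smooth_on UNIV \<phi>" "continuous_on UNIV \<phi>"
    using box_bump_smooth smooth_continuous by (auto simp: \<phi>_def)
  have \<phi>_nn: "0 \<le> \<phi> x" for x by (simp add: \<phi>_def box_bump_bounds)
  have \<phi>_pos: "\<phi> x \<noteq> 0 \<longleftrightarrow> x \<in> box l u" for x
    using box_bump_pos[of x l u 0] box_bump_eq_0[of x l u 0] by (auto simp: \<phi>_def)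
  have boxU: "box l u \<subseteq> U" using lu(1) box_subset_cbox by blast
  have F0G: "F0 \<subseteq> G" if "G facet_of closure K" "x \<in> G" "x \<in> box l u" for G x
  proof -
    have "y0 \<in> G" using that boxU by (auto simp: U_def)
    then show ?thesis using triangle_in_facet[OF F0 y0 _ that(1)] by blast
  qed
  have in_F0: "x \<in> rel_interior F0" if G: "G facet_of closure K" "x \<in> G" "x \<in> box l u" for G x
  proof -
    obtain a b c where abc: "G = convex hull {a, b, c}" using Kp(9)[OF G(1)] by blast
    have "x \<in> affine hull {a, b, c}" using G(2) abc convex_hull_subset_affine_hull by blast
    then have "x \<in> affine hull F0" using facet_affine_hull[OF F0 G(1) F0G[OF G] abc] by simp
    then show ?thesis using T(2) boxU G(3) by (auto simp: U_def)
  qed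
  have "face_functional F \<phi> = 0" if F: "F \<in> \<F>" "F \<noteq> F0" for F
    unfolding face_functional_def boundary_integral_def
  proof (intro sum.neutral ballI)
    fix G assume "G \<in> {G. G facet_of closure K}"
    then have G: "G facet_of closure K" by simp
    have "indicator (rel_interior F) x * \<phi> x = (0::real)" if "x \<in> G" for x
      using in_F0[OF G that] rel_interior_disjoint[OF F(1) F0, of x] F(2) \<phi>_pos[of x] by (auto simp: indicator_def)
    then have "triangle_integral G (\<lambda>x. indicator (rel_interior F) x * \<phi> x) = triangle_integral G (\<lambda>x. 0)"
      by (rule triangle_integral_cong[OF G])
    then show "triangle_integral G (\<lambda>x. indicator (rel_interior F) x * \<phi> x) = 0"
      by (simp add: triangle_integral_def case_prod_beta)
  qed
  then have "(\<Sum>F\<in>\<F>. c F * face_functional F \<phi>) = (\<Sum>F\<in>\<F>. if F = F0 then c F0 * face_functional F0 \<phi> else 0)"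
    by (intro sum.cong) auto
  then have cF0: "c F0 * face_functional F0 \<phi> = 0" using zero[OF \<phi>(1)] F0 finite_\<F> by simp
  have "face_functional F0 \<phi> = (\<Sum>G | G facet_of closure K. triangle_integral G \<phi>)"
    unfolding face_functional_def boundary_integral_def
  proof (intro sum.cong refl triangle_integral_cong)
    fix G x assume G: "G \<in> {G. G facet_of closure K}" and x: "x \<in> G"
    then show "indicator (rel_interior F0) x * \<phi> x = \<phi> x" using in_F0[of G x] \<phi>_pos[of x] by (auto simp: indicator_def)
  qed simp
  also have "\<dots> > 0"
  proof -
    obtain G where G: "G facet_of closure K" "F0 \<subseteq> G" using on_facet[OF F0] by blast
    have "0 < (\<Sum>G | G facet_of closure K. triangle_integral G \<phi>)"
    proof (rule sum_pos2)
      show "finite {G. G facet_of closure K}" by (rule Kp(8))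
      show "G \<in> {G. G facet_of closure K}" using G by simp
      show "0 \<le> triangle_integral G' \<phi>" for G'
        by (auto simp: triangle_integral_def case_prod_beta \<phi>_nn intro!: mult_nonneg_nonneg)
      obtain a b c where abc: "G = convex hull {a, b, c}"
        "\<And>f. triangle_integral G f = norm (cross3 (b - a) (c - a)) * (LINT p|lebesgue_on std_triangle. f (affine_param a b c p))"
        "inj (affine_param a b c)" "cross3 (b - a) (c - a) \<noteq> 0"
        by (rule facet_param[OF tet G(1)]) (rule that)
      let ?Y = "affine_param a b c"
      obtain C where C: "\<And>p. p \<in> std_triangle \<Longrightarrow> \<bar>\<phi> (?Y p)\<bar> \<le> C"
        by (rule continuous_on_std_triangle_bounded[OF \<phi>(2), of a b c]) (rule that)
      have cont: "continuous_on UNIV (\<lambda>p. \<phi> (?Y p))"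
        by (rule continuous_on_compose2[OF \<phi>(2) continuous_affine_param]) simp
      have int: "integrable (lebesgue_on std_triangle) (\<lambda>p. \<phi> (?Y p))"
        using C by (intro std_triangle_integrable[of _ C] borel_measurable_continuous_onI cont)
      have "(LINT p|lebesgue_on std_triangle. \<phi> (?Y p)) \<noteq> 0"
      proof
        assume "(LINT p|lebesgue_on std_triangle. \<phi> (?Y p)) = 0"
        then have "AE p in lebesgue_on std_triangle. \<phi> (?Y p) = 0"
          using integral_nonneg_eq_0_iff_AE[OF int] \<phi>_nn by simp
        then have ae: "AE p in lebesgue. p \<in> std_triangle \<longrightarrow> \<phi> (?Y p) = 0"
          using std_triangle_borel by (subst (asm) AE_lebesgue_on_iff) auto
        \<comment> \<open>The parameters where the bump is nonzero form a nonempty open set inside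
          the standard triangle. A vanishing integral would make this set negligible.\<close>
        define O1 where "O1 = {p. \<phi> (?Y p) \<noteq> 0}"
        have "open O1" unfolding O1_def by (intro open_Collect_neq cont continuous_on_const)
        have sub: "O1 \<subseteq> std_triangle"
        proof
          fix p assume "p \<in> O1"
          then have p: "?Y p \<in> box l u" by (simp add: O1_def \<phi>_pos)
          have "?Y p \<in> affine hull {a, b, c}"
            unfolding affine_hull_3 affine_param_def
            by (intro CollectI exI[of _ "1 - fst p - snd p"] exI[of _ "fst p"] exI[of _ "snd p"]) (auto simp: algebra_simps)
          then have "?Y p \<in> affine hull F0" using facet_affine_hull[OF F0 G abc(1)] by simp
          then have "?Y p \<in> rel_interior F0" using T(2) boxU p by (auto simp: U_def)
          then have "?Y p \<in> ?Y ` std_triangle"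
            using rel_interior_subset G(2) abc(1) by (auto simp: affine_param_image)
          then show "p \<in> std_triangle" using abc(3) by (simp add: inj_image_mem_iff)
        qed
        have "AE p in lebesgue. p \<notin> O1" using ae by eventually_elim (use sub in \<open>auto simp: O1_def\<close>)
        then have "negligible O1"
          using completion.AE_iff_null_sets by (simp add: negligible_iff_null_sets completion.AE_iff_null_sets)
        moreover have "O1 \<noteq> {}"
        proof -
          have "y0 \<in> G" using y0 G(2) rel_interior_subset by blast
          then obtain p where "y0 = ?Y p" unfolding abc(1) affine_param_image[symmetric] by blast
          then have "p \<in> O1" using lu(2) \<phi>_pos by (simp add: O1_def)
          then show ?thesis by blast
        qed
        ultimately show False using open_not_negligible \<open>open O1\<close> by blast
      qed
      moreover have "(LINT p|lebesgue_on std_triangle. \<phi> (?Y p)) \<ge> 0" by (simp add: \<phi>_nn)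
      ultimately show "0 < triangle_integral G \<phi>" unfolding abc(2) using abc(4) by (simp add: less_le)
    qed
    then show ?thesis .
  qed
  finally show ?thesis using cF0 by simp
qed

end

section \<open>Unisolvence\<close>

lemma has_weak_div_comb:
  assumes K: "bounded K" "open K" and u: "has_weak_div K u d" and v: "has_weak_div K v d'"
  shows "has_weak_div K (\<lambda>x. u x + s *\<^sub>R v x) (\<lambda>x. d x + s * d' x)"
proof -
  have L: "L2_on K u" "L2_on K d" "L2_on K v" "L2_on K d'" using u v by (auto simp: has_weak_div_def)
  have L': "L2_on K (\<lambda>x. u x + s *\<^sub>R v x)" "L2_on K (\<lambda>x. d x + s * d' x)"
    using L2_on_comb[OF L(1,3)] L2_on_comb[OF L(2,4), of s] by simp_all
  have "(LINT x|lebesgue_on K. (u x + s *\<^sub>R v x) \<bullet> gradient \<phi> x) = - (LINT x|lebesgue_on K. (d x + s * d' x) * \<phi> x)"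
    if \<phi>: "test_function K \<phi>" for \<phi>
  proof -
    have P: "L2_on K (gradient \<phi>)" "L2_on K \<phi>"
      using test_function_smooth[OF \<phi>]
      by (auto intro: L2_on_continuous K smooth_continuous smooth_gradient_continuous)
    have int: "integrable (lebesgue_on K) (\<lambda>x. u x \<bullet> gradient \<phi> x)" "integrable (lebesgue_on K) (\<lambda>x. v x \<bullet> gradient \<phi> x)"
      "integrable (lebesgue_on K) (\<lambda>x. d x * \<phi> x)" "integrable (lebesgue_on K) (\<lambda>x. d' x * \<phi> x)"
      using L2_on_inner_integrable[OF L(1) P(1)] L2_on_inner_integrable[OF L(3) P(1)]
        L2_on_inner_integrable[OF L(2) P(2)] L2_on_inner_integrable[OF L(4) P(2)] by simp_all
    then show ?thesis using u v \<phi>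
      by (simp add: has_weak_div_def inner_add_left distrib_right mult.assoc)
  qed
  with L' show ?thesis by (simp add: has_weak_div_def)
qed

lemma has_weak_curl_comb:
  assumes K: "bounded K" "open K" and u: "has_weak_curl K u (\<lambda>_. 0)" and v: "has_weak_curl K v (\<lambda>_. 0)"
  shows "has_weak_curl K (\<lambda>x. u x + s *\<^sub>R v x) (\<lambda>_. 0)"
proof -
  have L: "L2_on K u" "L2_on K v" using u v by (auto simp: has_weak_curl_def)
  have "(LINT x|lebesgue_on K. (u x + s *\<^sub>R v x) \<bullet> curl \<psi> x) = 0" if \<psi>: "test_field K \<psi>" for \<psi>
  proof -
    have P: "L2_on K (curl \<psi>)" by (intro L2_on_continuous K test_field_curl_continuous[OF \<psi>])
    show ?thesis using u v \<psi> L2_on_inner_integrable[OF L(1) P] L2_on_inner_integrable[OF L(2) P]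
      by (simp add: has_weak_curl_def inner_add_left)
  qed
  then show ?thesis using L2_on_comb[OF L] by (simp add: has_weak_curl_def L2_on_zero)
qed

text \<open>The divergence in the trace condition is existentially quantified; uniqueness identifies
  it with the constant divergence of the space.\<close>

lemma weak_div_unique:
  assumes K: "bounded K" "open K" and d: "has_weak_div K v d" "has_weak_div K v d'"
  shows "AE x in lebesgue_on K. d x = d' x"
proof -
  have L: "L2_on K d" "L2_on K d'" using d by (auto simp: has_weak_div_def)
  have one: "L2_on K (\<lambda>x. 1 :: real)" by (intro L2_on_continuous K continuous_on_const)
  have "AE x in lebesgue_on K. d x - d' x = 0"
  proof (rule fundamental_lemma[OF K(2)])
    show "integrable (lebesgue_on K) (\<lambda>x. d x - d' x)"
      using L2_on_inner_integrable[OF L2_on_diff[OF L] one] by simp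
    fix \<phi> assume \<phi>: "test_function K \<phi>"
    have P: "L2_on K \<phi>" by (intro L2_on_continuous K smooth_continuous test_function_smooth[OF \<phi>])
    show "(LINT x|lebesgue_on K. (d x - d' x) * \<phi> x) = 0"
      using d \<phi> L2_on_inner_integrable[OF L(1) P] L2_on_inner_integrable[OF L(2) P]
      by (simp add: has_weak_div_def left_diff_distrib)
  qed
  then show ?thesis by eventually_elim simp
qed

section \<open>Normal traces as coefficient vectors\<close>

context triangulated_boundary
begin

text \<open>The normal trace is recorded by its coefficients instead of by a function. Fluxes
  combine linearly, whereas trace functions carry arbitrary values on the edges.\<close>

definition flux :: "(real^3 \<Rightarrow> real^3) \<Rightarrow> ((real^3) set \<Rightarrow> real) \<Rightarrow> bool" where
  "flux v c \<longleftrightarrow> (\<exists>d. has_weak_div K v d \<and> (\<forall>\<phi>. smooth_on UNIV \<phi> \<longrightarrow>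
     (LINT x|lebesgue_on K. v x \<bullet> gradient \<phi> x) + (LINT x|lebesgue_on K. d x * \<phi> x)
       = (\<Sum>F\<in>\<F>. c F * face_functional F \<phi>)))"

lemma has_normal_trace_iff_flux:
  assumes "\<And>F x. F \<in> \<F> \<Longrightarrow> x \<in> rel_interior F \<Longrightarrow> g x = c F"
  shows "has_normal_trace K v g \<longleftrightarrow> flux v c"
  using boundary_integral_piecewise[of g c, OF assms] smooth_continuous[of UNIV]
  by (auto simp: has_normal_trace_def flux_def)

lemma Bf_values:
  assumes "g \<in> Bf \<F>"
  obtains c where "\<And>F x. F \<in> \<F> \<Longrightarrow> x \<in> rel_interior F \<Longrightarrow> g x = c F"
proof -
  have "\<forall>F\<in>\<F>. \<exists>c. \<forall>x\<in>rel_interior F. g x = c" using assms by (simp add: Bf_def)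
  from bchoice[OF this] show ?thesis using that by blast
qed

lemma flux_iff_ex_trace: "(\<exists>g\<in>Bf \<F>. has_normal_trace K v g) \<longleftrightarrow> (\<exists>c. flux v c)"
proof
  assume "\<exists>g\<in>Bf \<F>. has_normal_trace K v g"
  then obtain g where g: "g \<in> Bf \<F>" "has_normal_trace K v g" by blast
  obtain c where "\<And>F x. F \<in> \<F> \<Longrightarrow> x \<in> rel_interior F \<Longrightarrow> g x = c F" by (rule Bf_values[OF g(1)]) (rule that)
  then show "\<exists>c. flux v c" using has_normal_trace_iff_flux[of g c v] g(2) by blast
next
  assume "\<exists>c. flux v c"
  then obtain c where "flux v c" by blast
  then have "has_normal_trace K v (piecewise c)"
    using has_normal_trace_iff_flux[of "piecewise c" c v] piecewise_eq by blast
  then show "\<exists>g\<in>Bf \<F>. has_normal_trace K v g" using piecewise_Bf by blast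
qed

lemma flux_comb:
  assumes u: "flux u c" and v: "flux v c'"
  shows "flux (\<lambda>x. u x + s *\<^sub>R v x) (\<lambda>F. c F + s * c' F)"
proof -
  obtain d where d: "has_weak_div K u d" "\<And>\<phi>. smooth_on UNIV \<phi> \<Longrightarrow>
     (LINT x|lebesgue_on K. u x \<bullet> gradient \<phi> x) + (LINT x|lebesgue_on K. d x * \<phi> x) = (\<Sum>F\<in>\<F>. c F * face_functional F \<phi>)"
    using u by (auto simp: flux_def)
  obtain d' where d': "has_weak_div K v d'" "\<And>\<phi>. smooth_on UNIV \<phi> \<Longrightarrow>
     (LINT x|lebesgue_on K. v x \<bullet> gradient \<phi> x) + (LINT x|lebesgue_on K. d' x * \<phi> x) = (\<Sum>F\<in>\<F>. c' F * face_functional F \<phi>)"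
    using v by (auto simp: flux_def)
  have L: "L2_on K u" "L2_on K d" "L2_on K v" "L2_on K d'" using d(1) d'(1) by (auto simp: has_weak_div_def)
  have "(LINT x|lebesgue_on K. (u x + s *\<^sub>R v x) \<bullet> gradient \<phi> x) + (LINT x|lebesgue_on K. (d x + s * d' x) * \<phi> x)
     = (\<Sum>F\<in>\<F>. (c F + s * c' F) * face_functional F \<phi>)" if \<phi>: "smooth_on UNIV \<phi>" for \<phi>
  proof -
    have P: "L2_on K (gradient \<phi>)" "L2_on K \<phi>"
      using \<phi> by (auto intro: L2_on_continuous Kp smooth_continuous smooth_gradient_continuous)
    have int: "integrable (lebesgue_on K) (\<lambda>x. u x \<bullet> gradient \<phi> x)" "integrable (lebesgue_on K) (\<lambda>x. v x \<bullet> gradient \<phi> x)"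
      "integrable (lebesgue_on K) (\<lambda>x. d x * \<phi> x)" "integrable (lebesgue_on K) (\<lambda>x. d' x * \<phi> x)"
      using L2_on_inner_integrable[OF L(1) P(1)] L2_on_inner_integrable[OF L(3) P(1)]
        L2_on_inner_integrable[OF L(2) P(2)] L2_on_inner_integrable[OF L(4) P(2)] by simp_all
    have "(LINT x|lebesgue_on K. (u x + s *\<^sub>R v x) \<bullet> gradient \<phi> x) + (LINT x|lebesgue_on K. (d x + s * d' x) * \<phi> x)
      = ((LINT x|lebesgue_on K. u x \<bullet> gradient \<phi> x) + (LINT x|lebesgue_on K. d x * \<phi> x))
        + s * ((LINT x|lebesgue_on K. v x \<bullet> gradient \<phi> x) + (LINT x|lebesgue_on K. d' x * \<phi> x))"
      using int by (simp add: inner_add_left distrib_right distrib_left mult.assoc)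
    then show ?thesis unfolding d(2)[OF \<phi>] d'(2)[OF \<phi>]
      by (simp add: distrib_right sum.distrib sum_distrib_left mult.assoc)
  qed
  then show ?thesis using has_weak_div_comb[OF Kp(2,1) d(1) d'(1)] unfolding flux_def by blast
qed

text \<open>This makes coefficients well defined up to null sets: a field that vanishes almost
  everywhere has divergence zero almost everywhere, so its combination of face functionals vanishes
  and the separation lemma applies.\<close>

lemma flux_zero_field:
  assumes "AE x in lebesgue_on K. v x = 0" "L2_on K v" "flux v c" "F \<in> \<F>"
  shows "c F = 0"
proof -
  obtain d where d: "has_weak_div K v d" "\<And>\<phi>. smooth_on UNIV \<phi> \<Longrightarrow>
     (LINT x|lebesgue_on K. v x \<bullet> gradient \<phi> x) + (LINT x|lebesgue_on K. d x * \<phi> x) = (\<Sum>F\<in>\<F>. c F * face_functional F \<phi>)"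
    using assms(3) by (auto simp: flux_def)
  have v0: "(LINT x|lebesgue_on K. v x \<bullet> gradient \<phi> x) = 0" for \<phi>
  proof -
    have "AE x in lebesgue_on K. v x \<bullet> gradient \<phi> x = 0" using assms(1) by eventually_elim simp
    then show ?thesis by (rule integral_eq_zero_AE)
  qed
  have "has_weak_div K v (\<lambda>_. 0)" unfolding has_weak_div_def using assms(2) v0 by (simp add: L2_on_zero)
  from weak_div_unique[OF Kp(2,1) d(1) this] have d0: "AE x in lebesgue_on K. d x = 0" .
  show ?thesis
  proof (rule face_functional_separates[OF _ assms(4)])
    fix \<phi> :: "real^3 \<Rightarrow> real" assume \<phi>: "smooth_on UNIV \<phi>"
    have "AE x in lebesgue_on K. d x * \<phi> x = 0" using d0 by eventually_elim simp
    then have "(LINT x|lebesgue_on K. d x * \<phi> x) = 0" by (rule integral_eq_zero_AE)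
    then show "(\<Sum>F\<in>\<F>. c F * face_functional F \<phi>) = 0" using d(2)[OF \<phi>] v0 by simp
  qed
qed

lemma flux_L2: "flux v c \<Longrightarrow> L2_on K v"
  by (auto simp: flux_def has_weak_div_def)

lemma flux_cong_AE:
  assumes uv: "AE x in lebesgue_on K. u x = v x" and u: "flux u c" and v: "flux v c'" and F: "F \<in> \<F>"
  shows "c F = c' F"
proof -
  have fl: "flux (\<lambda>x. u x + (-1) *\<^sub>R v x) (\<lambda>F. c F + (-1) * c' F)" by (rule flux_comb[OF u v])
  have "AE x in lebesgue_on K. u x + (-1) *\<^sub>R v x = 0" using uv by eventually_elim simp
  from flux_zero_field[OF this flux_L2[OF fl] fl F] show ?thesis by simp
qed

text \<open>It discharges the definite description in \<open>dof\<close>: \<open>piecewise c\<close>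
  witnesses existence, and any other trace function of v yields a flux of the same field, so the
  coefficients agree. Nonemptiness of the relative interior lets the value of the function be
  read.\<close>

lemma dof_eq:
  assumes v: "flux v c" and F: "F \<in> \<F>"
  shows "dof K \<F> F v = c F"
  unfolding dof_def
proof (rule the_equality)
  have "has_normal_trace K v (piecewise c)"
    using has_normal_trace_iff_flux[of "piecewise c" c v] piecewise_eq v by blast
  then show "\<exists>g\<in>Bf \<F>. has_normal_trace K v g \<and> (\<forall>x\<in>rel_interior F. g x = c F)"
    using piecewise_Bf piecewise_eq[OF F] by blast
next
  fix c0 assume "\<exists>g\<in>Bf \<F>. has_normal_trace K v g \<and> (\<forall>x\<in>rel_interior F. g x = c0)"
  then obtain g where g: "g \<in> Bf \<F>" "has_normal_trace K v g" "\<And>x. x \<in> rel_interior F \<Longrightarrow> g x = c0" by blast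
  obtain c1 where c1: "\<And>F x. F \<in> \<F> \<Longrightarrow> x \<in> rel_interior F \<Longrightarrow> g x = c1 F" by (rule Bf_values[OF g(1)]) (rule that)
  then have "flux v c1" using has_normal_trace_iff_flux[of g c1 v] g(2) by blast
  then have "c1 F = c F" by (rule flux_cong_AE[OF AE_I2[OF refl] _ v F])
  moreover obtain x where "x \<in> rel_interior F"
    using rel_interior_eq_empty[OF triangle_props(1)[OF F]] triangle_props(3)[OF F] by blast
  ultimately show "c0 = c F" using g(3) c1[OF F] by metis
qed

lemma Vf_iff: "v \<in> Vf \<alpha> K \<F> \<longleftrightarrow>
  (\<exists>c. has_weak_div K v (\<lambda>_. c)) \<and> (\<exists>c. flux v c) \<and> has_weak_curl K (\<lambda>x. \<alpha> x *\<^sub>R v x) (\<lambda>_. 0)"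
  unfolding Vf_def Hdiv_def Hcurl_def flux_iff_ex_trace[symmetric] by blast

lemma Vf_comb:
  assumes "u \<in> Vf \<alpha> K \<F>" "v \<in> Vf \<alpha> K \<F>"
  shows "(\<lambda>x. u x + s *\<^sub>R v x) \<in> Vf \<alpha> K \<F>"
proof -
  obtain c1 c2 where c: "has_weak_div K u (\<lambda>_. c1)" "has_weak_div K v (\<lambda>_. c2)" using assms by (auto simp: Vf_iff)
  obtain f1 f2 where f: "flux u f1" "flux v f2" using assms by (auto simp: Vf_iff)
  have w: "has_weak_curl K (\<lambda>x. \<alpha> x *\<^sub>R u x) (\<lambda>_. 0)" "has_weak_curl K (\<lambda>x. \<alpha> x *\<^sub>R v x) (\<lambda>_. 0)"
    using assms by (auto simp: Vf_iff)
  have "has_weak_curl K (\<lambda>x. \<alpha> x *\<^sub>R u x + s *\<^sub>R (\<alpha> x *\<^sub>R v x)) (\<lambda>_. 0)" by (rule has_weak_curl_comb[OF Kp(2,1) w])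
  then have "has_weak_curl K (\<lambda>x. \<alpha> x *\<^sub>R (u x + s *\<^sub>R v x)) (\<lambda>_. 0)"
    by (simp add: scaleR_add_right mult.commute)
  then show ?thesis unfolding Vf_iff using has_weak_div_comb[OF Kp(2,1) c, of s] flux_comb[OF f, of s] by blast
qed

lemma Vf_zero_flux:
  assumes v: "v \<in> Vf \<alpha> K \<F>" and c: "flux v c" "\<And>F. F \<in> \<F> \<Longrightarrow> c F = 0"
    and \<alpha>: "AE x in lebesgue_on K. lo \<le> \<alpha> x" and lo: "0 < lo"
  shows "AE x in lebesgue_on K. v x = 0"
proof -
  obtain k where k: "has_weak_div K v (\<lambda>_. k)" using v by (auto simp: Vf_iff)
  have w: "has_weak_curl K (\<lambda>x. \<alpha> x *\<^sub>R v x) (\<lambda>_. 0)" using v by (simp add: Vf_iff)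
  have L: "L2_on K v" "L2_on K (\<lambda>x. \<alpha> x *\<^sub>R v x)" using k w by (auto simp: has_weak_div_def has_weak_curl_def)
  obtain d where d: "has_weak_div K v d" "\<And>\<phi>. smooth_on UNIV \<phi> \<Longrightarrow>
     (LINT x|lebesgue_on K. v x \<bullet> gradient \<phi> x) + (LINT x|lebesgue_on K. d x * \<phi> x) = (\<Sum>F\<in>\<F>. c F * face_functional F \<phi>)"
    using c(1) by (auto simp: flux_def)
  have d0: "(LINT x|lebesgue_on K. v x \<bullet> gradient \<phi> x) + (LINT x|lebesgue_on K. d x * \<phi> x) = 0" if "smooth_on UNIV \<phi>" for \<phi>
    using d(2)[OF that] c(2) by simp
  have ae: "AE x in lebesgue_on K. d x = k" by (rule weak_div_unique[OF Kp(2,1) d(1) k])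
  have dm: "d \<in> borel_measurable (lebesgue_on K)" using d(1) by (auto simp: has_weak_div_def L2_on_def)
  have dk: "(LINT x|lebesgue_on K. d x * \<phi> x) = (LINT x|lebesgue_on K. k * \<phi> x)" if "smooth_on UNIV \<phi>" for \<phi>
  proof (rule integral_cong_AE)
    have m: "\<phi> \<in> borel_measurable (lebesgue_on K)"
      by (intro borel_measurable_lebesgue_onI borel_measurable_continuous_onI smooth_continuous that)
    show "(\<lambda>x. d x * \<phi> x) \<in> borel_measurable (lebesgue_on K)" "(\<lambda>x. k * \<phi> x) \<in> borel_measurable (lebesgue_on K)"
      using m dm by auto
    show "AE x in lebesgue_on K. d x * \<phi> x = k * \<phi> x" using ae by eventually_elim simp
  qed
  \<comment> \<open>Testing with the constant function 1 is the divergence theorem: zero total flux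
    forces a constant divergence to vanish.\<close>
  have "k = 0"
  proof -
    have grad0: "gradient (\<lambda>x. 1) x = 0" for x by (simp add: vec_eq_iff)
    have "(LINT x|lebesgue_on K. k * 1) = 0" using d0[OF smooth_const, of 1] dk[OF smooth_const, of 1] by (simp add: grad0)
    moreover have "(LINT x|lebesgue_on K. k * 1) = measure lebesgue K * k"
      using Kp(1) by (simp add: measure_restrict_space)
    moreover have "measure lebesgue K \<noteq> 0"
      using open_not_negligible[OF Kp(1,4)] lmeasurable_open[OF Kp(2,1)] by (simp add: negligible_iff_measure)
    ultimately show ?thesis by (metis mult_eq_0_iff)
  qed
  then have orth: "(LINT x|lebesgue_on K. v x \<bullet> gradient \<phi> x) = 0" if "smooth_on UNIV \<phi>" for \<phi>
    using d0[OF that] dk[OF that] by simp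
  have "(LINT x|lebesgue_on K. v x \<bullet> (\<alpha> x *\<^sub>R v x)) = 0"
    by (rule curl_free_orthogonal[OF Kp(2,1,3,4) L(1) w orth])
  moreover have nn: "AE x in lebesgue_on K. 0 \<le> v x \<bullet> (\<alpha> x *\<^sub>R v x)"
    using \<alpha> by eventually_elim (use lo in simp)
  ultimately have "AE x in lebesgue_on K. v x \<bullet> (\<alpha> x *\<^sub>R v x) = 0"
    using integral_nonneg_eq_0_iff_AE[OF L2_on_inner_integrable[OF L] nn] by simp
  with \<alpha> show ?thesis by eventually_elim (use lo in auto)
qed

text \<open>Solvability of the Neumann problem for arbitrary coefficients makes the functionals
  independent; uniqueness makes them span, because a field is determined almost everywhere by its
  fluxes and a functional in the dual respects this equality.\<close>

lemma unisolvent_Vf: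
  fixes \<alpha> a :: "real^3 \<Rightarrow> real"
  assumes a: "a \<in> borel_measurable borel" "\<And>x. lo \<le> a x" "\<And>x. a x \<le> hi" "0 < lo"
    and \<alpha>: "AE x in lebesgue_on K. \<alpha> x = a x"
  shows "unisolvent K (Vf \<alpha> K \<F>) \<F> (dof K \<F>)"
proof -
  let ?V = "Vf \<alpha> K \<F>"
  have \<alpha>_lo: "AE x in lebesgue_on K. lo \<le> \<alpha> x" using \<alpha> by eventually_elim (simp add: a(2))
  have solve: "\<exists>v\<in>?V. flux v c" for c
  proof -
    obtain v k where v: "has_weak_div K v (\<lambda>_. k)" "has_normal_trace K v (piecewise c)" "has_weak_curl K (\<lambda>x. \<alpha> x *\<^sub>R v x) (\<lambda>_. 0)"
      by (rule neumann_solution[OF tet a \<alpha> piecewise_measurable piecewise_bounded]) (rule that)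
    have "flux v c" using has_normal_trace_iff_flux[of "piecewise c" c v] piecewise_eq v(2) by blast
    moreover from this v have "v \<in> ?V" unfolding Vf_iff by blast
    ultimately show ?thesis by blast
  qed
  have ex_flux: "\<exists>c. flux v c" if "v \<in> ?V" for v using that by (simp add: Vf_iff)
  have zero_V: "(\<lambda>x. 0) \<in> ?V"
  proof -
    obtain v where "v \<in> ?V" using solve by blast
    from Vf_comb[OF this this, of "-1"] show ?thesis by simp
  qed
  have dual: "dof K \<F> F \<in> dual_space K ?V" if F: "F \<in> \<F>" for F
    unfolding dual_space_def
  proof (intro CollectI conjI ballI allI impI)
    fix u v assume u: "u \<in> ?V" and v: "v \<in> ?V"
    obtain c1 c2 where c: "flux u c1" "flux v c2" using ex_flux u v by blast
    show "dof K \<F> F (\<lambda>x. u x + v x) = dof K \<F> F u + dof K \<F> F v"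
      using dof_eq[OF flux_comb[OF c, of 1] F] dof_eq[OF c(1) F] dof_eq[OF c(2) F] by simp
    show "dof K \<F> F u = dof K \<F> F v" if "AE x in lebesgue_on K. u x = v x"
      using flux_cong_AE[OF that c F] dof_eq[OF c(1) F] dof_eq[OF c(2) F] by simp
  next
    fix s v assume v: "v \<in> ?V"
    obtain c where c: "flux v c" using ex_flux v by blast
    \<comment> \<open>Scaling is obtained from the closure under \<open>u + s v\<close> by adding (s
      - 1) times the field to itself.\<close>
    have "flux (\<lambda>x. v x + (s - 1) *\<^sub>R v x) (\<lambda>F. c F + (s - 1) * c F)" by (rule flux_comb[OF c c])
    then have "flux (\<lambda>x. s *\<^sub>R v x) (\<lambda>F. s * c F)" by (simp add: algebra_simps)
    from dof_eq[OF this F] dof_eq[OF c F] show "dof K \<F> F (\<lambda>x. s *\<^sub>R v x) = s * dof K \<F> F v" by simp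
  qed
  have indep: "\<forall>F\<in>\<F>. c F = 0" if c: "\<forall>v\<in>?V. (\<Sum>F\<in>\<F>. c F * dof K \<F> F v) = 0" for c
  proof -
    obtain v where v: "v \<in> ?V" "flux v c" using solve by blast
    \<comment> \<open>The vanishing combination is evaluated at the field whose fluxes are its own
      coefficients, which gives a sum of squares.\<close>
    have "(\<Sum>F\<in>\<F>. c F * c F) = (\<Sum>F\<in>\<F>. c F * dof K \<F> F v)" using dof_eq[OF v(2)] by simp
    then have "(\<Sum>F\<in>\<F>. c F * c F) = 0" using c v(1) by simp
    then show ?thesis using finite_\<F> by (simp add: sum_nonneg_eq_0_iff)
  qed
  have span: "\<exists>c. \<forall>v\<in>?V. l v = (\<Sum>F\<in>\<F>. c F * dof K \<F> F v)" if l: "l \<in> dual_space K ?V" for l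
  proof -
    note D = l[unfolded dual_space_def, THEN CollectD]
    have l_add: "l (\<lambda>x. u x + v x) = l u + l v" if "u \<in> ?V" "v \<in> ?V" for u v
      using bspec[OF bspec[OF D[THEN conjunct1] that(1)] that(2)] .
    have l_AE: "(AE x in lebesgue_on K. u x = v x) \<Longrightarrow> l u = l v" if "u \<in> ?V" "v \<in> ?V" for u v
      using bspec[OF bspec[OF D[THEN conjunct2, THEN conjunct2] that(1)] that(2)] by (rule mp)
    have l_scale: "l (\<lambda>x. s *\<^sub>R v x) = s * l v" if "v \<in> ?V" for s v
      using bspec[OF spec[OF D[THEN conjunct2, THEN conjunct1], of s] that] .
    have l_comb: "l (\<lambda>x. u x + s *\<^sub>R v x) = l u + s * l v" if "u \<in> ?V" "v \<in> ?V" for s u v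
    proof -
      have "(\<lambda>x. s *\<^sub>R v x) \<in> ?V" using Vf_comb[OF zero_V that(2), of s] by simp
      then show ?thesis using l_add[OF that(1)] l_scale[OF that(2)] by simp
    qed
    have l_zero: "l (\<lambda>x. 0) = 0" using l_scale[OF zero_V, of 0] by simp
    have "\<forall>F. \<exists>v. v \<in> ?V \<and> flux v (\<lambda>F'. if F' = F then 1 else 0)" using solve by blast
    then obtain e where e: "\<And>F. e F \<in> ?V" "\<And>F. flux (e F) (\<lambda>F'. if F' = F then 1 else 0)"
      using choice by metis
    \<comment> \<open>A field minus itself; any index serves, and \<open>undefined\<close> works
      also when there are no triangles.\<close>
    have flux_zero: "flux (\<lambda>x. 0) (\<lambda>F. 0)"
      using flux_comb[OF e(2) e(2), of undefined "-1" undefined] by simp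
    have combination: "(\<lambda>x. \<Sum>F\<in>A. c F *\<^sub>R e F x) \<in> ?V \<and> l (\<lambda>x. \<Sum>F\<in>A. c F *\<^sub>R e F x) = (\<Sum>F\<in>A. c F * l (e F))
      \<and> flux (\<lambda>x. \<Sum>F\<in>A. c F *\<^sub>R e F x) (\<lambda>F. if F \<in> A then c F else 0)" if "finite A" for A c
      using that
    proof (induction A rule: finite_induct)
      case empty
      then show ?case using zero_V l_zero flux_zero by simp
    next
      case (insert F A)
      define u where "u x = (\<Sum>F\<in>A. c F *\<^sub>R e F x)" for x
      have u: "u \<in> ?V" "l u = (\<Sum>F\<in>A. c F * l (e F))" "flux u (\<lambda>F. if F \<in> A then c F else 0)"
        using insert.IH by (auto simp: u_def[abs_def])
      have eq: "(\<lambda>x. \<Sum>F\<in>insert F A. c F *\<^sub>R e F x) = (\<lambda>x. u x + c F *\<^sub>R e F x)"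
        using insert.hyps by (auto simp: u_def add.commute)
      have "flux (\<lambda>x. u x + c F *\<^sub>R e F x) (\<lambda>F'. (if F' \<in> A then c F' else 0) + c F * (if F' = F then 1 else 0))"
        by (rule flux_comb[OF u(3) e(2)])
      also have "(\<lambda>F'. (if F' \<in> A then c F' else 0) + c F * (if F' = F then 1 else 0)) = (\<lambda>F'. if F' \<in> insert F A then c F' else 0)"
        using insert.hyps by auto
      finally show ?case unfolding eq
        using Vf_comb[OF u(1) e(1)] l_comb[OF u(1) e(1), of "c F" F] u(2) insert.hyps by (simp add: add.commute)
    qed
    have "l v = (\<Sum>F\<in>\<F>. l (e F) * dof K \<F> F v)" if v: "v \<in> ?V" for v
    proof -
      obtain c where c: "flux v c" using ex_flux v by blast
      define u where "u x = (\<Sum>F\<in>\<F>. c F *\<^sub>R e F x)" for x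
      have u: "u \<in> ?V" "l u = (\<Sum>F\<in>\<F>. c F * l (e F))" "flux u (\<lambda>F. if F \<in> \<F> then c F else 0)"
        using combination[OF finite_\<F>, of c] by (auto simp: u_def[abs_def])
      \<comment> \<open>u reproduces the fluxes of v from the unit fields, so their difference has
        zero fluxes and vanishes almost everywhere.\<close>
      have "AE x in lebesgue_on K. v x + (-1) *\<^sub>R u x = 0"
        by (rule Vf_zero_flux[OF Vf_comb[OF v u(1)] flux_comb[OF c u(3)] _ \<alpha>_lo a(4)]) simp
      then have "AE x in lebesgue_on K. v x = u x" by eventually_elim simp
      then have "l v = (\<Sum>F\<in>\<F>. c F * l (e F))" using l_AE[OF v u(1)] u(2) by simp
      then show ?thesis using dof_eq[OF c] by (simp add: mult.commute)
    qed
    then show ?thesis by (intro exI[of _ "\<lambda>F. l (e F)"]) blast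
  qed
  show ?thesis unfolding unisolvent_def using finite_\<F> dual indep span by blast
qed

end

section \<open>Application to an interface element\<close>

theorem lemma5p4:
  fixes \<Omega> \<Omega>m K :: "(real^3) set"
    and \<alpha> :: "real^3 \<Rightarrow> real"
    and \<alpha>p \<alpha>m \<sigma> \<theta> C :: real
    and \<T> \<F> :: "(real^3) set set"
  assumes "open \<Omega>" "connected \<Omega>" "bounded \<Omega>" "\<Omega> \<noteq> {}"
    and "open \<Omega>m" "connected \<Omega>m" "\<Omega>m \<noteq> {}" "\<Omega>m \<subseteq> \<Omega>"
    and "C2_surface (frontier \<Omega>m)"
    and "\<alpha>p > 0" "\<alpha>m > 0"
    and "\<And>x. x \<in> \<Omega>m \<Longrightarrow> \<alpha> x = \<alpha>m"
    and "\<And>x. x \<in> \<Omega> - closure \<Omega>m \<Longrightarrow> \<alpha> x = \<alpha>p"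
    and "tetrahedral_mesh \<Omega> \<T>" "shape_regular \<sigma> \<T>"
    and "K \<in> \<T>" "K \<inter> frontier \<Omega>m \<noteq> {}"
    and "\<theta> < pi"
    and "boundary_triangulation (frontier \<Omega>m) \<theta> C K \<F>"
  shows "unisolvent K (Vf \<alpha> K \<F>) \<F> (dof K \<F>)"
proof -
  have K: "open_tetrahedron K" "K \<subseteq> \<Omega>"
    using assms(14,16) by (auto simp: tetrahedral_mesh_def)
  note bt = assms(19)[unfolded boundary_triangulation_def]
  note triangles = bt[THEN conjunct1] and facets = bt[THEN conjunct2, THEN conjunct2, THEN conjunct2]
  interpret triangulated_boundary K \<F>
  proof
    show "open_tetrahedron K" by (rule K(1))
    show "2 simplex F" if "F \<in> \<F>" for F
      using bspec[OF triangles that] by (rule conjunct1)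
    show "\<exists>G. G facet_of closure K \<and> F \<subseteq> G" if "F \<in> \<F>" for F
      using bspec[OF triangles that] by (rule conjunct2)
    fix G assume "G facet_of closure K"
    note G = mp[OF spec[OF facets] this]
    show "triangulation {F\<in>\<F>. F \<subseteq> G}" by (rule conjunct1[OF G])
    show "\<Union>{F\<in>\<F>. F \<subseteq> G} = G" by (rule conjunct1[OF conjunct2[OF G]])
  qed
  \<comment> \<open>A Borel function with two positive values on the whole space. On K it can differ
    from \<alpha> only on the interface, where \<alpha> is not prescribed.\<close>
  define a where "a x = (if x \<in> \<Omega>m then \<alpha>m else \<alpha>p)" for x
  have "AE x in lebesgue. x \<notin> frontier \<Omega>m"
    using C2_surface_negligible[OF assms(9)] by (intro AE_not_in) (simp add: negligible_iff_null_sets)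
  then have "AE x in lebesgue. x \<in> K \<longrightarrow> \<alpha> x = a x"
  proof eventually_elim
    case (elim x)
    show ?case
    proof
      assume "x \<in> K"
      then have "x \<in> \<Omega>m \<or> x \<in> \<Omega> - closure \<Omega>m"
        using K(2) elim assms(5) by (auto simp: frontier_def interior_open)
      then show "\<alpha> x = a x" using assms(12,13) closure_subset by (fastforce simp: a_def)
    qed
  qed
  then have "AE x in lebesgue_on K. \<alpha> x = a x" using Kp(1) by (subst AE_lebesgue_on_iff) auto
  moreover have [measurable]: "\<Omega>m \<in> sets borel" using assms(5) by simp
  have "a \<in> borel_measurable borel" unfolding a_def by measurable
  ultimately show ?thesis
    using assms(10,11) by (intro unisolvent_Vf[of a "min \<alpha>m \<alpha>p" "max \<alpha>m \<alpha>p"]) (auto simp: a_def)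
qed

end
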